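(* For every fixed integer $k\ge 2$, the decision problem \textsc{$k$-Limited Dominating Set} is $\mathsf{NP}$-complete.
   Context: All graphs are finite and simple. For a graph $G$, $N_G(u)$ denotes the open neighborhood of $u$. A set $D\subseteq V(G)$ is a dominating set if every vertex of $V(G)\setminus D$ has a neighbor in $D$. For an integer $k\ge 0$, a dominating set $D$ of $G$ is a $k$-limited dominating set if $|N_G(u)\setminus D|\le k$ for every $u\in D$. The problem \textsc{$k$-Limited Dominating Set} (for a fixed integer $k$) is the following. Instance: a graph $G$ and a positive integer $\ell$. Question: does $G$ admit a $k$-limited dominating set $D$ with $|D|\le \ell$? Here $k$ is fixed and $\ell$ is part of the input. *)

theory Defs
  imports "HOL-Computational_Algebra.Polynomial"
begin

datatype move = Left | Stay | Right

fun shift :: "move \<Rightarrow> int" where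
  "shift Left = - 1"
| "shift Stay = 0"
| "shift Right = 1"

text \<open>
  A transition \<open>(q, a, q', w)\<close> is enabled in state \<open>q\<close> when the \<open>i\<close>-th head scans the symbol
  \<open>a ! i\<close>; if \<open>w ! i = (b, d)\<close>, the \<open>i\<close>-th head then writes \<open>b\<close> and moves in direction \<open>d\<close>.
  The transitions form a relation, so machines are nondeterministic in general.
\<close>

record tm =
  tapes :: nat
  states :: "nat set"
  alphabet :: "nat set"
  start :: nat
  accept :: nat
  delta :: "(nat \<times> nat list \<times> nat \<times> (nat \<times> move) list) set"

abbreviation (input) blank :: nat where
  "blank \<equiv> 0"

definition bit_symbol :: "bool \<Rightarrow> nat" where
  "bit_symbol b = (if b then 2 else 1)"

text \<open>The accepting state is halting: it has no outgoing transition.\<close>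

definition wf_tm :: "tm \<Rightarrow> bool" where
  "wf_tm M \<longleftrightarrow>
     tapes M \<ge> 1 \<and>
     finite (states M) \<and> start M \<in> states M \<and> accept M \<in> states M \<and>
     finite (alphabet M) \<and> {blank, bit_symbol False, bit_symbol True} \<subseteq> alphabet M \<and>
     (\<forall>(q, a, q', w) \<in> delta M.
        q \<in> states M \<and> q \<noteq> accept M \<and> q' \<in> states M \<and>
        length a = tapes M \<and> set a \<subseteq> alphabet M \<and>
        length w = tapes M \<and> fst ` set w \<subseteq> alphabet M)"

definition deterministic :: "tm \<Rightarrow> bool" where
  "deterministic M \<longleftrightarrow>
     (\<forall>q a q' w q'' w'. (q, a, q', w) \<in> delta M \<and> (q, a, q'', w') \<in> delta M
        \<longrightarrow> q' = q'' \<and> w = w')"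

text \<open>Tapes are infinite in both directions; a tape comes with its head position.\<close>

type_synonym tape = "(int \<Rightarrow> nat) \<times> int"

type_synonym config = "nat \<times> tape list"

definition scanned :: "tape \<Rightarrow> nat" where
  "scanned = (\<lambda>(c, h). c h)"

definition act :: "nat \<times> move \<Rightarrow> tape \<Rightarrow> tape" where
  "act = (\<lambda>(b, d) (c, h). (c(h := b), h + shift d))"

inductive step :: "tm \<Rightarrow> config \<Rightarrow> config \<Rightarrow> bool" for M where
  "(q, map scanned ts, q', w) \<in> delta M \<Longrightarrow> step M (q, ts) (q', map2 act w ts)"

definition string_contents :: "bool list \<Rightarrow> int \<Rightarrow> nat" where
  "string_contents x i =
     (if 0 \<le> i \<and> i < int (length x) then bit_symbol (x ! nat i) else blank)"

definition initial :: "tm \<Rightarrow> bool list \<Rightarrow> config" where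
  "initial M x =
     (start M, (string_contents x, 0) # replicate (tapes M - 1) (string_contents [], 0))"

definition accepts_in :: "tm \<Rightarrow> bool list \<Rightarrow> nat \<Rightarrow> bool" where
  "accepts_in M x t \<longleftrightarrow> (\<exists>ts. (step M ^^ t) (initial M x) (accept M, ts))"

text \<open>The output is the string left on the first tape, which must otherwise be blank.\<close>

definition outputs_in :: "tm \<Rightarrow> bool list \<Rightarrow> nat \<Rightarrow> bool list \<Rightarrow> bool" where
  "outputs_in M x t y \<longleftrightarrow>
     (\<exists>ts. (step M ^^ t) (initial M x) (accept M, ts) \<and> fst (hd ts) = string_contents y)"

text \<open>
  A language is in NP if it is accepted by a nondeterministic machine such that every accepted
  input has an accepting computation of polynomial length.
\<close>

definition NP :: "bool list set set" where
  "NP = {A. \<exists>M (p :: nat poly). wf_tm M \<and>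
              (\<forall>x. x \<in> A \<longleftrightarrow> (\<exists>t. accepts_in M x t)) \<and>
              (\<forall>x\<in>A. \<exists>t \<le> poly p (length x). accepts_in M x t)}"

definition poly_time_computable :: "(bool list \<Rightarrow> bool list) \<Rightarrow> bool" where
  "poly_time_computable f \<longleftrightarrow>
     (\<exists>M (p :: nat poly). wf_tm M \<and> deterministic M \<and>
        (\<forall>x. \<exists>t \<le> poly p (length x). outputs_in M x t (f x)))"

definition poly_reducible :: "bool list set \<Rightarrow> bool list set \<Rightarrow> bool" where
  "poly_reducible A B \<longleftrightarrow> (\<exists>f. poly_time_computable f \<and> (\<forall>x. x \<in> A \<longleftrightarrow> f x \<in> B))"

definition NP_hard :: "bool list set \<Rightarrow> bool" where
  "NP_hard B \<longleftrightarrow> (\<forall>A\<in>NP. poly_reducible A B)"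

definition NP_complete :: "bool list set \<Rightarrow> bool" where
  "NP_complete B \<longleftrightarrow> B \<in> NP \<and> NP_hard B"

definition simple_graph :: "'a set \<Rightarrow> 'a set set \<Rightarrow> bool" where
  "simple_graph V E \<longleftrightarrow> finite V \<and> (\<forall>e\<in>E. e \<subseteq> V \<and> card e = 2)"

definition neighborhood :: "'a set set \<Rightarrow> 'a \<Rightarrow> 'a set" where
  "neighborhood E u = {v. {u, v} \<in> E}"

definition dominating_set :: "'a set \<Rightarrow> 'a set set \<Rightarrow> 'a set \<Rightarrow> bool" where
  "dominating_set V E D \<longleftrightarrow> D \<subseteq> V \<and> (\<forall>v\<in>V - D. neighborhood E v \<inter> D \<noteq> {})"

definition limited_dominating_set :: "nat \<Rightarrow> 'a set \<Rightarrow> 'a set set \<Rightarrow> 'a set \<Rightarrow> bool" where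
  "limited_dominating_set k V E D \<longleftrightarrow>
     dominating_set V E D \<and> (\<forall>u\<in>D. card (neighborhood E u - D) \<le> k)"

text \<open>Binary representation, least significant bit first, without superfluous zeros.\<close>

fun binary :: "nat \<Rightarrow> bool list" where
  "binary n = (if n = 0 then [] else odd n # binary (n div 2))"

declare binary.simps [simp del]

text \<open>
  An instance is a graph with vertex set \<open>{..<n}\<close> and a number \<open>l\<close>. It is encoded by \<open>n\<close> in unary,
  the rows of the adjacency matrix below the diagonal, and \<open>l\<close> in binary.
\<close>

definition encode_instance :: "nat \<Rightarrow> nat set set \<Rightarrow> nat \<Rightarrow> bool list" where
  "encode_instance n E l =
     replicate n True @ [False] @
     concat (map (\<lambda>i. map (\<lambda>j. {i, j} \<in> E) [0..<i]) [0..<n]) @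
     binary l"

definition LIMITED_DOMINATING_SET :: "nat \<Rightarrow> bool list set" where
  "LIMITED_DOMINATING_SET k =
     {encode_instance n E l | n E l.
        simple_graph {..<n} E \<and> l \<ge> 1 \<and>
        (\<exists>D. limited_dominating_set k {..<n} E D \<and> card D \<le> l)}"

lemma binary_inject: "binary m = binary n \<Longrightarrow> m = n"
proof (induction m arbitrary: n rule: less_induct)
  case (less m)
  show ?case
  proof (cases "m = 0 \<or> n = 0")
    case True
    then show ?thesis
      using less.prems by (auto simp: binary.simps[of m] binary.simps[of n] split: if_splits)
  next
    case False
    then have parity: "odd m = odd n" and tails: "binary (m div 2) = binary (n div 2)"
      using less.prems by (simp_all add: binary.simps[of m] binary.simps[of n])
    have "m div 2 = n div 2"
      using less.IH[of "m div 2"] tails False by simp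
    then show ?thesis
      using parity by presburger
  qed
qed

lemma replicate_True_False_inject:
  "replicate m True @ False # xs = replicate n True @ False # ys \<Longrightarrow> m = n \<and> xs = ys"
proof (induction m arbitrary: n)
  case 0
  then show ?case by (cases n) auto
next
  case (Suc m)
  then show ?case by (cases n) auto
qed

lemma simple_graph_edge:
  fixes E :: "nat set set"
  assumes "simple_graph {..<n} E" "e \<in> E"
  obtains i j where "e = {i, j}" "i < n" "j < i"
proof -
  have "card e = 2" "e \<subseteq> {..<n}"
    using assms by (simp_all add: simple_graph_def)
  then obtain x y where xy: "e = {x, y}" "x \<noteq> y"
    by (meson card_2_iff)
  then have "x < n" "y < n"
    using \<open>e \<subseteq> {..<n}\<close> by simp_all
  then show thesis
    using that[of x y] that[of y x] xy by (metis insert_commute linorder_neqE_nat)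
qed

lemma simple_graph_subsetI:
  fixes E E' :: "nat set set"
  assumes "simple_graph {..<n} E"
    and "\<And>i j. i < n \<Longrightarrow> j < i \<Longrightarrow> {i, j} \<in> E \<Longrightarrow> {i, j} \<in> E'"
  shows "E \<subseteq> E'"
proof
  fix e assume "e \<in> E"
  then show "e \<in> E'"
    using simple_graph_edge[OF assms(1) \<open>e \<in> E\<close>] assms(2) by metis
qed

lemma encode_instance_inject:
  assumes "simple_graph {..<n} E" "simple_graph {..<n'} E'"
    and "encode_instance n E l = encode_instance n' E' l'"
  shows "n = n' \<and> E = E' \<and> l = l'"
proof -
  define row where "row = (\<lambda>E (i::nat). map (\<lambda>j. {i, j} \<in> E) [0..<i])"
  define rows where "rows = (\<lambda>n E. concat (map (row E) [0..<n]))"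
  have enc: "encode_instance n E l = replicate n True @ False # rows n E @ binary l" for n E l
    by (simp add: encode_instance_def rows_def row_def)
  have n: "n = n'" and tail: "rows n E @ binary l = rows n' E' @ binary l'"
    using replicate_True_False_inject[OF assms(3)[unfolded enc]] by blast+
  have row_length: "length (row E i) = i" for E i
    by (simp add: row_def)
  have "length (rows n E) = length (rows n E')"
    by (simp add: rows_def length_concat o_def row_length)
  then have rows: "rows n E = rows n E'" and l: "binary l = binary l'"
    using tail unfolding n by simp_all
  have "row E i = row E' i" if "i < n" for i
    using rows that unfolding rows_def
  proof (induction n)
    case (Suc n)
    have "length (concat (map (row E) [0..<n])) = length (concat (map (row E') [0..<n]))"
      by (simp add: length_concat o_def row_length)
    then show ?case using Suc by (auto simp: less_Suc_eq)
  qed simp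
  then have edges: "{i, j} \<in> E \<longleftrightarrow> {i, j} \<in> E'" if "i < n" "j < i" for i j
    using that unfolding row_def map_eq_conv by (metis atLeastLessThan_iff set_upt zero_le)
  have "E \<subseteq> E'" "E' \<subseteq> E"
    using simple_graph_subsetI[OF assms(1)] simple_graph_subsetI[OF assms(2)] edges n by metis+
  then show ?thesis
    using n binary_inject[OF l] by blast
qed

end

theory Submission imports Defs begin

text \<open>
  Both parts of the proof rest on a small language of bounded arithmetic: expressions built from
  sums, products, truncated differences, bounded summation and queries to the input symbols compile
  to deterministic machines whose counters are head positions on otherwise blank tapes, so that every
  value is kept in unary and the running time is polynomial. Membership in NP then means writing the
  definition of the problem as such an expression over the input and a guessed string, and a
  reduction is polynomial-time computable as soon as its adjacency matrix is given by one.

  For hardness, a computation of length \<open>T\<close> of a nondeterministic machine is described by a tableau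
  whose entries are locally correct as soon as no two of them conflict; an accepting computation
  is a choice of one option per cell without conflicting options. Such a selection problem becomes
  a limited dominating set problem as follows. A budget of one vertex per part forces a
  choosing gadget to put either the vertex \<open>X\<close> (rejected) or the vertex \<open>Y\<close> (chosen) of every option
  into the set. A vertex outside the budget, adjacent to the \<open>Y\<close>-vertices of a cell, asks that one of
  them is chosen, and every conflict yields a vertex that is forced into the set with capacity 1 and
  is adjacent to the \<open>X\<close>-vertices of the two options, which therefore cannot both be chosen. A
  chosen \<open>Y\<close>-vertex has just two neighbours outside the set, which is where \<open>k \<ge> 2\<close> is used.
\<close>

section \<open>Structured programs for Turing machines\<close>

text \<open>Storing the whole transition at every head keeps the tableau conditions binary: the
  usual rule that derives a cell from its three predecessors relates four entries, whereas here
  every condition involves an entry and at most one other, which is the form that a conflict gadget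
  can forbid. Uniformity shapes the graph. Every pair \<open>(i, j)\<close> of options receives a
  full copy of all gadgets, whether or not it conflicts; the instance enters only through the arcs.
  So vertex numbers are digits in a mixed radix, the vertex count and the budget
  \<open>4 * m * m\<close> (four forced members per copy) are polynomials in \<open>T\<close>, and
  adjacency can be decided by bounded search without division. Unary counters create one difficulty:
  the number \<open>l\<close> of an instance is written in binary and may be exponential in the
  input length. The verifier therefore never computes \<open>l\<close>. A set has at most
  \<open>n\<close> members, so its size is compared with the low bits of \<open>l\<close>, and any
  high bit that is set decides at once. The reduction, in contrast, prints an \<open>l\<close> of
  polynomial size, which a counter can hold.\<close>

datatype cmd =
    Mv nat move
  | Wr nat nat move
  | Seq cmd cmd
  | If nat "nat set" cmd cmd
  | While nat "nat set" cmd

type_synonym store = "nat \<Rightarrow> tape"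

text \<open>The counts are exact step numbers of the code below: a true \<open>If\<close> pays for
  the test and for a jump over the other branch, a round of \<open>While\<close> for the test and
  the jump back.\<close>

inductive exec :: "cmd \<Rightarrow> store \<Rightarrow> nat \<Rightarrow> store \<Rightarrow> bool" where
  Mv: "exec (Mv r d) s 1 (s(r := act (scanned (s r), d) (s r)))"
| Wr: "exec (Wr r b d) s 1 (s(r := act (b, d) (s r)))"
| Seq: "exec c s t s' \<Longrightarrow> exec c' s' t' s'' \<Longrightarrow> exec (Seq c c') s (t + t') s''"
| IfTrue: "scanned (s r) \<in> A \<Longrightarrow> exec c s t s' \<Longrightarrow> exec (If r A c c') s (1 + t + 1) s'"
| IfFalse: "scanned (s r) \<notin> A \<Longrightarrow> exec c' s t s' \<Longrightarrow> exec (If r A c c') s (1 + t) s'"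
| WhileFalse: "scanned (s r) \<notin> A \<Longrightarrow> exec (While r A c) s 1 s"
| WhileTrue: "scanned (s r) \<in> A \<Longrightarrow> exec c s t s' \<Longrightarrow> exec (While r A c) s' t' s''
    \<Longrightarrow> exec (While r A c) s (1 + t + 1 + t') s''"

text \<open>Covers written symbols as well as tape numbers, since one bound will serve for
  both.\<close>

fun width :: "cmd \<Rightarrow> nat" where
  "width (Mv r d) = Suc r"
| "width (Wr r b d) = max (Suc r) (Suc b)"
| "width (Seq c c') = max (width c) (width c')"
| "width (If r A c c') = max (Suc r) (max (width c) (width c'))"
| "width (While r A c) = max (Suc r) (width c)"

text \<open>The number of control states. \<open>If\<close> and \<open>While\<close> own two besides
  those of their parts: the test and a closing jump.\<close>

fun len :: "cmd \<Rightarrow> nat" where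
  "len (Mv r d) = 1"
| "len (Wr r b d) = 1"
| "len (Seq c c') = len c + len c'"
| "len (If r A c c') = len c + len c' + 2"
| "len (While r A c) = len c + 2"

type_synonym transition = "nat \<times> nat list \<times> nat \<times> (nat \<times> move) list"

abbreviation stay :: "nat \<Rightarrow> nat \<times> move" where
  "stay b \<equiv> (b, Stay)"

text \<open>A single number \<open>K\<close> serves as the number of tapes and, through \<open>{..<K}\<close>, as the alphabet.\<close>

definition rules :: "nat \<Rightarrow> nat \<Rightarrow> nat \<Rightarrow> nat \<Rightarrow> nat set \<Rightarrow> (nat \<Rightarrow> nat \<times> move) \<Rightarrow> transition set" where
  "rules K q q' r A f =
     {(q, a, q', (map stay a)[r := f (a ! r)]) | a. length a = K \<and> set a \<subseteq> {..<K} \<and> a ! r \<in> A}"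

text \<open>A program is entered at state \<open>p\<close> and left at \<open>p\<close> plus its
  length. The jump that closes the true branch or the loop body sits right behind that block, which
  is why a failed test leads to \<open>p + len c + 2\<close>.\<close>

fun code :: "nat \<Rightarrow> cmd \<Rightarrow> nat \<Rightarrow> transition set" where
  "code K (Mv r d) p = rules K p (p + 1) r UNIV (\<lambda>b. (b, d))"
| "code K (Wr r b d) p = rules K p (p + 1) r UNIV (\<lambda>_. (b, d))"
| "code K (Seq c c') p = code K c p \<union> code K c' (p + len c)"
| "code K (If r A c c') p =
     rules K p (p + 1) r A stay \<union> rules K p (p + len c + 2) r (- A) stay
     \<union> code K c (p + 1) \<union> rules K (p + len c + 1) (p + len c + len c' + 2) r UNIV stay
     \<union> code K c' (p + len c + 2)"
| "code K (While r A c) p =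
     rules K p (p + 1) r A stay \<union> rules K p (p + len c + 2) r (- A) stay
     \<union> code K c (p + 1) \<union> rules K (p + len c + 1) p r UNIV stay"

section \<open>State intervals and determinism of compiled programs\<close>

lemma len_pos: "0 < len c"
  by (induction c) auto

lemma rules_bounds:
  assumes "(q, a, q', w) \<in> rules K q1 q2 r A f" "r < K" "\<And>b. b < K \<Longrightarrow> fst (f b) < K"
  shows "q = q1 \<and> q' = q2 \<and> length a = K \<and> set a \<subseteq> {..<K} \<and> length w = K \<and> fst ` set w \<subseteq> {..<K}"
proof -
  have a: "q = q1" "q' = q2" "length a = K" "set a \<subseteq> {..<K}" "w = (map stay a)[r := f (a ! r)]"
    using assms(1) by (auto simp: rules_def)
  then have "a ! r < K"
    using assms(2) nth_mem by blast
  then have "fst ` insert (f (a ! r)) (set (map stay a)) \<subseteq> {..<K}"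
    using a(4) assms(3) by auto
  then have "fst ` set w \<subseteq> {..<K}"
    using set_update_subset_insert[of "map stay a" r "f (a ! r)"] unfolding a(5) by (meson image_mono subset_trans)
  with a show ?thesis by simp
qed

text \<open>The strict upper bound on source states separates consecutive blocks and leaves the exit
  state without a rule; determinism and the halting accepting state rest on it.\<close>

lemma code_bounds:
  assumes "(q, a, q', w) \<in> code K c p" "width c \<le> K"
  shows "p \<le> q \<and> q < p + len c \<and> p \<le> q' \<and> q' \<le> p + len c \<and> length a = K \<and> set a \<subseteq> {..<K} \<and>
    length w = K \<and> fst ` set w \<subseteq> {..<K}"
  using assms
proof (induction c arbitrary: p)
  case (Mv r d)
  then show ?case using rules_bounds[of q a q' w K p "p + 1" r UNIV] by fastforce
next
  case (Wr r b d)
  then show ?case using rules_bounds[of q a q' w K p "p + 1" r UNIV] by fastforce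
next
  case (Seq c1 c2)
  then show ?case by fastforce
next
  case (If r A c1 c2)
  then have r: "r < K" and w: "width c1 \<le> K" "width c2 \<le> K" by auto
  have tb: "(q, a, q', w) \<in> rules K q1 q2 r A' stay \<Longrightarrow> q = q1 \<and> q' = q2 \<and> length a = K \<and>
    set a \<subseteq> {..<K} \<and> length w = K \<and> fst ` set w \<subseteq> {..<K}" for q1 q2 A'
    using rules_bounds[of q a q' w K q1 q2 r A' stay] r by simp
  show ?case
    using If.prems(1) If.IH(1)[OF _ w(1), of "p + 1"] If.IH(2)[OF _ w(2), of "p + len c1 + 2"]
      tb[of p "p + 1" A] tb[of p "p + len c1 + 2" "- A"]
      tb[of "p + len c1 + 1" "p + len c1 + len c2 + 2" UNIV]
    by (simp only: code.simps Un_iff len.simps) linarith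
next
  case (While r A c)
  then have r: "r < K" and w: "width c \<le> K" by auto
  have tb: "(q, a, q', w) \<in> rules K q1 q2 r A' stay \<Longrightarrow> q = q1 \<and> q' = q2 \<and> length a = K \<and>
    set a \<subseteq> {..<K} \<and> length w = K \<and> fst ` set w \<subseteq> {..<K}" for q1 q2 A'
    using rules_bounds[of q a q' w K q1 q2 r A' stay] r by simp
  show ?case
    using While.prems(1) While.IH(1)[OF _ w, of "p + 1"]
      tb[of p "p + 1" A] tb[of p "p + len c + 2" "- A"] tb[of "p + len c + 1" p UNIV]
    by (simp only: code.simps Un_iff len.simps) linarith
qed

definition functional :: "transition set \<Rightarrow> bool" where
  "functional \<Delta> \<longleftrightarrow> (\<forall>q a q' w q'' w'. (q, a, q', w) \<in> \<Delta> \<and> (q, a, q'', w') \<in> \<Delta> \<longrightarrow> q' = q'' \<and> w = w')"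

lemma functional_Un:
  assumes "functional X" "functional Y"
    and "\<And>q a q' w q'' w'. (q, a, q', w) \<in> X \<Longrightarrow> (q, a, q'', w') \<in> Y \<Longrightarrow> False"
  shows "functional (X \<union> Y)"
  using assms unfolding functional_def Un_iff by metis

lemma functional_rules: "functional (rules K q q' r A f)"
  by (auto simp: functional_def rules_def)

lemma rules_source: "(q, a, q', w) \<in> rules K q1 q2 r A f \<Longrightarrow> q = q1 \<and> a ! r \<in> A"
  by (auto simp: rules_def)

text \<open>Blocks own disjoint intervals of source states, and the two rules of a test share a
  state but require \<open>A\<close> and \<open>- A\<close> of the scanned symbol.\<close>

lemma functional_code: "width c \<le> K \<Longrightarrow> functional (code K c p)"
proof (induction c arbitrary: p)
  case (Seq c1 c2)
  then show ?case
    by (auto intro!: functional_Un dest!: code_bounds)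
next
  case (If r A c1 c2)
  show ?case
    unfolding code.simps using If
    by (intro functional_Un functional_rules) (auto dest!: rules_source code_bounds)
next
  case (While r A c)
  show ?case
    unfolding code.simps using While
    by (intro functional_Un functional_rules) (auto dest!: rules_source code_bounds)
qed (auto simp: functional_rules)

section \<open>Stores as configurations, and the simulation of programs by machine steps\<close>

definition conf :: "nat \<Rightarrow> store \<Rightarrow> tape list" where
  "conf K s = map s [0..<K]"

text \<open>There are rules only for symbols below \<open>K\<close>; a larger scanned symbol would
  block the machine.\<close>

definition valid :: "nat \<Rightarrow> store \<Rightarrow> bool" where
  "valid K s \<longleftrightarrow> (\<forall>r<K. \<forall>i. fst (s r) i < K)"

lemma valid_act: "valid K s \<Longrightarrow> b < K \<Longrightarrow> valid K (s(r := act (b, d) (s r)))"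
  by (auto simp: valid_def act_def split: prod.splits)

lemma scanned_valid: "valid K s \<Longrightarrow> r < K \<Longrightarrow> scanned (s r) < K"
  by (auto simp: valid_def scanned_def split: prod.splits)

lemma act_scanned_Stay: "act (scanned \<tau>, Stay) \<tau> = \<tau>"
  by (auto simp: act_def scanned_def split: prod.splits)

lemma map2_act_rules:
  assumes "(q0, map scanned (conf K s), q0', w) \<in> rules K q q' r A f" "r < K"
  shows "map2 act w (conf K s) = conf K (s(r := act (f (scanned (s r))) (s r)))"
proof -
  have "w = (map stay (map scanned (conf K s)))[r := f (scanned (s r))]"
    using assms by (auto simp: rules_def conf_def)
  then show ?thesis
    by (intro nth_equalityI) (auto simp: conf_def nth_list_update act_scanned_Stay)
qed

lemma step_rules:
  assumes "rules K q q' r A f \<subseteq> delta M" "valid K s" "r < K" "scanned (s r) \<in> A"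
  shows "step M (q, conf K s) (q', conf K (s(r := act (f (scanned (s r))) (s r))))"
proof -
  let ?a = "map scanned (conf K s)"
  let ?w = "(map stay ?a)[r := f (?a ! r)]"
  have ar: "?a ! r = scanned (s r)"
    using assms(3) by (simp add: conf_def)
  have w: "(q, ?a, q', ?w) \<in> rules K q q' r A f"
    unfolding rules_def using assms ar scanned_valid[OF assms(2)]
    by (auto simp: conf_def)
  then have "step M (q, conf K s) (q', map2 act ?w (conf K s))"
    using assms(1) by (intro step.intros) auto
  then show ?thesis
    using map2_act_rules[OF w assms(3)] by simp
qed

lemma step_rules_stay:
  assumes "rules K q q' r A stay \<subseteq> delta M" "valid K s" "r < K" "scanned (s r) \<in> A"
  shows "step M (q, conf K s) (q', conf K s)"
  using step_rules[OF assms] by (simp add: act_scanned_Stay)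

lemma relpowp_trans: "(R ^^ m) x y \<Longrightarrow> (R ^^ n) y z \<Longrightarrow> (R ^^ (m + n)) x z"
  by (auto simp: relpowp_add)

lemma relpowp_1I:
  fixes R :: "'a \<Rightarrow> 'a \<Rightarrow> bool"
  shows "R x y \<Longrightarrow> (R ^^ Suc 0) x y"
  by (rule relpowp_Suc_I[OF relpowp_0_I])

text \<open>Validity is carried along because every later step needs a rule for the symbols it
  scans; \<open>p\<close> is arbitrary in the induction because subprograms start at shifted
  states.\<close>

lemma simulation:
  assumes "exec c s t s'" "width c \<le> K" "valid K s" "code K c p \<subseteq> delta M"
  shows "(step M ^^ t) (p, conf K s) (p + len c, conf K s') \<and> valid K s'"
  using assms
proof (induction arbitrary: p rule: exec.induct)
  case (Mv r d s)
  then show ?case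
    using relpowp_1I[where R = "step M", OF step_rules[of K p "p + 1" r UNIV "\<lambda>b. (b, d)" M s]]
    by (simp del: relpowp.simps fun_upd_apply add: valid_act scanned_valid)
next
  case (Wr r b d s)
  then show ?case
    using relpowp_1I[where R = "step M", OF step_rules[of K p "p + 1" r UNIV "\<lambda>_. (b, d)" M s]]
    by (simp del: relpowp.simps fun_upd_apply add: valid_act)
next
  case (Seq c s t s' c' t' s'')
  have "(step M ^^ t) (p, conf K s) (p + len c, conf K s') \<and> valid K s'"
    using Seq.IH(1)[of p] Seq.prems by simp
  moreover from this have "(step M ^^ t') (p + len c, conf K s') (p + len c + len c', conf K s'') \<and> valid K s''"
    using Seq.IH(2)[of "p + len c"] Seq.prems by simp
  ultimately show ?case
    by (auto simp: add.assoc intro: relpowp_trans)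
next
  case (IfTrue s r A c t s' c')
  have 1: "step M (p, conf K s) (p + 1, conf K s)"
    using IfTrue by (intro step_rules_stay[where r = r and A = A]) auto
  have b: "(step M ^^ t) (p + 1, conf K s) (p + 1 + len c, conf K s') \<and> valid K s'"
    using IfTrue.IH[of "p + 1"] IfTrue.prems by simp
  have 3: "step M (p + 1 + len c, conf K s') (p + len c + len c' + 2, conf K s')"
    using IfTrue b by (intro step_rules_stay[where r = r and A = UNIV]) auto
  have "(step M ^^ (Suc 0 + t + Suc 0)) (p, conf K s) (p + len c + len c' + 2, conf K s')"
    using relpowp_trans[OF relpowp_trans[OF relpowp_1I[where R = "step M", OF 1] conjunct1[OF b]] relpowp_1I[where R = "step M", OF 3]] .
  with b show ?case by (simp add: ac_simps del: relpowp.simps)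
next
  case (IfFalse s r A c' t s' c)
  have 1: "step M (p, conf K s) (p + len c + 2, conf K s)"
    using IfFalse by (intro step_rules_stay[where r = r and A = "- A"]) auto
  have b: "(step M ^^ t) (p + len c + 2, conf K s) (p + len c + 2 + len c', conf K s') \<and> valid K s'"
    using IfFalse.IH[of "p + len c + 2"] IfFalse.prems by simp
  have "(step M ^^ (Suc 0 + t)) (p, conf K s) (p + len c + 2 + len c', conf K s')"
    using relpowp_trans[OF relpowp_1I[where R = "step M", OF 1] conjunct1[OF b]] .
  with b show ?case by (simp add: ac_simps del: relpowp.simps)
next
  case (WhileFalse s r A c)
  then have "step M (p, conf K s) (p + len c + 2, conf K s)"
    by (intro step_rules_stay[where r = r and A = "- A"]) auto
  then have "(step M ^^ 1) (p, conf K s) (p + len c + 2, conf K s)"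
    unfolding One_nat_def by (rule relpowp_1I)
  with WhileFalse show ?case by (simp add: add.assoc del: relpowp.simps)
next
  case (WhileTrue s r A c t s' t' s'')
  have 1: "step M (p, conf K s) (p + 1, conf K s)"
    using WhileTrue by (intro step_rules_stay[where r = r and A = A]) auto
  have 2: "(step M ^^ t) (p + 1, conf K s) (p + 1 + len c, conf K s') \<and> valid K s'"
    using WhileTrue.IH(1)[of "p + 1"] WhileTrue.prems by simp
  have 3: "step M (p + 1 + len c, conf K s') (p, conf K s')"
    using WhileTrue 2 by (intro step_rules_stay[where r = r and A = UNIV]) auto
  have 4: "(step M ^^ t') (p, conf K s') (p + len (While r A c), conf K s'') \<and> valid K s''"
    using WhileTrue.IH(2)[of p] WhileTrue.prems 2 by simp
  have "(step M ^^ (Suc 0 + t + Suc 0 + t')) (p, conf K s) (p + len (While r A c), conf K s'')"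
    using relpowp_trans[OF relpowp_trans[OF relpowp_trans[OF relpowp_1I[where R = "step M", OF 1] conjunct1[OF 2]] relpowp_1I[where R = "step M", OF 3]] conjunct1[OF 4]] .
  with 4 show ?case by (simp del: relpowp.simps)
qed

section \<open>Tape layout\<close>

text \<open>Keeping only an upper bound lets branches of different length and loops that depend on
  data have closed-form times.\<close>

definition runs :: "cmd \<Rightarrow> nat \<Rightarrow> store \<Rightarrow> store \<Rightarrow> bool" where
  "runs c T s s' \<longleftrightarrow> (\<exists>t\<le>T. exec c s t s')"

lemma runs_mono: "runs c T s s' \<Longrightarrow> T \<le> T' \<Longrightarrow> runs c T' s s'"
  unfolding runs_def using le_trans by blast

lemma runs_Mv: "s' = s(r := act (scanned (s r), d) (s r)) \<Longrightarrow> runs (Mv r d) 1 s s'"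
  unfolding runs_def using exec.Mv by blast

lemma runs_Wr: "s' = s(r := act (b, d) (s r)) \<Longrightarrow> runs (Wr r b d) 1 s s'"
  unfolding runs_def using exec.Wr by blast

lemma runs_Seq: "runs c T s s' \<Longrightarrow> runs c' T' s' s'' \<Longrightarrow> runs (Seq c c') (T + T') s s''"
  unfolding runs_def using exec.Seq add_mono by metis

lemma runs_IfTrue: "scanned (s r) \<in> A \<Longrightarrow> runs c T s s' \<Longrightarrow> runs (If r A c c') (T + 2) s s'"
proof -
  assume "scanned (s r) \<in> A" "runs c T s s'"
  then obtain t where "t \<le> T" "exec (If r A c c') s (1 + t + 1) s'"
    unfolding runs_def using exec.IfTrue by blast
  then show ?thesis
    unfolding runs_def by (intro exI[of _ "1 + t + 1"]) simp
qed

lemma runs_IfFalse: "scanned (s r) \<notin> A \<Longrightarrow> runs c' T s s' \<Longrightarrow> runs (If r A c c') (T + 2) s s'"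
proof -
  assume "scanned (s r) \<notin> A" "runs c' T s s'"
  then obtain t where "t \<le> T" "exec (If r A c c') s (1 + t) s'"
    unfolding runs_def using exec.IfFalse by blast
  then show ?thesis
    unfolding runs_def by (intro exI[of _ "1 + t"]) simp
qed

lemma runs_While:
  assumes "\<And>i. i < n \<Longrightarrow> scanned (S i r) \<in> A" "\<And>i. i < n \<Longrightarrow> runs c T (S i) (S (Suc i))"
    and "scanned (S n r) \<notin> A"
  shows "runs (While r A c) (n * (T + 2) + 1) (S 0) (S n)"
  using assms
proof (induction n arbitrary: S)
  case 0
  then show ?case
    unfolding runs_def using exec.WhileFalse by fastforce
next
  case (Suc n)
  have "runs (While r A c) (n * (T + 2) + 1) (S (Suc 0)) (S (Suc n))"
    using Suc.IH[of "\<lambda>i. S (Suc i)"] Suc.prems by simp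
  then obtain t' where t': "t' \<le> n * (T + 2) + 1" "exec (While r A c) (S (Suc 0)) t' (S (Suc n))"
    unfolding runs_def by blast
  obtain t where t: "t \<le> T" "exec c (S 0) t (S (Suc 0))"
    using Suc.prems(2)[of 0] unfolding runs_def by blast
  have "exec (While r A c) (S 0) (1 + t + 1 + t') (S (Suc n))"
    using Suc.prems(1)[of 0] t t'
    by (intro exec.WhileTrue) auto
  with t t' show ?case
    unfolding runs_def by (intro exI[of _ "1 + t + 1 + t'"]) auto
qed

text \<open>
  The working layout: tape 0 collects the output \<open>y\<close>, tapes 1 and 2 hold the input \<open>x\<close> and a
  guess \<open>g\<close>, and the other tapes are counters. On each tape \<open>r \<ge> 1\<close> the cell \<open>-1\<close> carries the end
  marker 3, and the counter value \<open>h r\<close> is the distance of the head from that marker.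
\<close>

definition contents :: "bool list \<Rightarrow> bool list \<Rightarrow> nat \<Rightarrow> bool list" where
  "contents x g r = (if r = 1 then x else if r = 2 then g else [])"

definition layout :: "bool list \<Rightarrow> bool list \<Rightarrow> bool list \<Rightarrow> (nat \<Rightarrow> nat) \<Rightarrow> store" where
  "layout x g y h r =
     (if r = 0 then (string_contents y, int (length y))
      else ((string_contents (contents x g r))(-1 := 3), int (h r) - 1))"

lemma string_contents_neq3: "string_contents x i \<noteq> 3"
  by (auto simp: string_contents_def bit_symbol_def)

lemma string_contents_le2: "string_contents x i \<le> 2"
  by (auto simp: string_contents_def bit_symbol_def)

lemma scanned_layout:
  "r \<noteq> 0 \<Longrightarrow> scanned (layout x g y h r) =
    (if h r = 0 then 3 else string_contents (contents x g r) (int (h r) - 1))"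
  by (auto simp: scanned_def layout_def)

lemma scanned_layout_3: "r \<noteq> 0 \<Longrightarrow> scanned (layout x g y h r) = 3 \<longleftrightarrow> h r = 0"
  by (simp add: scanned_layout string_contents_neq3)

section \<open>Counters as head positions\<close>

lemma runs_inc:
  assumes "r \<noteq> 0" "h' = h(r := Suc (h r))"
  shows "runs (Mv r Right) 1 (layout x g y h) (layout x g y h')"
proof -
  have "(layout x g y h)(r := act (scanned (layout x g y h r), Right) (layout x g y h r)) = layout x g y h'"
    using assms by (auto simp: fun_eq_iff layout_def act_def scanned_def)
  then show ?thesis by (intro runs_Mv) simp
qed

text \<open>Passing from \<open>m - n\<close> to \<open>m - Suc n\<close> is the form in which
  successive rounds of a countdown chain.\<close>

lemma runs_dec:
  assumes "r \<noteq> 0" "n < m"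
  shows "runs (Mv r Left) 1 (layout x g y (h(r := m - n))) (layout x g y (h(r := m - Suc n)))"
proof -
  let ?s = "layout x g y (h(r := m - n))"
  have "?s(r := act (scanned (?s r), Left) (?s r)) = layout x g y (h(r := m - Suc n))"
    using assms by (auto simp: fun_eq_iff layout_def act_def scanned_def)
  then show ?thesis by (intro runs_Mv) simp
qed

lemma runs_skip: "runs (Mv r Stay) 1 s s"
  by (rule runs_Mv) (simp add: act_scanned_Stay)

definition loop :: "nat \<Rightarrow> cmd \<Rightarrow> cmd" where
  "loop r c = While r (- {3}) (Seq (Mv r Left) c)"

text \<open>\<open>H i\<close> and \<open>Y i\<close> describe the counters and the output after
  \<open>i\<close> rounds, with the entry for \<open>r\<close> overwritten. The counter is
  decremented before the body runs, hence \<open>n - Suc i\<close> on both sides.\<close>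

lemma runs_loop:
  assumes "r \<noteq> 0"
    and "\<And>i. i < n \<Longrightarrow> runs c T (layout x g (Y i) ((H i)(r := n - Suc i)))
      (layout x g (Y (Suc i)) ((H (Suc i))(r := n - Suc i)))"
    and "h = (H 0)(r := n)" "h' = (H n)(r := 0)" "y = Y 0" "y' = Y n"
  shows "runs (loop r c) (n * (T + 3) + 1) (layout x g y h) (layout x g y' h')"
proof -
  let ?S = "\<lambda>i. layout x g (Y i) ((H i)(r := n - i))"
  have "runs (Seq (Mv r Left) c) (1 + T) (?S i) (?S (Suc i))" if "i < n" for i
    using runs_Seq[OF runs_dec[OF assms(1) that] assms(2)[OF that]] .
  then have "runs (While r (- {3}) (Seq (Mv r Left) c)) (n * (1 + T + 2) + 1) (?S 0) (?S n)"
    using scanned_layout_3[OF assms(1)] by (intro runs_While[where S = ?S]) simp_all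
  then show ?thesis
    using assms(3-6) by (simp add: loop_def eval_nat_numeral)
qed

definition clear :: "nat \<Rightarrow> cmd" where
  "clear r = While r (- {3}) (Mv r Left)"

lemma runs_clear:
  assumes "r \<noteq> 0" "h' = h(r := 0)" "h r \<le> N"
  shows "runs (clear r) (N * 3 + 1) (layout x g y h) (layout x g y h')"
proof -
  let ?S = "\<lambda>i. layout x g y (h(r := h r - i))"
  have a: "scanned (?S i r) \<in> - {3}" if "i < h r" for i
    using assms that by (simp add: scanned_layout_3)
  have b: "runs (Mv r Left) 1 (?S i) (?S (Suc i))" if "i < h r" for i
    using assms(1) that by (rule runs_dec)
  have c: "scanned (?S (h r) r) \<notin> - {3}"
    using assms by (simp add: scanned_layout_3)
  have "runs (While r (- {3}) (Mv r Left)) (h r * (1 + 2) + 1) (?S 0) (?S (h r))"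
    by (rule runs_While[where S = ?S, OF a b c])
  then have "runs (clear r) (h r * (1 + 2) + 1) (layout x g y h) (layout x g y h')"
    by (simp add: clear_def assms(2))
  then show ?thesis
    by (rule runs_mono) (use mult_le_mono1[OF assms(3), of 3] in simp)
qed

text \<open>A head position is read by moving it down, so addition empties its source, and a copy
  needs a spare counter.\<close>

definition add_to :: "nat \<Rightarrow> nat \<Rightarrow> cmd" where
  "add_to r r' = loop r (Mv r' Right)"

lemma runs_add_to:
  assumes "r \<noteq> 0" "r' \<noteq> 0" "r \<noteq> r'" "h' = h(r := 0, r' := h r' + h r)" "h r \<le> N"
  shows "runs (add_to r r') (N * 4 + 1) (layout x g y h) (layout x g y h')"
proof -
  let ?H = "\<lambda>i. h(r' := h r' + i)"
  have "runs (Mv r' Right) 1 (layout x g y ((?H i)(r := h r - Suc i)))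
      (layout x g y ((?H (Suc i))(r := h r - Suc i)))" for i
    using assms(2,3) by (intro runs_inc) (auto simp: fun_eq_iff)
  then have "runs (loop r (Mv r' Right)) (h r * (1 + 3) + 1) (layout x g y h)
      (layout x g y h')"
    by (intro runs_loop[where Y = "\<lambda>_. y" and H = ?H]) (use assms in \<open>auto simp: fun_eq_iff\<close>)
  then have "runs (add_to r r') (h r * (1 + 3) + 1) (layout x g y h) (layout x g y h')"
    by (simp add: add_to_def)
  then show ?thesis
    by (rule runs_mono) (use mult_le_mono1[OF assms(5), of 4] in simp)
qed

text \<open>
  The prologue moves the input from tape 0 to tape 1 and its length to tape 3. Tape 3 gets its end
  marker first: later no trace of its origin would be left.
\<close>

definition mark :: "nat \<Rightarrow> cmd" where
  "mark r = Seq (Mv r Left) (Wr r 3 Stay)"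

fun mark_from :: "nat \<Rightarrow> nat \<Rightarrow> cmd" where
  "mark_from r 0 = mark r"
| "mark_from r (Suc n) = Seq (mark r) (mark_from (Suc r) n)"

definition rewind :: "nat \<Rightarrow> cmd" where
  "rewind r = Seq (Mv r Left) (Seq (While r {1, 2} (Mv r Left)) (Wr r 3 Stay))"

definition copy_input :: cmd where
  "copy_input = While 0 {1, 2} (Seq (If 0 {1} (Wr 1 1 Right) (Wr 1 2 Right)) (Seq (Mv 0 Right) (Mv 3 Right)))"

definition erase_input :: cmd where
  "erase_input = Seq (Mv 0 Left) (Seq (While 0 {1, 2} (Wr 0 0 Left)) (Mv 0 Right))"

text \<open>\<open>mark_from r n\<close> marks \<open>n + 1\<close> tapes, so \<open>K - 4\<close>
  stands for the tapes 3 to \<open>K - 1\<close>; tapes 1 and 2 receive their marker from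
  \<open>rewind\<close>.\<close>

definition prologue :: "nat \<Rightarrow> cmd" where
  "prologue K = Seq (mark_from 3 (K - 4)) (Seq copy_input (Seq erase_input (Seq (rewind 1) (rewind 2))))"

text \<open>The guess is written from left to right, so its head starts behind the last symbol. With
  \<open>g = []\<close> this is an initial configuration.\<close>

definition start_store :: "bool list \<Rightarrow> bool list \<Rightarrow> store" where
  "start_store x g r = (if r = 0 then (string_contents x, 0)
     else if r = 2 then (string_contents g, int (length g)) else (string_contents [], 0))"

lemma width_mark_from: "width (mark_from r n) = max 4 (r + n + 1)"
  by (induction n arbitrary: r) (auto simp: mark_def)

lemma width_prologue: "4 \<le> K \<Longrightarrow> width (prologue K) = K"
  by (simp add: prologue_def width_mark_from copy_input_def erase_input_def rewind_def)

lemma string_contents_nth: "i < length x \<Longrightarrow> string_contents x (int i) = bit_symbol (x ! i)"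
  by (simp add: string_contents_def)

lemma bit_symbol_in: "bit_symbol b \<in> {1, 2}"
  by (simp add: bit_symbol_def)

lemma string_contents_append:
  "(string_contents x)(int (length x) := bit_symbol b) = string_contents (x @ [b])"
  by (auto simp: fun_eq_iff string_contents_def nth_append)

lemma string_contents_Nil: "string_contents [] i = 0"
  by (simp add: string_contents_def)

lemma runs_mark:
  assumes "s r = (string_contents [], 0)"
  shows "runs (mark r) 2 s (s(r := ((string_contents [])(-1 := 3), -1)))"
proof -
  have "runs (mark r) (1 + 1) s (s(r := ((string_contents [])(-1 := 3), -1)))"
    unfolding mark_def
    by (rule runs_Seq[OF runs_Mv[OF refl] runs_Wr]) (simp add: assms act_def scanned_def fun_upd_idem)
  then show ?thesis by (simp add: numeral_2_eq_2)
qed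

lemma runs_mark_from:
  assumes "\<And>i. r \<le> i \<Longrightarrow> s i = (string_contents [], 0)"
  shows "runs (mark_from r n) (2 * n + 2) s
    (\<lambda>i. if r \<le> i \<and> i \<le> r + n then ((string_contents [])(-1 := 3), -1) else s i)"
  using assms
proof (induction n arbitrary: r s)
  case (0 r s)
  have *: "s(r := ((string_contents [])(-1 := 3), -1)) =
    (\<lambda>i. if r \<le> i \<and> i \<le> r + 0 then ((string_contents [])(-1 := 3), -1) else s i)"
    by (rule ext) simp
  show ?case
    using runs_mono[OF runs_mark[of s r, OF 0[OF le_refl]]] unfolding * mark_from.simps by simp
next
  case (Suc n r s)
  let ?s = "s(r := ((string_contents [])(-1 := 3), -1))"
  let ?s' = "\<lambda>i. if Suc r \<le> i \<and> i \<le> Suc r + n then ((string_contents [])(-1 := 3), -1) else ?s i"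
  have "runs (mark_from (Suc r) n) (2 * n + 2) ?s ?s'"
    by (rule Suc.IH) (simp add: Suc.prems)
  moreover have "?s' = (\<lambda>i. if r \<le> i \<and> i \<le> r + Suc n then ((string_contents [])(-1 := 3), -1) else s i)"
    by (rule ext) auto
  ultimately have "runs (mark_from r (Suc n)) (2 + (2 * n + 2)) s
    (\<lambda>i. if r \<le> i \<and> i \<le> r + Suc n then ((string_contents [])(-1 := 3), -1) else s i)"
    using runs_Seq[OF runs_mark[of s r, OF Suc.prems[OF le_refl]]] by (simp only: mark_from.simps)
  then show ?case by simp
qed

lemma runs_rewind:
  assumes "s r = (string_contents x, int (length x))"
  shows "runs (rewind r) (3 * length x + 3) s (s(r := ((string_contents x)(-1 := 3), -1)))"
proof -
  let ?S = "\<lambda>i. s(r := (string_contents x, int (length x) - 1 - int i))"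
  have 1: "runs (Mv r Left) 1 s (?S 0)"
    by (rule runs_Mv) (simp add: assms act_def scanned_def)
  have b: "runs (Mv r Left) 1 (?S i) (?S (Suc i))" for i
    by (rule runs_Mv) (auto simp: act_def scanned_def)
  have a: "scanned (?S i r) \<in> {1, 2}" if "i < length x" for i
    using that bit_symbol_in by (auto simp: scanned_def string_contents_def)
  \<comment> \<open>The head is now on cell -1, which is still blank and stops the scan.\<close>
  have c: "scanned (?S (length x) r) \<notin> {1, 2}"
    by (auto simp: scanned_def string_contents_def)
  have 2: "runs (While r {1, 2} (Mv r Left)) (length x * (1 + 2) + 1) (?S 0) (?S (length x))"
    by (rule runs_While[where S = ?S, OF a b c])
  have 3: "runs (Wr r 3 Stay) 1 (?S (length x)) (s(r := ((string_contents x)(-1 := 3), -1)))"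
    by (rule runs_Wr) (simp add: act_def scanned_def)
  show ?thesis
    unfolding rewind_def using runs_Seq[OF 1 runs_Seq[OF 2 3]] by (rule runs_mono) simp
qed

lemma runs_copy_input:
  assumes "s 0 = (string_contents x, 0)" "s 1 = (string_contents [], 0)" "s 3 = (c, -1)"
  shows "runs copy_input (7 * length x + 1) s
    (s(0 := (string_contents x, int (length x)), 1 := (string_contents x, int (length x)),
       3 := (c, int (length x) - 1)))"
proof -
  let ?S = "\<lambda>i. s(0 := (string_contents x, int i), 1 := (string_contents (take i x), int i),
       3 := (c, int i - 1))"
  have b: "runs (Seq (If 0 {1} (Wr 1 1 Right) (Wr 1 2 Right)) (Seq (Mv 0 Right) (Mv 3 Right))) (3 + (1 + 1))
      (?S i) (?S (Suc i))" if i: "i < length x" for i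
  proof (rule runs_Seq)
    let ?s = "(?S i)(1 := (string_contents (take (Suc i) x), int (Suc i)))"
    have *: "(string_contents (take i x))(int i := bit_symbol (x ! i)) = string_contents (take (Suc i) x)"
      using string_contents_append[of "take i x" "x ! i"] i by (simp add: take_Suc_conv_app_nth)
    have sc: "scanned (?S i 0) = bit_symbol (x ! i)"
      using i by (simp add: scanned_def string_contents_nth)
    have "runs (If 0 {1} (Wr 1 1 Right) (Wr 1 2 Right)) (1 + 2) (?S i) ?s"
    proof (cases "x ! i")
      case True
      then have "runs (Wr 1 2 Right) 1 (?S i) ?s"
        using * by (intro runs_Wr) (auto simp: act_def bit_symbol_def fun_eq_iff)
      then show ?thesis
        using sc True by (intro runs_IfFalse) (auto simp: bit_symbol_def)
    next
      case False
      then have "runs (Wr 1 1 Right) 1 (?S i) ?s"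
        using * by (intro runs_Wr) (auto simp: act_def bit_symbol_def fun_eq_iff)
      then show ?thesis
        using sc False by (intro runs_IfTrue) (auto simp: bit_symbol_def)
    qed
    then show "runs (If 0 {1} (Wr 1 1 Right) (Wr 1 2 Right)) 3 (?S i) ?s"
      by (rule runs_mono) simp
    let ?s' = "?s(0 := (string_contents x, int (Suc i)))"
    show "runs (Seq (Mv 0 Right) (Mv 3 Right)) (1 + 1) ?s (?S (Suc i))"
    proof (rule runs_Seq)
      show "runs (Mv 0 Right) 1 ?s ?s'"
        by (rule runs_Mv) (auto simp: act_def scanned_def fun_eq_iff)
      show "runs (Mv 3 Right) 1 ?s' (?S (Suc i))"
        by (rule runs_Mv) (auto simp: act_def scanned_def fun_eq_iff)
    qed
  qed
  have a: "scanned (?S i 0) \<in> {1, 2}" if "i < length x" for i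
    using that bit_symbol_in by (auto simp: scanned_def string_contents_def)
  have c: "scanned (?S (length x) 0) \<notin> {1, 2}"
    by (auto simp: scanned_def string_contents_def)
  have "runs copy_input (length x * (3 + (1 + 1) + 2) + 1) (?S 0) (?S (length x))"
    unfolding copy_input_def by (rule runs_While[where S = ?S, OF a b c])
  moreover have "?S 0 = s"
    using assms by (auto simp: fun_eq_iff)
  ultimately show ?thesis
    by (simp add: mult.commute)
qed

lemma runs_erase_input:
  assumes "s 0 = (string_contents x, int (length x))"
  shows "runs erase_input (3 * length x + 3) s (s(0 := (string_contents [], 0)))"
proof -
  let ?S = "\<lambda>i. s(0 := (string_contents (take (length x - i) x), int (length x) - 1 - int i))"
  have 1: "runs (Mv 0 Left) 1 s (?S 0)"
    by (rule runs_Mv) (simp add: assms act_def scanned_def)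
  have b: "runs (Wr 0 0 Left) 1 (?S i) (?S (Suc i))" if i: "i < length x" for i
  proof -
    have "(string_contents (take (length x - i) x))(int (length x) - 1 - int i := 0) =
      string_contents (take (length x - Suc i) x)"
      using i by (auto simp: string_contents_def fun_eq_iff nat_less_iff zless_nat_eq_int_zless)
    then show ?thesis
      by (intro runs_Wr) (auto simp: act_def scanned_def fun_eq_iff)
  qed
  have a: "scanned (?S i 0) \<in> {1, 2}" if "i < length x" for i
    using that bit_symbol_in by (auto simp: scanned_def string_contents_def)
  have c: "scanned (?S (length x) 0) \<notin> {1, 2}"
    by (auto simp: scanned_def string_contents_def)
  have 2: "runs (While 0 {1, 2} (Wr 0 0 Left)) (length x * (1 + 2) + 1) (?S 0) (?S (length x))"
    by (rule runs_While[where S = ?S, OF a b c])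
  have 3: "runs (Mv 0 Right) 1 (?S (length x)) (s(0 := (string_contents [], 0)))"
    by (rule runs_Mv) (auto simp: act_def scanned_def fun_eq_iff)
  show ?thesis
    unfolding erase_input_def using runs_Seq[OF 1 runs_Seq[OF 2 3]] by (rule runs_mono) simp
qed

text \<open>On the unused tapes \<open>r \<ge> K\<close> the layout has a marker that is never written, hence the restriction.\<close>

lemma runs_prologue:
  assumes "4 \<le> K"
  shows "\<exists>s. runs (prologue K) (2 * K + 13 * length x + 3 * length g + 10) (start_store x g) s \<and>
    (\<forall>r<K. s r = layout x g [] ((\<lambda>_. 0)(3 := length x)) r)"
proof -
  let ?b = "((string_contents [])(-1 := 3), -1)"
  define s1 where "s1 = (\<lambda>i. if 3 \<le> i \<and> i \<le> 3 + (K - 4) then ?b else start_store x g i)"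
  have 1: "runs (mark_from 3 (K - 4)) (2 * (K - 4) + 2) (start_store x g) s1"
    unfolding s1_def by (intro runs_mark_from) (auto simp: start_store_def)
  define s2 where "s2 = s1(0 := (string_contents x, int (length x)), 1 := (string_contents x, int (length x)),
       3 := (fst ?b, int (length x) - 1))"
  have 2: "runs copy_input (7 * length x + 1) s1 s2"
    unfolding s2_def by (intro runs_copy_input) (auto simp: s1_def start_store_def)
  define s3 where "s3 = s2(0 := (string_contents [], 0))"
  have 3: "runs erase_input (3 * length x + 3) s2 s3"
    unfolding s3_def by (intro runs_erase_input) (auto simp: s2_def)
  define s4 where "s4 = s3(1 := ((string_contents x)(-1 := 3), -1))"
  have 4: "runs (rewind 1) (3 * length x + 3) s3 s4"
    unfolding s4_def by (intro runs_rewind) (auto simp: s3_def s2_def)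
  define s5 where "s5 = s4(2 := ((string_contents g)(-1 := 3), -1))"
  have 5: "runs (rewind 2) (3 * length g + 3) s4 s5"
    unfolding s5_def by (intro runs_rewind) (auto simp: s4_def s3_def s2_def s1_def start_store_def)
  have "runs (prologue K) (2 * K + 13 * length x + 3 * length g + 10) (start_store x g) s5"
    unfolding prologue_def
    by (rule runs_mono[OF runs_Seq[OF 1 runs_Seq[OF 2 runs_Seq[OF 3 runs_Seq[OF 4 5]]]]]) (use assms in simp)
  moreover have "s5 r = layout x g [] ((\<lambda>_. 0)(3 := length x)) r" if "r < K" for r
    using that assms
    by (auto simp: s5_def s4_def s3_def s2_def s1_def start_store_def layout_def contents_def)
  ultimately show ?thesis by blast
qed

section \<open>Compiling bounded arithmetic\<close>

text \<open>\<open>Sum\<close> is the sole binder and the sole loop. Its range is computed before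
  the first round, which keeps values and times polynomial in the variables.\<close>

datatype exp =
    Const nat
  | Var nat
  | Add exp exp
  | Mul exp exp
  | Sub exp exp
  | Sum nat exp exp
  | Sym bool exp

type_synonym env = "nat \<Rightarrow> nat"

fun eval :: "bool list \<Rightarrow> bool list \<Rightarrow> exp \<Rightarrow> env \<Rightarrow> nat" where
  "eval x g (Const c) \<sigma> = c"
| "eval x g (Var v) \<sigma> = \<sigma> v"
| "eval x g (Add a b) \<sigma> = eval x g a \<sigma> + eval x g b \<sigma>"
| "eval x g (Mul a b) \<sigma> = eval x g a \<sigma> * eval x g b \<sigma>"
| "eval x g (Sub a b) \<sigma> = eval x g a \<sigma> - eval x g b \<sigma>"
| "eval x g (Sum v a b) \<sigma> = (\<Sum>i<eval x g a \<sigma>. eval x g b (\<sigma>(v := i)))"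
| "eval x g (Sym guess a) \<sigma> = string_contents (if guess then g else x) (int (eval x g a \<sigma>))"

text \<open>There is no empty command, so adding 0 becomes a move that stays put.\<close>

fun incs :: "nat \<Rightarrow> nat \<Rightarrow> cmd" where
  "incs d 0 = Mv d Stay"
| "incs d (Suc n) = Seq (Mv d Right) (incs d n)"

text \<open>
  \<open>compile e \<rho> d\<close> evaluates \<open>e\<close> into counter \<open>d\<close>, where variable \<open>v\<close> lives in counter \<open>\<rho> v < d\<close>;
  the counters from \<open>d\<close> on are free and initially zero.
\<close>

fun compile :: "exp \<Rightarrow> (nat \<Rightarrow> nat) \<Rightarrow> nat \<Rightarrow> cmd" where
  "compile (Const c) \<rho> d = incs d c"
| "compile (Var v) \<rho> d =
     Seq (loop (\<rho> v) (Seq (Mv d Right) (Mv (d + 1) Right))) (add_to (d + 1) (\<rho> v))"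
| "compile (Add a b) \<rho> d = Seq (compile a \<rho> d) (Seq (compile b \<rho> (d + 1)) (add_to (d + 1) d))"
| "compile (Mul a b) \<rho> d =
     Seq (compile a \<rho> d)
       (Seq (loop d (Seq (compile b \<rho> (d + 2)) (add_to (d + 2) (d + 1)))) (add_to (d + 1) d))"
| "compile (Sub a b) \<rho> d =
     Seq (compile a \<rho> d) (Seq (compile b \<rho> (d + 1)) (loop (d + 1) (If d {3} (Mv d Stay) (Mv d Left))))"
| "compile (Sum v a b) \<rho> d =
     Seq (compile a \<rho> d)
       (Seq (loop d
              (Seq (compile b (\<rho>(v := d + 1)) (d + 3)) (Seq (add_to (d + 3) (d + 2)) (Mv (d + 1) Right))))
         (Seq (clear (d + 1)) (add_to (d + 2) d)))"
| "compile (Sym guess a) \<rho> d =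
     (let r = (if guess then 2 else 1) in
      Seq (compile a \<rho> d)
       (Seq (add_to d r)
         (Seq (Mv r Right)
           (Seq (If r {1} (Mv d Right) (If r {2} (Seq (Mv d Right) (Mv d Right)) (Mv d Stay)))
              (clear r)))))"

text \<open>\<open>N\<close> bounds every variable. Inside \<open>Sum\<close> the bound variable may
  be larger, up to the range; \<open>N + val_bound a N\<close>, rather than a maximum, keeps the
  bound a polynomial.\<close>

fun val_bound :: "exp \<Rightarrow> nat \<Rightarrow> nat" where
  "val_bound (Const c) = (\<lambda>N. c)"
| "val_bound (Var v) = (\<lambda>N. N)"
| "val_bound (Add a b) = (\<lambda>N. val_bound a N + val_bound b N)"
| "val_bound (Mul a b) = (\<lambda>N. val_bound a N * val_bound b N)"
| "val_bound (Sub a b) = (\<lambda>N. val_bound a N)"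
| "val_bound (Sum v a b) = (\<lambda>N. val_bound a N * val_bound b (N + val_bound a N))"
| "val_bound (Sym guess a) = (\<lambda>N. 2)"

text \<open>A round of \<open>loop\<close> costs 3 more than its body. This gives 4 for
  \<open>add_to\<close>, 5 for the double increment in \<open>Var\<close> and 6 for the guarded
  decrement in \<open>Sub\<close>; a round of \<open>clear\<close> costs 3.\<close>

fun time_bound :: "exp \<Rightarrow> nat \<Rightarrow> nat" where
  "time_bound (Const c) = (\<lambda>N. c + 1)"
| "time_bound (Var v) = (\<lambda>N. (N * 5 + 1) + (N * 4 + 1))"
| "time_bound (Add a b) = (\<lambda>N. time_bound a N + (time_bound b N + (val_bound b N * 4 + 1)))"
| "time_bound (Mul a b) = (\<lambda>N.
     time_bound a N + ((val_bound a N * (time_bound b N + (val_bound b N * 4 + 1) + 3) + 1) +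
       (val_bound a N * val_bound b N * 4 + 1)))"
| "time_bound (Sub a b) = (\<lambda>N. time_bound a N + (time_bound b N + (val_bound b N * 6 + 1)))"
| "time_bound (Sum v a b) = (\<lambda>N.
     (let k = val_bound a N; N' = N + k in
      time_bound a N +
       ((k * (time_bound b N' + ((val_bound b N' * 4 + 1) + 1) + 3) + 1) +
        ((k * 3 + 1) + (k * val_bound b N' * 4 + 1)))))"
| "time_bound (Sym guess a) = (\<lambda>N.
     time_bound a N + ((val_bound a N * 4 + 1) + (1 + (6 + (Suc (val_bound a N) * 3 + 1)))))"

lemma eval_le_val_bound: "(\<And>v. \<sigma> v \<le> N) \<Longrightarrow> eval x g e \<sigma> \<le> val_bound e N"
proof (induction e arbitrary: \<sigma> N)
  case (Mul a b)
  then show ?case by (simp add: mult_mono)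
next
  case (Sub a b)
  then show ?case by (auto intro: le_trans[OF diff_le_self])
next
  case (Sum v a b)
  have a: "eval x g a \<sigma> \<le> val_bound a N"
    using Sum by simp
  have "eval x g b (\<sigma>(v := i)) \<le> val_bound b (N + val_bound a N)" if "i < eval x g a \<sigma>" for i
    using a that Sum.prems by (intro Sum.IH(2)) (auto intro: trans_le_add1)
  then have "(\<Sum>i<eval x g a \<sigma>. eval x g b (\<sigma>(v := i))) \<le>
    eval x g a \<sigma> * val_bound b (N + val_bound a N)"
    using sum_bounded_above[of "{..<eval x g a \<sigma>}" "\<lambda>i. eval x g b (\<sigma>(v := i))"
        "val_bound b (N + val_bound a N)"] by simp
  also have "\<dots> \<le> val_bound a N * val_bound b (N + val_bound a N)"
    using a by simp
  finally show ?case by simp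
qed (auto simp: add_mono string_contents_le2)

section \<open>Correctness of compiled expressions\<close>

lemma runs_incs:
  assumes "d \<noteq> 0"
  shows "runs (incs d n) (n + 1) (layout x g y h) (layout x g y (h(d := h d + n)))"
proof (induction n arbitrary: h)
  case 0
  then show ?case using runs_skip[of d "layout x g y h"] by simp
next
  case (Suc n)
  have "runs (incs d (Suc n)) (1 + (n + 1)) (layout x g y h)
    (layout x g y ((h(d := Suc (h d)))(d := (h(d := Suc (h d))) d + n)))"
    unfolding incs.simps by (rule runs_Seq[OF runs_inc[OF assms refl] Suc])
  then show ?case by (simp del: fun_upd_apply add: fun_upd_same)
qed

lemma runs_cong:
  "runs c T s (layout x g y h) \<Longrightarrow> h = h' \<Longrightarrow> T \<le> T' \<Longrightarrow> runs c T' s (layout x g y h')"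
  using runs_mono by blast

text \<open>Counters 1 and 2 are the heads on the input and the guess. They rest on their markers
  between evaluations, so that \<open>Sym\<close> can fill them like counters. All temporaries from
  \<open>d\<close> on are 0 again except for the result, so the operands can be evaluated one after
  another in fresh counters.\<close>

lemma runs_compile:
  assumes "\<And>v. 3 \<le> \<rho> v \<and> \<rho> v < d" "\<And>r. d \<le> r \<Longrightarrow> h r = 0" "h 1 = 0" "h 2 = 0"
    and "\<And>v. h (\<rho> v) \<le> N"
  shows "runs (compile e \<rho> d) (time_bound e N) (layout x g y h)
    (layout x g y (h(d := eval x g e (\<lambda>v. h (\<rho> v)))))"
  using assms
proof (induction e arbitrary: \<rho> d h N)
  case (Const c)
  have "d \<noteq> 0" "h d = 0" using Const.prems(1)[of 0] Const.prems(2)[of d] by simp_all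
  then show ?case using runs_incs[of d c x g y h] by (simp del: fun_upd_apply)
next
  case (Var v)
  let ?n = "h (\<rho> v)"
  have d: "\<rho> v \<noteq> 0" "d \<noteq> 0" "h d = 0" "h (Suc d) = 0" "\<rho> v < d"
    using Var.prems(1)[of v] Var.prems(2)[of d] Var.prems(2)[of "Suc d"] by auto
  let ?H = "\<lambda>i. h(d := i, Suc d := i)"
  have b: "runs (Seq (Mv d Right) (Mv (Suc d) Right)) (1 + 1)
    (layout x g y ((?H i)(\<rho> v := ?n - Suc i))) (layout x g y ((?H (Suc i))(\<rho> v := ?n - Suc i)))" for i
    by (rule runs_Seq[OF runs_inc[OF d(2) refl] runs_inc]) (use d in \<open>auto simp: fun_eq_iff\<close>)
  have 1: "runs (loop (\<rho> v) (Seq (Mv d Right) (Mv (Suc d) Right))) (?n * (1 + 1 + 3) + 1)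
    (layout x g y h) (layout x g y ((?H ?n)(\<rho> v := 0)))"
    by (rule runs_loop[where Y = "\<lambda>_. y" and H = ?H, OF _ b]) (use d in \<open>auto simp: fun_eq_iff\<close>)
  let ?h = "(?H ?n)(\<rho> v := 0)"
  \<comment> \<open>The second copy restores the variable, which the first loop has emptied.\<close>
  have 2: "runs (add_to (Suc d) (\<rho> v)) (?n * 4 + 1) (layout x g y ?h) (layout x g y (h(d := ?n)))"
    by (rule runs_add_to) (use d in \<open>auto simp: fun_eq_iff\<close>)
  from runs_Seq[OF 1 2] have "runs (compile (Var v) \<rho> d) (?n * (1 + 1 + 3) + 1 + (?n * 4 + 1)) (layout x g y h)
    (layout x g y (h(d := ?n)))" by simp
  then show ?case
    unfolding eval.simps by (rule runs_mono) (use Var.prems(5)[of v] in simp)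
next
  case (Add a b)
  let ?\<sigma> = "\<lambda>v. h (\<rho> v)" let ?a = "eval x g a ?\<sigma>" let ?b = "eval x g b ?\<sigma>"
  let ?h = "h(d := ?a)"
  have d: "d \<noteq> 0" "3 < d" using Add.prems(1)[of 0] by auto
  have \<rho>: "\<rho> v \<noteq> d" for v using Add.prems(1)[of v] by simp
  have 1: "runs (compile a \<rho> d) (time_bound a N) (layout x g y h) (layout x g y ?h)"
    using Add by blast
  have "runs (compile b \<rho> (d + 1)) (time_bound b N) (layout x g y ?h)
      (layout x g y (?h(d + 1 := eval x g b (\<lambda>v. ?h (\<rho> v)))))"
    using Add.prems d \<rho> by (intro Add.IH(2)) (auto simp: less_Suc_eq)
  then have 2: "runs (compile b \<rho> (d + 1)) (time_bound b N) (layout x g y ?h) (layout x g y (?h(d + 1 := ?b)))"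
    using \<rho> by simp
  have 3: "runs (add_to (d + 1) d) (val_bound b N * 4 + 1) (layout x g y (?h(d + 1 := ?b)))
      (layout x g y (h(d := ?a + ?b)))"
    by (rule runs_add_to)
      (use d Add.prems(2)[of "d + 1"] eval_le_val_bound[OF Add.prems(5)] in \<open>auto simp: fun_eq_iff\<close>)
  show ?case
    using runs_Seq[OF 1 runs_Seq[OF 2 3]] by (simp del: fun_upd_apply)
next
  case (Mul a b)
  let ?\<sigma> = "\<lambda>v. h (\<rho> v)" let ?a = "eval x g a ?\<sigma>" let ?b = "eval x g b ?\<sigma>"
  have d: "d \<noteq> 0" "3 < d" using Mul.prems(1)[of 0] by auto
  have \<rho>: "\<rho> v \<noteq> d" "\<rho> v < d" "\<rho> v \<noteq> d + 1" "\<rho> v \<noteq> Suc d" "\<rho> v \<noteq> d + 2" for v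
    using Mul.prems(1)[of v] by simp_all
  have h: "h d = 0" "h (d + 1) = 0" "h (Suc d) = 0" "h (d + 2) = 0"
    using Mul.prems(2) by simp_all
  have vb: "?a \<le> val_bound a N" "?b \<le> val_bound b N"
    using Mul.prems by (auto intro!: eval_le_val_bound)
  have 1: "runs (compile a \<rho> d) (time_bound a N) (layout x g y h) (layout x g y (h(d := ?a)))"
    using Mul by blast
  let ?H = "\<lambda>i. h(d + 1 := i * ?b)"
  have b: "runs (Seq (compile b \<rho> (d + 2)) (add_to (d + 2) (d + 1))) (time_bound b N + (val_bound b N * 4 + 1))
    (layout x g y ((?H i)(d := ?a - Suc i))) (layout x g y ((?H (Suc i))(d := ?a - Suc i)))" for i
  proof -
    let ?h = "(?H i)(d := ?a - Suc i)"
    let ?h' = "?h(d + 2 := ?b)"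
    have \<sigma>: "(\<lambda>v. ?h (\<rho> v)) = ?\<sigma>" using \<rho> by auto
    have "runs (compile b \<rho> (d + 2)) (time_bound b N) (layout x g y ?h)
      (layout x g y (?h(d + 2 := eval x g b (\<lambda>v. ?h (\<rho> v)))))"
      using Mul.prems d \<rho> by (intro Mul.IH(2)) (auto simp: less_Suc_eq)
    then have 1: "runs (compile b \<rho> (d + 2)) (time_bound b N) (layout x g y ?h) (layout x g y ?h')"
      unfolding \<sigma> .
    have 2: "runs (add_to (d + 2) (d + 1)) (val_bound b N * 4 + 1) (layout x g y ?h')
      (layout x g y ((?H (Suc i))(d := ?a - Suc i)))"
      by (rule runs_add_to) (use d h vb in \<open>auto simp: fun_eq_iff\<close>)
    show ?thesis using runs_Seq[OF 1 2] .
  qed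
  let ?h = "h(d + 1 := ?a * ?b, d := 0)"
  have "runs (loop d (Seq (compile b \<rho> (d + 2)) (add_to (d + 2) (d + 1))))
    (?a * (time_bound b N + (val_bound b N * 4 + 1) + 3) + 1)
    (layout x g y (h(d := ?a))) (layout x g y ?h)"
    by (rule runs_loop[where Y = "\<lambda>_. y" and H = ?H, OF _ b]) (use d h in \<open>auto simp: fun_eq_iff\<close>)
  then have 2: "runs (loop d (Seq (compile b \<rho> (d + 2)) (add_to (d + 2) (d + 1))))
    (val_bound a N * (time_bound b N + (val_bound b N * 4 + 1) + 3) + 1)
    (layout x g y (h(d := ?a))) (layout x g y ?h)"
    by (rule runs_mono) (intro add_mono mult_mono le_refl vb; simp)
  have 3: "runs (add_to (d + 1) d) (val_bound a N * val_bound b N * 4 + 1) (layout x g y ?h)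
    (layout x g y (h(d := ?a * ?b)))"
    by (rule runs_add_to) (use d h mult_mono[OF vb] in \<open>auto simp: fun_eq_iff\<close>)
  show ?case
    using runs_Seq[OF 1 runs_Seq[OF 2 3]] by (simp del: fun_upd_apply)
next
  case (Sub a b)
  let ?\<sigma> = "\<lambda>v. h (\<rho> v)" let ?a = "eval x g a ?\<sigma>" let ?b = "eval x g b ?\<sigma>"
  let ?h = "h(d := ?a)"
  have d: "d \<noteq> 0" "3 < d" using Sub.prems(1)[of 0] by auto
  have \<rho>: "\<rho> v \<noteq> d" for v using Sub.prems(1)[of v] by simp
  have 1: "runs (compile a \<rho> d) (time_bound a N) (layout x g y h) (layout x g y ?h)"
    using Sub by blast
  have "runs (compile b \<rho> (d + 1)) (time_bound b N) (layout x g y ?h)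
      (layout x g y (?h(d + 1 := eval x g b (\<lambda>v. ?h (\<rho> v)))))"
    using Sub.prems d \<rho> by (intro Sub.IH(2)) (auto simp: less_Suc_eq)
  then have 2: "runs (compile b \<rho> (d + 1)) (time_bound b N) (layout x g y ?h) (layout x g y (?h(d + 1 := ?b)))"
    using \<rho> by simp
  let ?H = "\<lambda>i. h(d := ?a - i)"
  \<comment> \<open>The test for the marker keeps the head from passing the end of its tape; this
    makes the difference truncated.\<close>
  have b: "runs (If d {3} (Mv d Stay) (Mv d Left)) (1 + 2) (layout x g y ((?H i)(d + 1 := ?b - Suc i)))
    (layout x g y ((?H (Suc i))(d + 1 := ?b - Suc i)))" for i
  proof (cases "i < ?a")
    case True
    have "runs (Mv d Left) 1 (layout x g y ((h(d + 1 := ?b - Suc i))(d := ?a - i)))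
      (layout x g y ((h(d + 1 := ?b - Suc i))(d := ?a - Suc i)))"
      using d(1) True by (rule runs_dec)
    then have "runs (Mv d Left) 1 (layout x g y ((?H i)(d + 1 := ?b - Suc i)))
      (layout x g y ((?H (Suc i))(d + 1 := ?b - Suc i)))"
      by (simp add: fun_upd_twist)
    then show ?thesis
      using d True by (intro runs_IfFalse) (simp_all add: scanned_layout_3)
  next
    case False
    then show ?thesis
      using d by (intro runs_IfTrue) (simp_all add: scanned_layout_3 runs_skip[simplified])
  qed
  have "runs (loop (d + 1) (If d {3} (Mv d Stay) (Mv d Left))) (?b * (1 + 2 + 3) + 1)
    (layout x g y (?h(d + 1 := ?b))) (layout x g y (h(d := ?a - ?b)))"
    by (rule runs_loop[where Y = "\<lambda>_. y" and H = ?H, OF _ b])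
      (use d Sub.prems(2)[of "d + 1"] in \<open>auto simp: fun_eq_iff\<close>)
  moreover have "?b \<le> val_bound b N"
    using Sub.prems by (intro eval_le_val_bound) auto
  ultimately have 3: "runs (loop (d + 1) (If d {3} (Mv d Stay) (Mv d Left))) (val_bound b N * 6 + 1)
    (layout x g y (?h(d + 1 := ?b))) (layout x g y (h(d := ?a - ?b)))"
    by (elim runs_mono) simp
  show ?case
    using runs_Seq[OF 1 runs_Seq[OF 2 3]] by (simp del: fun_upd_apply)
next
  case (Sum v a b)
  let ?\<sigma> = "\<lambda>v. h (\<rho> v)" let ?a = "eval x g a ?\<sigma>" let ?b = "\<lambda>i. eval x g b (?\<sigma>(v := i))"
  define k where "k = val_bound a N"
  let ?N = "N + k"
  let ?t = "time_bound b ?N + ((val_bound b ?N * 4 + 1) + 1)"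
  have d: "d \<noteq> 0" "3 < d" using Sum.prems(1)[of 0] by auto
  have \<rho>: "\<rho> v \<noteq> d" "\<rho> v < d" "\<rho> v \<noteq> d + 1" "\<rho> v \<noteq> Suc d" "\<rho> v \<noteq> d + 2" "\<rho> v \<noteq> Suc (Suc d)"
    "3 \<le> \<rho> v" "\<rho> v < d + 3" for v
    using Sum.prems(1)[of v] by simp_all
  have h: "h d = 0" "h (d + 1) = 0" "h (Suc d) = 0" "h (d + 2) = 0" "h (Suc (Suc d)) = 0" "h (d + 3) = 0"
    using Sum.prems(2) by simp_all
  have a: "?a \<le> k"
    unfolding k_def using Sum.prems by (auto intro!: eval_le_val_bound)
  have bb: "?b i \<le> val_bound b ?N" if "i < ?a" for i
    using Sum.prems a that by (intro eval_le_val_bound) (auto intro: trans_le_add1)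
  have 1: "runs (compile a \<rho> d) (time_bound a N) (layout x g y h) (layout x g y (h(d := ?a)))"
    using Sum by blast
  \<comment> \<open>While \<open>d\<close> counts down the rounds, \<open>d + 1\<close> holds the
    bound variable and \<open>d + 2\<close> the partial sum.\<close>
  let ?H = "\<lambda>i. h(d + 1 := i, d + 2 := (\<Sum>j<i. ?b j))"
  let ?c = "Seq (compile b (\<rho>(v := d + 1)) (d + 3)) (Seq (add_to (d + 3) (d + 2)) (Mv (d + 1) Right))"
  have b: "runs ?c ?t (layout x g y ((?H i)(d := ?a - Suc i))) (layout x g y ((?H (Suc i))(d := ?a - Suc i)))"
    if i: "i < ?a" for i
  proof -
    let ?h = "(?H i)(d := ?a - Suc i)"
    let ?h' = "?h(d + 3 := ?b i)"
    let ?h'' = "(?H i)(d := ?a - Suc i, d + 2 := (\<Sum>j<Suc i. ?b j))"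
    have \<sigma>: "(\<lambda>w. ?h ((\<rho>(v := d + 1)) w)) = ?\<sigma>(v := i)" using \<rho> by (auto simp: fun_eq_iff)
    have "runs (compile b (\<rho>(v := d + 1)) (d + 3)) (time_bound b ?N) (layout x g y ?h)
      (layout x g y (?h(d + 3 := eval x g b (\<lambda>w. ?h ((\<rho>(v := d + 1)) w)))))"
    proof (rule Sum.IH(2))
      show "3 \<le> (\<rho>(v := d + 1)) w \<and> (\<rho>(v := d + 1)) w < d + 3" for w
        using \<rho>[of w] d by auto
      have "(?\<sigma>(v := i)) w \<le> ?N" for w
        using Sum.prems(5)[of w] a i by (auto intro: trans_le_add1)
      then show "?h ((\<rho>(v := d + 1)) w) \<le> ?N" for w
        using \<sigma> by metis
    qed (use d Sum.prems in auto)
    then have 1: "runs (compile b (\<rho>(v := d + 1)) (d + 3)) (time_bound b ?N) (layout x g y ?h) (layout x g y ?h')"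
      unfolding \<sigma> .
    have 2: "runs (add_to (d + 3) (d + 2)) (val_bound b ?N * 4 + 1) (layout x g y ?h') (layout x g y ?h'')"
      by (rule runs_add_to) (use d h bb[OF i] in \<open>auto simp: fun_eq_iff\<close>)
    have 3: "runs (Mv (d + 1) Right) 1 (layout x g y ?h'')
      (layout x g y ((?H (Suc i))(d := ?a - Suc i)))"
      by (rule runs_inc) (auto simp: fun_eq_iff)
    show ?thesis using runs_Seq[OF 1 runs_Seq[OF 2 3]] .
  qed
  let ?S = "\<Sum>i<?a. ?b i"
  let ?h = "h(d + 1 := ?a, d + 2 := ?S, d := 0)"
  let ?h' = "h(d + 2 := ?S)"
  have "runs (loop d ?c) (?a * (?t + 3) + 1) (layout x g y (h(d := ?a))) (layout x g y ?h)"
    by (rule runs_loop[where Y = "\<lambda>_. y" and H = ?H, OF _ b]) (use d h in \<open>auto simp: fun_eq_iff\<close>)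
  then have 2: "runs (loop d ?c) (k * (?t + 3) + 1) (layout x g y (h(d := ?a))) (layout x g y ?h)"
    by (rule runs_mono) (intro add_mono mult_mono le_refl a; simp)
  have 3: "runs (clear (d + 1)) (k * 3 + 1) (layout x g y ?h) (layout x g y ?h')"
    by (rule runs_clear) (use a h in \<open>auto simp: fun_eq_iff\<close>)
  have "?S \<le> ?a * val_bound b ?N"
    using sum_bounded_above[of "{..<?a}" ?b "val_bound b ?N"] bb by simp
  then have "?S \<le> k * val_bound b ?N"
    using mult_le_mono1[OF a] le_trans by blast
  then have 4: "runs (add_to (d + 2) d) (k * val_bound b ?N * 4 + 1) (layout x g y ?h')
    (layout x g y (h(d := ?S)))"
    by (intro runs_add_to) (use d h in \<open>auto simp: fun_eq_iff\<close>)
  show ?case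
    using runs_Seq[OF 1 runs_Seq[OF 2 runs_Seq[OF 3 4]]] by (simp add: Let_def k_def del: fun_upd_apply)
next
  case (Sym guess a)
  define r :: nat where "r = (if guess then 2 else 1)"
  let ?\<sigma> = "\<lambda>v. h (\<rho> v)" let ?a = "eval x g a ?\<sigma>"
  let ?w = "if guess then g else x"
  let ?b = "string_contents ?w (int ?a)"
  have d: "d \<noteq> 0" "3 < d" using Sym.prems(1)[of 0] by auto
  have h: "h d = 0" "h r = 0" using Sym.prems(2,3,4) by (auto simp: r_def)
  have r: "r \<noteq> 0" "r \<noteq> d" "contents x g r = ?w" using d by (auto simp: r_def contents_def)
  have a: "?a \<le> val_bound a N" using Sym.prems by (auto intro!: eval_le_val_bound)
  have 1: "runs (compile a \<rho> d) (time_bound a N) (layout x g y h) (layout x g y (h(d := ?a)))"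
    using Sym by blast
  have 2: "runs (add_to d r) (val_bound a N * 4 + 1) (layout x g y (h(d := ?a)))
    (layout x g y (h(r := ?a)))"
    by (rule runs_add_to) (use d r a h in \<open>auto simp: fun_eq_iff\<close>)
  \<comment> \<open>A counter with value \<open>a\<close> stands on cell \<open>a - 1\<close>, so
    one more move is needed to scan cell \<open>a\<close>.\<close>
  let ?h = "h(r := Suc ?a)"
  let ?h' = "?h(d := ?b)"
  have 3: "runs (Mv r Right) 1 (layout x g y (h(r := ?a))) (layout x g y ?h)"
    by (rule runs_inc[OF r(1)]) simp
  have sc: "scanned (layout x g y ?h r) = ?b"
    using r by (simp add: scanned_layout)
  have inc: "runs (Mv d Right) 1 (layout x g y ?h) (layout x g y (?h(d := 1)))"
    by (rule runs_inc[OF d(1)]) (use h r in simp)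
  have inc2: "runs (Mv d Right) 1 (layout x g y (?h(d := 1))) (layout x g y (?h(d := 2)))"
    by (rule runs_inc[OF d(1)]) (simp add: numeral_2_eq_2)
  have "?b = 0 \<or> ?b = 1 \<or> ?b = 2"
    using string_contents_le2[of ?w "int ?a"] by linarith
  then have 4: "runs (If r {1} (Mv d Right) (If r {2} (Seq (Mv d Right) (Mv d Right)) (Mv d Stay))) 6
    (layout x g y ?h) (layout x g y ?h')"
  proof (elim disjE)
    assume b: "?b = 0"
    have "runs (If r {1} (Mv d Right) (If r {2} (Seq (Mv d Right) (Mv d Right)) (Mv d Stay))) (1 + 2 + 2)
      (layout x g y ?h) (layout x g y ?h)"
      by (intro runs_IfFalse runs_skip) (use sc b in simp_all)
    then show ?thesis by (rule runs_cong) (use b h r in \<open>auto simp: fun_eq_iff\<close>)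
  next
    assume b: "?b = 1"
    then have "runs (If r {1} (Mv d Right) (If r {2} (Seq (Mv d Right) (Mv d Right)) (Mv d Stay))) (1 + 2)
      (layout x g y ?h) (layout x g y ?h')"
      using sc inc by (intro runs_IfTrue) simp_all
    then show ?thesis by (rule runs_mono) simp
  next
    assume b: "?b = 2"
    then have "runs (If r {1} (Mv d Right) (If r {2} (Seq (Mv d Right) (Mv d Right)) (Mv d Stay))) (1 + 1 + 2 + 2)
      (layout x g y ?h) (layout x g y ?h')"
      using sc runs_Seq[OF inc inc2] by (intro runs_IfFalse runs_IfTrue) simp_all
    then show ?thesis by (rule runs_mono) simp
  qed
  have 5: "runs (clear r) (Suc (val_bound a N) * 3 + 1) (layout x g y ?h') (layout x g y (h(d := ?b)))"
    by (rule runs_clear) (use r a h in \<open>auto simp: fun_eq_iff\<close>)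
  show ?case
    using runs_Seq[OF 1 runs_Seq[OF 2 runs_Seq[OF 3 runs_Seq[OF 4 5]]]]
    by (simp only: compile.simps Let_def r_def time_bound.simps eval.simps)
qed

section \<open>Polynomial time\<close>

definition poly_bounded :: "(nat \<Rightarrow> nat) \<Rightarrow> bool" where
  "poly_bounded f \<longleftrightarrow> (\<exists>p. \<forall>n. f n \<le> poly p n)"

lemma poly_bounded_const: "poly_bounded (\<lambda>n. c)"
  unfolding poly_bounded_def by (rule exI[of _ "[:c:]"]) simp

lemma poly_bounded_ident: "poly_bounded (\<lambda>n. n)"
  unfolding poly_bounded_def by (rule exI[of _ "[:0, 1:]"]) simp

lemma poly_bounded_add: "poly_bounded f \<Longrightarrow> poly_bounded g \<Longrightarrow> poly_bounded (\<lambda>n. f n + g n)"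
  unfolding poly_bounded_def by (metis add_mono poly_add)

lemma poly_bounded_mult: "poly_bounded f \<Longrightarrow> poly_bounded g \<Longrightarrow> poly_bounded (\<lambda>n. f n * g n)"
  unfolding poly_bounded_def by (metis mult_le_mono poly_mult)

lemma poly_nat_mono: "m \<le> n \<Longrightarrow> poly p m \<le> poly (p :: nat poly) n"
  by (induction p) (auto intro!: add_mono mult_mono)

text \<open>Polynomials with natural coefficients are monotone, so the bound for \<open>g\<close>
  may be substituted into the bound for \<open>f\<close>.\<close>

lemma poly_bounded_compose:
  assumes "poly_bounded f" "poly_bounded g"
  shows "poly_bounded (\<lambda>n. f (g n))"
proof -
  obtain p q where p: "\<And>n. f n \<le> poly p n" and q: "\<And>n. g n \<le> poly q n"
    using assms unfolding poly_bounded_def by blast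
  have "f (g n) \<le> poly (pcompose p q) n" for n
    using le_trans[OF p poly_nat_mono[OF q]] by (simp add: poly_pcompose)
  then show ?thesis
    unfolding poly_bounded_def by blast
qed

lemmas poly_bounded_intros =
  poly_bounded_const poly_bounded_ident poly_bounded_add poly_bounded_mult

lemma poly_bounded_Suc: "poly_bounded f \<Longrightarrow> poly_bounded (\<lambda>n. Suc (f n))"
  using poly_bounded_add[OF _ poly_bounded_const[of 1]] by simp

lemma poly_bounded_val_bound: "poly_bounded (val_bound e)"
proof (induction e)
  case (Sum v a b)
  have "poly_bounded (\<lambda>N. val_bound b (N + val_bound a N))"
    by (rule poly_bounded_compose[OF Sum(2) poly_bounded_add[OF poly_bounded_ident Sum(1)]])
  then show ?case
    unfolding val_bound.simps by (rule poly_bounded_mult[OF Sum(1)])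
qed (unfold val_bound.simps, (assumption | rule poly_bounded_intros)+)

lemma poly_bounded_time_bound: "poly_bounded (time_bound e)"
proof (induction e)
  case (Sum v a b)
  note vb = poly_bounded_val_bound
  have "poly_bounded (\<lambda>N. val_bound b (N + val_bound a N))" "poly_bounded (\<lambda>N. time_bound b (N + val_bound a N))"
    using poly_bounded_compose[OF vb[of b] poly_bounded_add[OF poly_bounded_ident vb[of a]]]
      poly_bounded_compose[OF Sum(2) poly_bounded_add[OF poly_bounded_ident vb[of a]]] .
  with Sum vb[of a] show ?case
    unfolding time_bound.simps Let_def by (intro poly_bounded_intros)
qed (unfold time_bound.simps, (intro poly_bounded_intros poly_bounded_Suc poly_bounded_val_bound; assumption?)+)

section \<open>Programs that print a bit string\<close>

datatype out =
    Emit exp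
  | OSeq out out
  | OFor nat exp out

fun emitted :: "bool list \<Rightarrow> bool list \<Rightarrow> out \<Rightarrow> env \<Rightarrow> bool list" where
  "emitted x g (Emit e) \<sigma> = [eval x g e \<sigma> \<noteq> 0]"
| "emitted x g (OSeq a b) \<sigma> = emitted x g a \<sigma> @ emitted x g b \<sigma>"
| "emitted x g (OFor v e a) \<sigma> = concat (map (\<lambda>i. emitted x g a (\<sigma>(v := i))) [0..<eval x g e \<sigma>])"

fun compile_out :: "out \<Rightarrow> (nat \<Rightarrow> nat) \<Rightarrow> nat \<Rightarrow> cmd" where
  "compile_out (Emit e) \<rho> d = Seq (compile e \<rho> d) (Seq (If d {3} (Wr 0 1 Right) (Wr 0 2 Right)) (clear d))"
| "compile_out (OSeq a b) \<rho> d = Seq (compile_out a \<rho> d) (compile_out b \<rho> d)"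
| "compile_out (OFor v e a) \<rho> d =
     Seq (compile e \<rho> d)
       (Seq (loop d (Seq (compile_out a (\<rho>(v := d + 1)) (d + 2)) (Mv (d + 1) Right))) (clear (d + 1)))"

fun out_bound :: "out \<Rightarrow> nat \<Rightarrow> nat" where
  "out_bound (Emit e) = (\<lambda>N. time_bound e N + (3 + (val_bound e N * 3 + 1)))"
| "out_bound (OSeq a b) = (\<lambda>N. out_bound a N + out_bound b N)"
| "out_bound (OFor v e a) = (\<lambda>N.
     time_bound e N + ((val_bound e N * (out_bound a (N + val_bound e N) + 1 + 3) + 1) + (val_bound e N * 3 + 1)))"

lemma poly_bounded_out_bound: "poly_bounded (out_bound a)"
proof (induction a)
  case (OFor v e a)
  note vb = poly_bounded_val_bound
  have "poly_bounded (\<lambda>N. out_bound a (N + val_bound e N))"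
    using poly_bounded_compose[OF OFor poly_bounded_add[OF poly_bounded_ident vb[of e]]] .
  with vb[of e] poly_bounded_time_bound[of e] show ?case
    unfolding out_bound.simps by (intro poly_bounded_intros)
qed (unfold out_bound.simps,
  (intro poly_bounded_intros poly_bounded_val_bound poly_bounded_time_bound; assumption?)+)

lemma runs_emit:
  assumes "d \<noteq> 0"
  shows "runs (If d {3} (Wr 0 1 Right) (Wr 0 2 Right)) 3 (layout x g y h) (layout x g (y @ [h d \<noteq> 0]) h)"
proof -
  have "runs (Wr 0 (bit_symbol b) Right) 1 (layout x g y h) (layout x g (y @ [b]) h)" for b
    by (rule runs_Wr) (auto simp: fun_eq_iff layout_def act_def string_contents_append[symmetric])
  from this[of True] this[of False]
  have w: "runs (Wr 0 2 Right) 1 (layout x g y h) (layout x g (y @ [True]) h)"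
    "runs (Wr 0 1 Right) 1 (layout x g y h) (layout x g (y @ [False]) h)"
    by (simp_all add: bit_symbol_def)
  have "runs (If d {3} (Wr 0 1 Right) (Wr 0 2 Right)) (1 + 2) (layout x g y h) (layout x g (y @ [h d \<noteq> 0]) h)"
  proof (cases "h d = 0")
    case True
    then show ?thesis
      using w by (intro runs_IfTrue) (simp_all add: scanned_layout_3 assms)
  next
    case False
    then show ?thesis
      using w by (intro runs_IfFalse) (simp_all add: scanned_layout_3 assms)
  qed
  then show ?thesis by (rule runs_mono) simp
qed

text \<open>Only the output grows: all counters return to their old values, so printing programs can
  be sequenced and iterated with the same free counters.\<close>

lemma runs_compileile_out:
  assumes "\<And>v. 3 \<le> \<rho> v \<and> \<rho> v < d" "\<And>r. d \<le> r \<Longrightarrow> h r = 0" "h 1 = 0" "h 2 = 0"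
    and "\<And>v. h (\<rho> v) \<le> N"
  shows "runs (compile_out a \<rho> d) (out_bound a N) (layout x g y h)
    (layout x g (y @ emitted x g a (\<lambda>v. h (\<rho> v))) h)"
  using assms
proof (induction a arbitrary: \<rho> d h N y)
  case (Emit e)
  let ?e = "eval x g e (\<lambda>v. h (\<rho> v))"
  have d: "d \<noteq> 0" using Emit.prems(1)[of 0] by auto
  have 1: "runs (compile e \<rho> d) (time_bound e N) (layout x g y h) (layout x g y (h(d := ?e)))"
    using Emit by (intro runs_compile)
  have 2: "runs (If d {3} (Wr 0 1 Right) (Wr 0 2 Right)) 3 (layout x g y (h(d := ?e)))
    (layout x g (y @ [?e \<noteq> 0]) (h(d := ?e)))"
    using runs_emit[OF d, of x g y "h(d := ?e)"] by simp
  have 3: "runs (clear d) (val_bound e N * 3 + 1) (layout x g (y @ [?e \<noteq> 0]) (h(d := ?e)))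
    (layout x g (y @ [?e \<noteq> 0]) h)"
    by (rule runs_clear)
      (use d Emit.prems(2)[of d] eval_le_val_bound[OF Emit.prems(5)] in \<open>auto simp: fun_eq_iff\<close>)
  show ?case
    using runs_Seq[OF 1 runs_Seq[OF 2 3]] by (simp del: fun_upd_apply)
next
  case (OSeq a b)
  have "runs (compile_out a \<rho> d) (out_bound a N) (layout x g y h)
    (layout x g (y @ emitted x g a (\<lambda>v. h (\<rho> v))) h)"
    using OSeq.prems by (rule OSeq.IH(1))
  moreover have "runs (compile_out b \<rho> d) (out_bound b N) (layout x g (y @ emitted x g a (\<lambda>v. h (\<rho> v))) h)
    (layout x g ((y @ emitted x g a (\<lambda>v. h (\<rho> v))) @ emitted x g b (\<lambda>v. h (\<rho> v))) h)"
    using OSeq.prems by (rule OSeq.IH(2))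
  ultimately show ?case
    using runs_Seq by fastforce
next
  case (OFor v e a)
  let ?\<sigma> = "\<lambda>v. h (\<rho> v)" let ?e = "eval x g e ?\<sigma>" let ?a = "\<lambda>i. emitted x g a (?\<sigma>(v := i))"
  define k where "k = val_bound e N"
  let ?N = "N + k"
  have d: "d \<noteq> 0" "3 < d" using OFor.prems(1)[of 0] by auto
  have \<rho>: "\<rho> v \<noteq> d" "\<rho> v < d" "\<rho> v \<noteq> d + 1" "\<rho> v \<noteq> Suc d" "3 \<le> \<rho> v" "\<rho> v < d + 2" for v
    using OFor.prems(1)[of v] by simp_all
  have h: "h d = 0" "h (d + 1) = 0" "h (Suc d) = 0"
    using OFor.prems(2) by simp_all
  have e: "?e \<le> k"
    unfolding k_def using OFor.prems by (auto intro!: eval_le_val_bound)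
  have 1: "runs (compile e \<rho> d) (time_bound e N) (layout x g y h) (layout x g y (h(d := ?e)))"
    using OFor.prems by (rule runs_compile)
  let ?H = "\<lambda>i. h(d + 1 := i)"
  let ?Y = "\<lambda>i. y @ concat (map ?a [0..<i])"
  let ?c = "Seq (compile_out a (\<rho>(v := d + 1)) (d + 2)) (Mv (d + 1) Right)"
  have b: "runs ?c (out_bound a ?N + 1) (layout x g (?Y i) ((?H i)(d := ?e - Suc i)))
    (layout x g (?Y (Suc i)) ((?H (Suc i))(d := ?e - Suc i)))"
    if i: "i < ?e" for i
  proof -
    let ?h = "(?H i)(d := ?e - Suc i)"
    have \<sigma>: "(\<lambda>w. ?h ((\<rho>(v := d + 1)) w)) = ?\<sigma>(v := i)" using \<rho> by (auto simp: fun_eq_iff)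
    have "runs (compile_out a (\<rho>(v := d + 1)) (d + 2)) (out_bound a ?N) (layout x g (?Y i) ?h)
      (layout x g (?Y i @ emitted x g a (\<lambda>w. ?h ((\<rho>(v := d + 1)) w))) ?h)"
    proof (rule OFor.IH)
      show "3 \<le> (\<rho>(v := d + 1)) w \<and> (\<rho>(v := d + 1)) w < d + 2" for w
        using \<rho>[of w] d by auto
      have "(?\<sigma>(v := i)) w \<le> ?N" for w
        using OFor.prems(5)[of w] e i by (auto intro: trans_le_add1)
      then show "?h ((\<rho>(v := d + 1)) w) \<le> ?N" for w
        using \<sigma> by metis
    qed (use d OFor.prems in auto)
    then have 1: "runs (compile_out a (\<rho>(v := d + 1)) (d + 2)) (out_bound a ?N) (layout x g (?Y i) ?h)
      (layout x g (?Y (Suc i)) ?h)"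
      unfolding \<sigma> by (simp del: fun_upd_apply)
    have 2: "runs (Mv (d + 1) Right) 1 (layout x g (?Y (Suc i)) ?h)
      (layout x g (?Y (Suc i)) ((?H (Suc i))(d := ?e - Suc i)))"
      by (rule runs_inc) (auto simp: fun_eq_iff)
    show ?thesis using runs_Seq[OF 1 2] .
  qed
  let ?h = "h(d + 1 := ?e, d := 0)"
  have "runs (loop d ?c) (?e * (out_bound a ?N + 1 + 3) + 1) (layout x g y (h(d := ?e))) (layout x g (?Y ?e) ?h)"
    by (rule runs_loop[where Y = ?Y and H = ?H, OF _ b]) (use d h in \<open>auto simp: fun_eq_iff\<close>)
  then have 2: "runs (loop d ?c) (k * (out_bound a ?N + 1 + 3) + 1) (layout x g y (h(d := ?e))) (layout x g (?Y ?e) ?h)"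
    by (rule runs_mono) (intro add_mono mult_mono le_refl e; simp)
  have 3: "runs (clear (d + 1)) (k * 3 + 1) (layout x g (?Y ?e) ?h) (layout x g (?Y ?e) h)"
    by (rule runs_clear) (use e h in \<open>auto simp: fun_eq_iff\<close>)
  show ?case
    using runs_Seq[OF 1 runs_Seq[OF 2 3]] by (simp add: k_def del: fun_upd_apply)
qed

text \<open>The prologue establishes the layout below \<open>K\<close> only, whereas the program is
  known to run from the full layout; \<open>conf K\<close> identifies the two stores.\<close>

lemma run_prog:
  assumes "4 \<le> K" "width c \<le> K" "code K (Seq (prologue K) c) p \<subseteq> delta M"
    and "runs c T (layout x g [] ((\<lambda>_. 0)(3 := length x))) s"
  shows "\<exists>t\<le>2 * K + 13 * length x + 3 * length g + 10 + T.
    (step M ^^ t) (p, conf K (start_store x g)) (p + len (Seq (prologue K) c), conf K s)"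
proof -
  let ?l = "layout x g [] ((\<lambda>_. 0)(3 := length x))"
  obtain s' where s': "runs (prologue K) (2 * K + 13 * length x + 3 * length g + 10) (start_store x g) s'"
    "\<And>r. r < K \<Longrightarrow> s' r = ?l r"
    using runs_prologue[OF assms(1)] by metis
  have conf: "conf K s' = conf K ?l"
    using s'(2) by (auto simp: conf_def)
  have le3: "string_contents w i < K" for w i
    using string_contents_le2[of w i] assms(1) by linarith
  have valid: "valid K (start_store x g)" "valid K ?l"
    using le3 assms(1) by (auto simp: valid_def start_store_def layout_def)
  obtain t1 where t1: "t1 \<le> 2 * K + 13 * length x + 3 * length g + 10" "exec (prologue K) (start_store x g) t1 s'"
    using s'(1) unfolding runs_def by blast
  obtain t2 where t2: "t2 \<le> T" "exec c ?l t2 s"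
    using assms(4) unfolding runs_def by blast
  have "code K (prologue K) p \<subseteq> delta M" and c: "code K c (p + len (prologue K)) \<subseteq> delta M"
    using assms(3) by auto
  then have 1: "(step M ^^ t1) (p, conf K (start_store x g)) (p + len (prologue K), conf K ?l)"
    using simulation[OF t1(2) _ valid(1)] width_prologue[OF assms(1)] conf by simp
  have 2: "(step M ^^ t2) (p + len (prologue K), conf K ?l) (p + len (prologue K) + len c, conf K s)"
    using simulation[OF t2(2) assms(2) valid(2) c] by simp
  show ?thesis
    using relpowp_trans[OF 1 2] t1(1) t2(1) by (intro exI[of _ "t1 + t2"]) (simp add: add.assoc add_mono)
qed

lemma conf_start_store: "1 \<le> K \<Longrightarrow>
  conf K (start_store x []) = (string_contents x, 0) # replicate (K - 1) (string_contents [], 0)"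
  by (intro nth_equalityI) (auto simp: conf_def start_store_def nth_Cons')

lemma width_prog: "4 \<le> K \<Longrightarrow> width c \<le> K \<Longrightarrow> width (Seq (prologue K) c) \<le> K"
  by (simp add: width_prologue)

text \<open>At the start every variable is mapped to counter 3, where the prologue has put the input
  length; hence the constant environment, and 4 as the first free counter.\<close>

theorem poly_time_computable_emitted: "poly_time_computable (\<lambda>x. emitted x [] a (\<lambda>_. length x))"
proof -
  define c where "c = compile_out a (\<lambda>_. 3) 4"
  \<comment> \<open>The prologue needs the tapes 0 to 3 and the symbols up to the marker 3.\<close>
  define K where "K = max 4 (width c)"
  have K: "4 \<le> K" "width c \<le> K" by (auto simp: K_def)
  define P where "P = Seq (prologue K) c"
  have wP: "width P \<le> K" unfolding P_def using width_prog K by blast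
  define M where "M = \<lparr>tapes = K, states = {..len P}, alphabet = {..<K}, start = 0, accept = len P,
    delta = code K P 0\<rparr>"
  have delta: "delta M = code K P 0" by (simp add: M_def)
  have "wf_tm M"
    unfolding wf_tm_def delta using K(1) len_pos[of P]
    by (auto simp: M_def bit_symbol_def dest!: code_bounds[OF _ wP])
  moreover have "deterministic M"
    using functional_code[OF wP, of 0] unfolding deterministic_def delta functional_def .
  moreover have "\<exists>p. \<forall>x. \<exists>t\<le>poly p (length x). outputs_in M x t (emitted x [] a (\<lambda>_. length x))"
  proof -
    have "poly_bounded (\<lambda>n. 2 * K + 13 * n + 10 + out_bound a n)"
      by (intro poly_bounded_intros poly_bounded_out_bound)
    then obtain p where p: "\<And>n. 2 * K + 13 * n + 10 + out_bound a n \<le> poly p n"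
      unfolding poly_bounded_def by blast
    have "\<exists>t\<le>poly p (length x). outputs_in M x t (emitted x [] a (\<lambda>_. length x))" for x
    proof -
      let ?h = "(\<lambda>_. 0)(3 := length x) :: nat \<Rightarrow> nat"
      let ?s = "layout x [] ([] @ emitted x [] a (\<lambda>v. ?h 3)) ?h"
      have "runs c (out_bound a (length x)) (layout x [] [] ?h) ?s"
        unfolding c_def by (rule runs_compileile_out) auto
      from run_prog[OF K _ this, of 0 M]
      obtain t where t: "t \<le> 2 * K + 13 * length x + 10 + out_bound a (length x)"
        "(step M ^^ t) (0, conf K (start_store x [])) (len P, conf K ?s)"
        by (auto simp: P_def M_def)
      have "initial M x = (0, conf K (start_store x []))"
        using K(1) by (simp add: initial_def conf_start_store M_def)
      moreover have "fst (hd (conf K ?s)) = string_contents (emitted x [] a (\<lambda>_. length x))"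
        using K(1) by (simp add: conf_def hd_map layout_def)
      ultimately have "outputs_in M x t (emitted x [] a (\<lambda>_. length x))"
        unfolding outputs_in_def using t(2) by (auto simp: M_def)
      with t(1) p show ?thesis using le_trans by blast
    qed
    then show ?thesis by blast
  qed
  ultimately show ?thesis
    unfolding poly_time_computable_def by blast
qed

section \<open>Guessing\<close>

text \<open>Two runs of a deterministic machine proceed in step until one of them is stuck, and then
  the other is stuck as well. So their lengths need not be assumed equal.\<close>

lemma functional_run:
  assumes "functional (delta M)" "(step M ^^ m) c c1" "(step M ^^ n) c c2"
    and "\<And>c'. \<not> step M c1 c'" "\<And>c'. \<not> step M c2 c'"
  shows "c1 = c2"
  using assms(2,3)
proof (induction m arbitrary: c n)
  case 0
  then show ?case
    using assms(4) by (cases n) (simp, metis relpowp_0_E relpowp_Suc_D2)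
next
  case (Suc m)
  obtain d where d: "step M c d" "(step M ^^ m) d c1"
    using relpowp_Suc_D2[OF Suc.prems(1)] by blast
  show ?case
  proof (cases n)
    case 0
    then show ?thesis using Suc.prems(2) d(1) assms(5) by auto
  next
    case (Suc n')
    then obtain d' where d': "step M c d'" "(step M ^^ n') d' c2"
      using relpowp_Suc_D2 Suc.prems(2) by metis
    have "d = d'"
      using d(1) d'(1) assms(1) unfolding functional_def
      by (auto elim!: step.cases) blast+
    then show ?thesis using Suc.IH d(2) d'(2) by blast
  qed
qed

lemma step_source: "step M (q, ts) c \<Longrightarrow> \<exists>a q' w. (q, a, q', w) \<in> delta M \<and> a = map scanned ts"
  by (erule step.cases) blast

text \<open>
  The machine guesses a string on tape 2 in state 0 and then runs a deterministic program. Since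
  that program halts on every guess, an accepting run is the unique run after its guess.
\<close>

theorem NP_guess:
  assumes "\<And>x. x \<in> A \<Longrightarrow> \<exists>g. length g \<le> length x \<and> eval x g e (\<lambda>_. length x) \<noteq> 0"
    and "\<And>x g. eval x g e (\<lambda>_. length x) \<noteq> 0 \<Longrightarrow> x \<in> A"
  shows "A \<in> NP"
proof -
  define c where "c = compile e (\<lambda>_. 3) 4"
  \<comment> \<open>Counter 4 receives the value and is tested at the end, so tape 4 must
    exist.\<close>
  define K where "K = max 5 (width c)"
  have K: "4 \<le> K" "5 \<le> K" "width c \<le> K" by (auto simp: K_def)
  define P where "P = Seq (prologue K) c"
  have wP: "width P \<le> K" unfolding P_def using width_prog K by blast
  define E where "E = 1 + len P"
  \<comment> \<open>The last rule fires only if counter 4 has left its marker, that is, on a nonzero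
    value. On 0 the machine stops in \<open>E\<close>, short of the accepting state
    \<open>E + 1\<close>.\<close>
  define det where "det = code K P 1 \<union> rules K E (E + 1) 4 (- {3}) stay"
  define guess where
    "guess = (\<Union>b. rules K 0 0 2 UNIV (\<lambda>_. (bit_symbol b, Right))) \<union> rules K 0 1 2 UNIV stay"
  define M where "M = \<lparr>tapes = K, states = {..E + 1}, alphabet = {..<K}, start = 0, accept = E + 1,
    delta = guess \<union> det\<rparr>"
  \<comment> \<open>Guessing is the only nondeterminism of \<open>M\<close>; \<open>M'\<close> is
    the deterministic machine that remains after state 0 is left.\<close>
  define M' where "M' = M\<lparr>delta := det\<rparr>"
  have det_bounds: "1 \<le> q \<and> q \<le> E \<and> 1 \<le> q' \<and> q' \<le> E + 1 \<and> length a = K \<and> set a \<subseteq> {..<K} \<and>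
    length w = K \<and> fst ` set w \<subseteq> {..<K}"
    if "(q, a, q', w) \<in> det" for q a q' w
    using that code_bounds[OF _ wP, of q a q' w 1] rules_bounds[of q a q' w K E "E + 1" 4 "- {3}" stay] K
    by (auto simp: det_def E_def)
  have guess_bounds: "q = 0 \<and> q' \<le> 1 \<and> length a = K \<and> set a \<subseteq> {..<K} \<and>
    length w = K \<and> fst ` set w \<subseteq> {..<K}"
    if "(q, a, q', w) \<in> guess" for q a q' w
  proof -
    have "bit_symbol b < K" for b
      using K(1) by (simp add: bit_symbol_def)
    then have "(q, a, q', w) \<in> rules K 0 0 2 UNIV (\<lambda>_. (bit_symbol b, Right)) \<Longrightarrow> ?thesis" for b
      using rules_bounds[of q a q' w K 0 0 2 UNIV "\<lambda>_. (bit_symbol b, Right)"] K(1) by simp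
    moreover have "(q, a, q', w) \<in> rules K 0 1 2 UNIV stay \<Longrightarrow> ?thesis"
      using rules_bounds[of q a q' w K 0 1 2 UNIV stay] K(1) by simp
    ultimately show ?thesis
      using that by (simp only: guess_def Un_iff UN_iff) blast
  qed
  have "functional det"
    unfolding det_def using functional_code[OF wP] functional_rules
    by (rule functional_Un) (auto dest!: code_bounds[OF _ wP] rules_source simp: E_def)
  then have fM': "functional (delta M')" by (simp add: M'_def)
  have wf: "wf_tm M"
    unfolding wf_tm_def using K(2)
    by (auto simp: M_def bit_symbol_def E_def dest!: det_bounds guess_bounds; force dest: det_bounds guess_bounds simp: E_def)
  let ?c0 = "\<lambda>x g. conf K (start_store x g)"
  have valid0: "valid K (start_store x g)" for x g
    using string_contents_le2 K(1) by (auto simp: valid_def start_store_def intro!: le_less_trans[OF string_contents_le2])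
  have initial: "initial M x = (0, ?c0 x [])" for x
    using K(1) by (simp add: initial_def conf_start_store M_def)
  let ?h = "\<lambda>x :: bool list. ((\<lambda>_. 0)(3 := length x)) :: nat \<Rightarrow> nat"
  let ?s = "\<lambda>x g. layout x g [] ((?h x)(4 := eval x g e (\<lambda>_. length x)))"
  have prog: "\<exists>t\<le>2 * K + 13 * length x + 3 * length g + 10 + time_bound e (length x).
    (step N ^^ t) (1, ?c0 x g) (E, conf K (?s x g))" if "det \<subseteq> delta N" for x g N
  proof -
    have "runs c (time_bound e (length x)) (layout x g [] (?h x))
      (layout x g [] ((?h x)(4 := eval x g e (\<lambda>v. ?h x 3))))"
      unfolding c_def by (rule runs_compile) auto
    then have "runs c (time_bound e (length x)) (layout x g [] (?h x)) (?s x g)" by simp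
    from run_prog[OF K(1,3) _ this, of 1 N] show ?thesis
      using that by (simp add: P_def E_def det_def)
  qed
  have valid1: "valid K (?s x g)" for x g
    using K(1) by (auto simp: valid_def layout_def intro!: le_less_trans[OF string_contents_le2])
  have scanned4: "scanned (?s x g 4) = 3 \<longleftrightarrow> eval x g e (\<lambda>_. length x) = 0" for x g
    by (simp add: scanned_layout_3)
  have write_guess: "(start_store x g)(2 := act (bit_symbol b, Right) (start_store x g 2)) = start_store x (g @ [b])" for x g b
    by (auto simp: start_store_def act_def string_contents_append[symmetric] fun_eq_iff)
  have guess_run: "(step M ^^ length g) (0, ?c0 x []) (0, ?c0 x g)" for x g
  proof (induction g rule: rev_induct)
    case (snoc b g)
    have "rules K 0 0 2 UNIV (\<lambda>_. (bit_symbol b, Right)) \<subseteq> delta M"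
      by (auto simp: M_def guess_def)
    from step_rules[OF this valid0, of x g]
    have "step M (0, ?c0 x g) (0, ?c0 x (g @ [b]))"
      using K(1) by (simp add: write_guess del: fun_upd_apply)
    with snoc show ?case by auto
  qed auto
  have accept: "\<exists>t\<le>2 * K + 13 * length x + 4 * length g + 12 + time_bound e (length x). accepts_in M x t"
    if e: "eval x g e (\<lambda>_. length x) \<noteq> 0" for x g
  proof -
    have 1: "step M (0, ?c0 x g) (1, ?c0 x g)"
      by (rule step_rules_stay[OF _ valid0, where r = 2 and A = UNIV]) (use K in \<open>auto simp: M_def guess_def\<close>)
    obtain t where t: "t \<le> 2 * K + 13 * length x + 3 * length g + 10 + time_bound e (length x)"
      "(step M ^^ t) (1, ?c0 x g) (E, conf K (?s x g))"
      using prog[of M x g] by (auto simp: M_def)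
    have 2: "step M (E, conf K (?s x g)) (E + 1, conf K (?s x g))"
      by (rule step_rules_stay[OF _ valid1, where r = 4 and A = "- {3}"])
        (use K scanned4[of x g] e in \<open>auto simp: M_def det_def\<close>)
    have "(step M ^^ (length g + Suc 0 + t + Suc 0)) (0, ?c0 x []) (E + 1, conf K (?s x g))"
      using relpowp_trans[OF relpowp_trans[OF relpowp_trans[OF guess_run relpowp_1I[where R = "step M", OF 1]] t(2)]
          relpowp_1I[where R = "step M", OF 2]] .
    then have "accepts_in M x (length g + Suc 0 + t + Suc 0)"
      unfolding accepts_in_def initial by (auto simp: M_def)
    then show ?thesis using t(1) by (intro exI[of _ "length g + Suc 0 + t + Suc 0"]) auto
  qed
  have sound: "x \<in> A" if "accepts_in M x t" for x t
  proof -
    obtain ts where ts: "(step M ^^ t) (0, ?c0 x []) (E + 1, ts)"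
      using \<open>accepts_in M x t\<close> unfolding accepts_in_def initial by (auto simp: M_def)
    \<comment> \<open>Every reachable configuration is still guessing or lies on a run of
      \<open>M'\<close> that started from the tapes of some guess \<open>g\<close>.\<close>
    have leave: "(q = 0 \<and> (\<exists>g. ts = ?c0 x g)) \<or> (1 \<le> q \<and> (\<exists>g t'. (step M' ^^ t') (1, ?c0 x g) (q, ts)))"
      if "(step M ^^ t) (0, ?c0 x []) (q, ts)" for q ts t
      using that
    proof (induction t arbitrary: q ts)
      case (Suc t)
      obtain q1 ts1 where 1: "(step M ^^ t) (0, ?c0 x []) (q1, ts1)" "step M (q1, ts1) (q, ts)"
        using Suc.prems by auto
      obtain w where w: "(q1, map scanned ts1, q, w) \<in> guess \<union> det" "ts = map2 act w ts1"
        using 1(2) by (cases rule: step.cases) (auto simp: M_def)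
      show ?case
      proof (cases "q1 = 0")
        case True
        then obtain g where g: "ts1 = ?c0 x g" using Suc.IH[OF 1(1)] by auto
        have "(q1, map scanned (?c0 x g), q, w) \<in> guess"
          using w(1) True g by (auto dest: det_bounds)
        then consider b where "(q1, map scanned (?c0 x g), q, w) \<in> rules K 0 0 2 UNIV (\<lambda>_. (bit_symbol b, Right))"
          | "(q1, map scanned (?c0 x g), q, w) \<in> rules K 0 1 2 UNIV stay"
          unfolding guess_def by blast
        then show ?thesis
        proof cases
          case (1 b)
          then have "ts = ?c0 x (g @ [b])"
            using map2_act_rules[OF 1] K(1) w(2) g by (simp add: write_guess del: fun_upd_apply)
          moreover have "q = 0" using 1 by (auto simp: rules_def)
          ultimately show ?thesis by blast
        next
          case 2
          then have "ts = ?c0 x g"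
            using map2_act_rules[OF 2] K(1) w(2) g by (simp add: act_scanned_Stay)
          moreover have "q = 1" using 2 by (auto simp: rules_def)
          moreover have "(step M' ^^ 0) (1, ?c0 x g) (1, ?c0 x g)" by simp
          ultimately show ?thesis by (metis le_refl)
        qed
      next
        case False
        then obtain g t' where g: "(step M' ^^ t') (1, ?c0 x g) (q1, ts1)" using Suc.IH[OF 1(1)] by auto
        have "(q1, map scanned ts1, q, w) \<in> det"
          using w(1) False by (auto dest: guess_bounds)
        then have "step M' (q1, ts1) (q, ts)" "1 \<le> q"
          using w(2) det_bounds by (auto simp: M'_def intro: step.intros)
        with g show ?thesis using relpowp_Suc_I by metis
      qed
    qed auto
    then obtain g t' where g: "(step M' ^^ t') (1, ?c0 x g) (E + 1, ts)"
      using ts by fastforce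
    obtain t'' where t'': "(step M' ^^ t'') (1, ?c0 x g) (E, conf K (?s x g))"
      using prog[of M' x g] by (auto simp: M'_def)
    have "eval x g e (\<lambda>_. length x) \<noteq> 0"
    proof
      assume "eval x g e (\<lambda>_. length x) = 0"
      then have 3: "scanned (?s x g 4) = 3" using scanned4 by blast
      \<comment> \<open>The program itself ends in \<open>E\<close> for this \<open>g\<close>, the
        accepting run in \<open>E + 1\<close>. Both start alike and both ends are stuck, which
        contradicts determinism.\<close>
      have "\<not> step M' (E, conf K (?s x g)) c'" for c'
      proof
        assume "step M' (E, conf K (?s x g)) c'"
        then obtain q' w where "(E, map scanned (conf K (?s x g)), q', w) \<in> det"
          by (auto dest!: step_source simp: M'_def)
        then have "(E, map scanned (conf K (?s x g)), q', w) \<in> rules K E (E + 1) 4 (- {3}) stay"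
          by (auto simp: det_def E_def dest: code_bounds[OF _ wP])
        then have "map scanned (conf K (?s x g)) ! 4 \<noteq> 3"
          by (auto dest: rules_source)
        then show False using 3 K(2) by (simp add: conf_def)
      qed
      moreover have "\<not> step M' (E + 1, ts) c'" for c'
        by (auto dest!: step_source det_bounds simp: M'_def)
      ultimately show False
        using functional_run[OF fM' g t''] by simp
    qed
    then show ?thesis using assms(2) by blast
  qed
  have "poly_bounded (\<lambda>n. 2 * K + 13 * n + 4 * n + 12 + time_bound e n)"
    by (intro poly_bounded_intros poly_bounded_time_bound)
  then obtain p where p: "\<And>n. 2 * K + 13 * n + 4 * n + 12 + time_bound e n \<le> poly p n"
    unfolding poly_bounded_def by blast
  have complete: "\<exists>t\<le>poly p (length x). accepts_in M x t" if "x \<in> A" for x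
  proof -
    obtain g where g: "length g \<le> length x" "eval x g e (\<lambda>_. length x) \<noteq> 0"
      using assms(1)[OF \<open>x \<in> A\<close>] by blast
    obtain t where "t \<le> 2 * K + 13 * length x + 4 * length g + 12 + time_bound e (length x)" "accepts_in M x t"
      using accept[OF g(2)] by blast
    moreover have "2 * K + 13 * length x + 4 * length g + 12 + time_bound e (length x) \<le> poly p (length x)"
      using p[of "length x"] g(1) by simp
    ultimately show ?thesis using le_trans by blast
  qed
  show ?thesis
    unfolding NP_def using wf sound complete by blast
qed

section \<open>From selection problems to dominating sets\<close>

text \<open>
  The vertices come in groups \<open>(i, j, _)\<close>. In the third component, 4 and 5 are the centres of two
  stars with \<open>k - 1\<close> and \<open>k\<close> leaves: the hub 5 uses its whole capacity on its leaves, so that its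
  neighbour 4 must belong to the dominating set, with capacity 1 left. The vertices 0 and 1 of
  \<open>(i, 0, _)\<close> say that option \<open>i\<close> is rejected or chosen, \<open>5 + 2 * k\<close> makes this a budgeted choice,
  and 2 in \<open>(g, 0, _)\<close> asks for a chosen option of the \<open>g\<close>-th cell. For the unused copies of 2, the
  vertex 3 takes over the domination.
\<close>

type_synonym vertex = "nat \<times> nat \<times> nat"

text \<open>Option \<open>q\<close> of cell \<open>g\<close> has the number
  \<open>g * Q + q\<close>. \<open>R\<close> is the conflict relation between options, where
  \<open>R i i\<close> rules out option \<open>i\<close> altogether.\<close>

locale selection =
  fixes k G Q :: nat and R :: "nat \<Rightarrow> nat \<Rightarrow> bool"
  assumes k: "2 \<le> k" and Q: "0 < Q"
begin

definition m :: nat where "m = G * Q"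

text \<open>Each edge is listed in one direction only. The centre \<open>(i, i, 4)\<close> spends
  its spare capacity on option \<open>i\<close> itself: it is adjacent to both vertices of that
  option and dominates the one left out. Conflicts use the centres \<open>(i, j, 4)\<close> with
  \<open>i \<noteq> j\<close>. An option with \<open>R i i\<close> is ruled out by losing its edge
  to the cell.\<close>

fun arc :: "vertex \<Rightarrow> vertex \<Rightarrow> bool" where
  "arc (i, j, e) (i', j', e') \<longleftrightarrow>
     (i' = i \<and> j' = j \<and>
       ((e = 5 + 2 * k \<and> e' \<le> 1) \<or>
        (e = 2 \<and> e' = 3 \<and> (G \<le> i \<or> 0 < j)) \<or>
        (e = 4 \<and> 5 \<le> e' \<and> e' < 5 + k) \<or>
        (e = 5 \<and> 5 + k \<le> e' \<and> e' < 5 + 2 * k))) \<or>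
     (e = 1 \<and> e' = 2 \<and> j = 0 \<and> j' = 0 \<and> i' * Q \<le> i \<and> i < i' * Q + Q \<and> \<not> R i i) \<or>
     (e = 4 \<and> e' \<le> 1 \<and> j' = 0 \<and> i = j \<and> i' = i) \<or>
     (e = 4 \<and> e' = 0 \<and> j' = 0 \<and> i \<noteq> j \<and> R i j \<and> (i' = i \<or> i' = j))"

definition V :: "vertex set" where
  "V = {..<m} \<times> {..<m} \<times> {..<6 + 2 * k}"

definition E :: "vertex set set" where
  "E = {{p, q} | p q. p \<in> V \<and> q \<in> V \<and> arc p q}"

definition solvable :: bool where
  "solvable \<longleftrightarrow> (\<exists>f. (\<forall>g<G. f g < Q) \<and> (\<forall>g<G. \<forall>g'<G. \<not> R (g * Q + f g) (g' * Q + f g')))"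

lemma neighborhood_iff: "v \<in> neighborhood E u \<longleftrightarrow> u \<in> V \<and> v \<in> V \<and> (arc u v \<or> arc v u)"
  unfolding neighborhood_def E_def mem_Collect_eq doubleton_eq_iff by blast

lemma finite_V: "finite V"
  by (simp add: V_def)

lemma arc_irrefl: "\<not> arc p p"
  using k by (cases p) auto

lemma simple_graph_E: "simple_graph V E"
  unfolding simple_graph_def using finite_V arc_irrefl by (auto simp: E_def card_insert_if simp del: arc.simps)

lemma option_less: "g < G \<Longrightarrow> f < Q \<Longrightarrow> g * Q + f < m"
proof -
  assume a: "g < G" "f < Q"
  then have "g * Q + f < (g + 1) * Q" by simp
  also have "\<dots> \<le> G * Q" using a by (intro mult_right_mono) auto
  finally show ?thesis by (simp add: m_def)
qed

lemma cell_unique: "g * Q \<le> i \<Longrightarrow> i < g * Q + Q \<Longrightarrow> g = i div Q"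
  by (metis add.commute div_nat_eqI mult.commute mult_Suc_right)

lemma G_le_m: "G \<le> m"
  using Q by (simp add: m_def)

lemma solvable_imp_limited_dominating_set:
  assumes solvable
  shows "\<exists>D. limited_dominating_set k V E D \<and> card D \<le> 4 * m * m"
proof -
  obtain f where f: "\<And>g. g < G \<Longrightarrow> f g < Q"
    "\<And>g g'. g < G \<Longrightarrow> g' < G \<Longrightarrow> \<not> R (g * Q + f g) (g' * Q + f g')"
    using assms unfolding solvable_def by blast
  define S where "S = {g * Q + f g | g. g < G}"
  have S: "\<not> R i j" if "i \<in> S" "j \<in> S" for i j
    using that f(2) by (auto simp: S_def)
  \<comment> \<open>In the copies with \<open>0 < j\<close>, which represent no option, the selector
    \<open>5 + 2 * k\<close> takes over from the vertices 0 and 1 and dominates both.\<close>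
  define inD where "inD = (\<lambda>(i, j, e). e = 3 \<or> e = 4 \<or> e = 5 \<or> (e = 5 + 2 * k \<and> 0 < j) \<or>
    (e = 0 \<and> j = 0 \<and> i \<notin> S) \<or> (e = 1 \<and> j = (0::nat) \<and> i \<in> S))"
  define D where "D = {p \<in> V. inD p}"
  \<comment> \<open>Four members per copy \<open>(i, j, _)\<close>: the vertices 3, 4, 5 and one
    among 0, 1 and the selector.\<close>
  define pick where "pick = (\<lambda>(i, j :: nat, c). (i, j, if c = (0::nat) then (if 0 < j then 5 + 2 * k else if i \<in> S then 1 else 0) else c + 2))"
  have "D \<subseteq> pick ` ({..<m} \<times> {..<m} \<times> {..<4})"
  proof
    fix p assume "p \<in> D"
    obtain i j e where p: "p = (i, j, e)" by (cases p)
    have b: "i < m" "j < m" "inD (i, j, e)"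
      using \<open>p \<in> D\<close> by (auto simp: D_def V_def p)
    define c where "c = (if e \<in> {3, 4, 5} then e - 2 else 0)"
    have "c < 4" "pick (i, j, c) = p"
      using b(3) k by (auto simp: c_def pick_def inD_def p)
    then show "p \<in> pick ` ({..<m} \<times> {..<m} \<times> {..<4})"
      using b by (intro image_eqI[of _ _ "(i, j, c)"]) auto
  qed
  then have "card D \<le> card ({..<m} \<times> {..<m} \<times> {..<4::nat})"
    by (rule surj_card_le[rotated]) simp
  then have card: "card D \<le> 4 * m * m" by (simp add: card_cartesian_product algebra_simps)
  have "dominating_set V E D"
    unfolding dominating_set_def
  proof (intro conjI ballI)
    show "D \<subseteq> V" by (auto simp: D_def)
    fix p assume p: "p \<in> V - D"
    obtain i j e where ije: "p = (i, j, e)" by (cases p)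
    have b: "i < m" "j < m" "e < 6 + 2 * k" "\<not> inD (i, j, e)"
      using p by (auto simp: D_def V_def ije)
    have "\<exists>q\<in>D. arc p q \<or> arc q p"
    proof -
      have "e \<le> 1 \<or> e = 2 \<or> e = 3 \<or> e = 4 \<or> e = 5 \<or> (6 \<le> e \<and> e < 5 + k) \<or>
        (5 + k \<le> e \<and> e < 5 + 2 * k) \<or> e = 5 + 2 * k"
        using b(3) by linarith
      moreover have "e \<noteq> 3" "e \<noteq> 4" "e \<noteq> 5" "e = 5 + 2 * k \<Longrightarrow> j = 0"
        using b(4) by (auto simp: inD_def)
      moreover have "j = 0 \<or> 0 < j" "G \<le> i \<or> i < G" by auto
      ultimately consider "e \<le> 1" "0 < j" | "e \<le> 1" "j = 0" | "e = 2" "G \<le> i \<or> 0 < j" | "e = 2" "i < G" "j = 0"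
        | "6 \<le> e" "e < 5 + k" | "5 + k \<le> e" "e < 5 + 2 * k" | "e = 5 + 2 * k" "j = 0"
        by blast
      then show ?thesis
      proof cases
        case 1
        then show ?thesis
          by (intro bexI[of _ "(i, j, 5 + 2 * k)"]) (use b in \<open>auto simp: ije D_def V_def inD_def\<close>)
      next
        case 2
        then show ?thesis
          by (intro bexI[of _ "(i, i, 4)"]) (use b k in \<open>auto simp: ije D_def V_def inD_def\<close>)
      next
        case 3
        then show ?thesis
          by (intro bexI[of _ "(i, j, 3)"]) (use b in \<open>auto simp: ije D_def V_def inD_def\<close>)
      next
        case 4
        then have "(i * Q + f i, 0, 1) \<in> D"
          using f(1) option_less b by (auto simp: D_def V_def inD_def S_def)
        then show ?thesis
          by (intro bexI[of _ "(i * Q + f i, 0, 1)"]) (use 4 f in \<open>auto simp: ije\<close>)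
      next
        case 5
        then show ?thesis
          by (intro bexI[of _ "(i, j, 4)"]) (use b k in \<open>auto simp: ije D_def V_def inD_def\<close>)
      next
        case 6
        then show ?thesis
          by (intro bexI[of _ "(i, j, 5)"]) (use b k in \<open>auto simp: ije D_def V_def inD_def\<close>)
      next
        case 7
        then show ?thesis
          by (intro bexI[of _ "(i, j, if i \<in> S then 1 else 0)"]) (use b k in \<open>auto simp: ije D_def V_def inD_def\<close>)
      qed
    qed
    then show "neighborhood E p \<inter> D \<noteq> {}"
      using p by (auto simp: neighborhood_iff D_def simp del: arc.simps)
  qed
  moreover have "card (neighborhood E p - D) \<le> k" if "p \<in> D" for p
  proof -
    obtain i j e where ije: "p = (i, j, e)" by (cases p)
    have b: "i < m" "j < m" "inD (i, j, e)"
      using \<open>p \<in> D\<close> by (auto simp: D_def V_def ije)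
    have fin: "card (neighborhood E p - D) \<le> k"
      if "neighborhood E p - D \<subseteq> A" "finite A" "card A \<le> k" for A
      using that card_mono le_trans by blast
    have nb: "q \<in> V \<and> \<not> inD q \<and> (arc p q \<or> arc q p)" if "q \<in> neighborhood E p - D" for q
      using that by (auto simp: neighborhood_iff D_def simp del: arc.simps)
    consider "e = 0" | "e = 1" | "e = 3" | "e = 4" "i = j" | "e = 4" "i \<noteq> j" | "e = 5" | "e = 5 + 2 * k"
      using b(3) by (auto simp: inD_def)
    then show ?thesis
    proof cases
      case 1
      have "neighborhood E p - D \<subseteq> {(i, j, 5 + 2 * k)}"
      proof
        fix q assume q: "q \<in> neighborhood E p - D"
        show "q \<in> {(i, j, 5 + 2 * k)}"
          using nb[OF q] k 1 by (cases q) (auto simp: ije inD_def)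
      qed
      then show ?thesis by (rule fin) (use k in auto)
    next
      case 2
      have "neighborhood E p - D \<subseteq> {(i, j, 5 + 2 * k), (i div Q, 0, 2)}"
      proof
        fix q assume q: "q \<in> neighborhood E p - D"
        show "q \<in> {(i, j, 5 + 2 * k), (i div Q, 0, 2)}"
          using nb[OF q] k 2 by (cases q) (auto simp: ije inD_def cell_unique)
      qed
      then show ?thesis by (rule fin) (use k in \<open>auto simp: card_insert_if\<close>)
    next
      case 3
      have "neighborhood E p - D \<subseteq> {(i, j, 2)}"
      proof
        fix q assume q: "q \<in> neighborhood E p - D"
        show "q \<in> {(i, j, 2)}"
          using nb[OF q] k 3 by (cases q) (auto simp: ije inD_def)
      qed
      then show ?thesis by (rule fin) (use k in auto)
    next
      case 4
      \<comment> \<open>The \<open>k - 1\<close> leaves and the omitted vertex of option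
        \<open>i\<close> fill the capacity exactly.\<close>
      have "neighborhood E p - D \<subseteq> insert (i, 0, if i \<in> S then 0 else 1) ((\<lambda>e. (i, j, e)) ` {6..<5 + k})"
      proof
        fix q assume q: "q \<in> neighborhood E p - D"
        show "q \<in> insert (i, 0, if i \<in> S then 0 else 1) ((\<lambda>e. (i, j, e)) ` {6..<5 + k})"
          using nb[OF q] k 4 by (cases q) (auto simp: ije inD_def)
      qed
      then show ?thesis
        by (rule fin) (use k in \<open>auto intro!: card_insert_le_m1 card_image_le[THEN le_trans]\<close>)
    next
      case 5
      \<comment> \<open>At most one of two conflicting options lies in \<open>S\<close>, so the
        vertex 0 of the other one is in \<open>D\<close>.\<close>
      have "neighborhood E p - D \<subseteq> insert (if i \<in> S then i else j, 0, 0) ((\<lambda>e. (i, j, e)) ` {6..<5 + k})"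
      proof
        fix q assume q: "q \<in> neighborhood E p - D"
        show "q \<in> insert (if i \<in> S then i else j, 0, 0) ((\<lambda>e. (i, j, e)) ` {6..<5 + k})"
          using nb[OF q] k 5 S by (cases q) (auto simp: ije inD_def)
      qed
      then show ?thesis
        by (rule fin) (use k in \<open>auto intro!: card_insert_le_m1 card_image_le[THEN le_trans]\<close>)
    next
      case 6
      have "neighborhood E p - D \<subseteq> (\<lambda>e. (i, j, e)) ` {5 + k..<5 + 2 * k}"
      proof
        fix q assume q: "q \<in> neighborhood E p - D"
        show "q \<in> (\<lambda>e. (i, j, e)) ` {5 + k..<5 + 2 * k}"
          using nb[OF q] k 6 by (cases q) (auto simp: ije inD_def)
      qed
      then show ?thesis
        by (rule fin) (use k in \<open>auto intro!: card_image_le[THEN le_trans]\<close>)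
    next
      case 7
      have "neighborhood E p - D \<subseteq> {(i, j, 0), (i, j, 1)}"
      proof
        fix q assume q: "q \<in> neighborhood E p - D"
        show "q \<in> {(i, j, 0), (i, j, 1)}"
          using nb[OF q] k 7 by (cases q) (auto simp: ije inD_def)
      qed
      then show ?thesis by (rule fin) (use k in auto)
    qed
  qed
  ultimately show ?thesis
    using card unfolding limited_dominating_set_def by blast
qed

text \<open>A pigeonhole argument: each copy splits into four classes that \<open>D\<close> must all
  meet, so the budget leaves exactly one member of \<open>D\<close> per class. This uniqueness
  forces the hubs, the centres and the exclusive choice between the vertices 0 and 1.\<close>

lemma limited_dominating_set_imp_solvable:
  assumes D: "limited_dominating_set k V E D" "card D \<le> 4 * m * m"
  shows solvable
proof -
  have DV: "D \<subseteq> V" and dom: "\<And>v. v \<in> V \<Longrightarrow> v \<notin> D \<Longrightarrow> \<exists>q\<in>D. arc v q \<or> arc q v"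
    and lim: "\<And>u. u \<in> D \<Longrightarrow> card (neighborhood E u - D) \<le> k"
    using D(1) unfolding limited_dominating_set_def dominating_set_def
    by (auto simp: neighborhood_iff disjoint_iff simp del: arc.simps)
  have limA: "card A \<le> k" if "u \<in> D" "A \<subseteq> neighborhood E u - D" for u A
  proof -
    have "neighborhood E u - D \<subseteq> V" by (auto simp: neighborhood_iff)
    then have "finite (neighborhood E u - D)" using finite_V finite_subset by blast
    then show ?thesis using lim[OF that(1)] card_mono[OF _ that(2)] by linarith
  qed
  \<comment> \<open>The classes are the selector with 0 and 1, the pair 2 and 3, and the two stars
    around 4 and 5.\<close>
  define part where "part = (\<lambda>e. if e \<le> 1 \<or> e = 5 + 2 * k then 0 else if e \<le> 3 then 1
    else if e = 4 \<or> (6 \<le> e \<and> e < 5 + k) then 2 else (3::nat))"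
  define cls where "cls = (\<lambda>(i::nat, j::nat, e). (i, j, part e))"
  have "{..<m} \<times> {..<m} \<times> {..<4} \<subseteq> cls ` D"
  proof
    fix p assume "p \<in> {..<m} \<times> {..<m} \<times> {..<4::nat}"
    then obtain i j c where p: "p = (i, j, c)" "i < m" "j < m" "c < 4" by auto
    \<comment> \<open>Each of these vertices has all its neighbours in its own class, so dominating
      it places a member of \<open>D\<close> there.\<close>
    define e where "e = (if c = 0 then 5 + 2 * k else if c = 1 then 3 else if c = 2 then 6 else 5 + k)"
    have e: "(i, j, e) \<in> V" "part e = c"
      using p k by (auto simp: V_def e_def part_def)
    have "\<exists>q\<in>D. cls q = p"
    proof (cases "(i, j, e) \<in> D")
      case True
      then show ?thesis
        using e by (intro bexI[of _ "(i, j, e)"]) (auto simp: cls_def p)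
    next
      case False
      then obtain q where q: "q \<in> D" "arc (i, j, e) q \<or> arc q (i, j, e)"
        using dom[OF e(1)] by blast
      have "cls q = p"
        using q(2) p(4) k by (cases q) (auto simp: e_def cls_def part_def p(1) split: if_splits)
      with q show ?thesis by blast
    qed
    then show "p \<in> cls ` D" by blast
  qed
  moreover have "finite D" using DV finite_V finite_subset by blast
  ultimately have "4 * m * m \<le> card (cls ` D)"
    using card_mono[of "cls ` D" "{..<m} \<times> {..<m} \<times> {..<4::nat}"]
    by (simp add: card_cartesian_product algebra_simps)
  then have "card (cls ` D) = card D"
    using D(2) card_image_le[OF \<open>finite D\<close>, of cls] by linarith
  then have inj: "inj_on cls D"
    using \<open>finite D\<close> by (rule eq_card_imp_inj_on[rotated])
  have uniq: "e = e'" if "(i, j, e) \<in> D" "(i, j, e') \<in> D" "part e = part e'" for i j e e'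
    using inj_onD[OF inj, of "(i, j, e)" "(i, j, e')"] that by (simp add: cls_def)
  \<comment> \<open>Without its hub every leaf must be in \<open>D\<close> itself, and
    \<open>k \<ge> 2\<close> leaves are too many for one class.\<close>
  have hub: "(i, j, 5) \<in> D" if "i < m" "j < m" for i j
  proof (rule ccontr)
    assume h: "(i, j, 5) \<notin> D"
    have "(i, j, e) \<in> D" if e: "5 + k \<le> e" "e < 5 + 2 * k" for e
    proof (rule ccontr)
      assume "(i, j, e) \<notin> D"
      moreover have "(i, j, e) \<in> V" using that \<open>i < m\<close> \<open>j < m\<close> by (auto simp: V_def)
      ultimately obtain q where q: "q \<in> D" "arc (i, j, e) q \<or> arc q (i, j, e)"
        using dom by blast
      then have "q = (i, j, 5)" using e k by (cases q) auto
      with q h show False by simp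
    qed
    from this[of "5 + k"] this[of "6 + k"] show False
      using uniq[of i j "5 + k" "6 + k"] k by (simp add: part_def)
  qed
  have center: "(i, j, 4) \<in> D" if ij: "i < m" "j < m" for i j
  proof (rule ccontr)
    assume "(i, j, 4) \<notin> D"
    moreover have "(i, j, e) \<notin> D" if "5 + k \<le> e" "e < 5 + 2 * k" for e
      using uniq[OF hub[OF ij], of e] that k by (auto simp: part_def)
    ultimately have "(\<lambda>e. (i, j, e)) ` insert 4 {5 + k..<5 + 2 * k} \<subseteq> neighborhood E (i, j, 5) - D"
      using ij k by (auto simp: neighborhood_iff V_def)
    from limA[OF hub[OF ij] this] have "card (insert 4 {5 + k..<5 + 2 * k}) \<le> k"
      by (subst (asm) card_image) (auto simp: inj_on_def)
    then show False by simp
  qed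
  have "\<exists>f. f < Q \<and> (g * Q + f, 0, 1) \<in> D \<and> \<not> R (g * Q + f) (g * Q + f)" if g: "g < G" for g
  proof -
    have gm: "g < m" "0 < m" using g G_le_m by auto
    \<comment> \<open>For \<open>g < G\<close> the edge between 2 and 3 is missing. So 3 is isolated
      and lies in \<open>D\<close>, it uses up the class, and 2 has to be dominated by a chosen
      option.\<close>
    have "(g, 0, 3) \<in> D"
    proof (rule ccontr)
      assume "(g, 0, 3) \<notin> D"
      moreover have "(g, 0, 3) \<in> V" using gm by (auto simp: V_def)
      ultimately obtain q where "q \<in> D" "arc (g, 0, 3) q \<or> arc q (g, 0, 3)"
        using dom by blast
      then show False using g k by (cases q) auto
    qed
    then have "(g, 0, 2) \<notin> D"
      using uniq[of g 0 3 2] by (auto simp: part_def)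
    moreover have "(g, 0, 2) \<in> V" using gm by (auto simp: V_def)
    ultimately obtain q where q: "q \<in> D" "arc (g, 0, 2) q \<or> arc q (g, 0, 2)"
      using dom by blast
    obtain i j e where ije: "q = (i, j, e)" by (cases q)
    have i: "e = 1" "j = 0" "g * Q \<le> i" "i < g * Q + Q" "\<not> R i i"
      using q(2) g k by (auto simp: ije)
    then show ?thesis
      using q(1) by (intro exI[of _ "i - g * Q"]) (auto simp: ije)
  qed
  then obtain f where f: "\<And>g. g < G \<Longrightarrow> f g < Q" "\<And>g. g < G \<Longrightarrow> (g * Q + f g, 0, 1) \<in> D"
    "\<And>g. g < G \<Longrightarrow> \<not> R (g * Q + f g) (g * Q + f g)"
    by metis
  have "\<not> R (g * Q + f g) (g' * Q + f g')" if g: "g < G" "g' < G" for g g'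
  proof
    let ?i = "g * Q + f g" let ?j = "g' * Q + f g'"
    assume R: "R ?i ?j"
    then have neq: "?i \<noteq> ?j" using f(3) g by metis
    have m: "?i < m" "?j < m" using g f(1) option_less by auto
    have "(i, 0, 0) \<notin> D" if "(i, 0, 1) \<in> D" for i
      using uniq[OF that, of 0] by (auto simp: part_def)
    then have x: "(?i, 0, 0) \<notin> D" "(?j, 0, 0) \<notin> D" using f(2) g by blast+
    have "(?i, ?j, e) \<notin> D" if "6 \<le> e" "e < 5 + k" for e
      using uniq[OF center[OF m], of e] that k by (auto simp: part_def)
    \<comment> \<open>The \<open>k - 1\<close> leaves and the two rejection vertices exceed the
      capacity by one.\<close>
    then have "insert (?i, 0, 0) (insert (?j, 0, 0) ((\<lambda>e. (?i, ?j, e)) ` {6..<5 + k})) \<subseteq>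
      neighborhood E (?i, ?j, 4) - D"
      using m k x neq R by (auto simp: neighborhood_iff V_def)
    from limA[OF center[OF m] this] show False
      using neq k by (auto simp: card_image inj_on_def card_insert_if image_iff)
  qed
  then show ?thesis
    unfolding solvable_def using f(1) by blast
qed

theorem solvable_iff:
  "solvable \<longleftrightarrow> (\<exists>D. limited_dominating_set k V E D \<and> card D \<le> 4 * m * m)"
  using solvable_imp_limited_dominating_set limited_dominating_set_imp_solvable by blast

end

section \<open>Tableaux of computations\<close>

type_synonym entry = "nat + transition"

text \<open>
  An entry of the tableau for a cell of a tape is \<open>Inl b\<close> if it holds \<open>b\<close> and the head is elsewhere,
  and \<open>Inr \<delta>\<close> if the head is on the cell and the transition \<open>\<delta>\<close> is about to be taken.
\<close>

fun symbol :: "nat \<Rightarrow> entry \<Rightarrow> nat" where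
  "symbol r (Inl b) = b"
| "symbol r (Inr (q, a, q', w)) = a ! r"

fun new_symbol :: "nat \<Rightarrow> entry \<Rightarrow> nat" where
  "new_symbol r (Inl b) = b"
| "new_symbol r (Inr (q, a, q', w)) = fst (w ! r)"

fun at_head :: "entry \<Rightarrow> bool" where
  "at_head (Inl b) = False"
| "at_head (Inr \<delta>) = True"

text \<open>Here, as in \<open>target\<close> and \<open>next_pos\<close>, the value 0 on
  \<open>Inl\<close> is a default: \<open>bad\<close> consults it only under
  \<open>at_head\<close>.\<close>

fun source :: "entry \<Rightarrow> nat" where
  "source (Inl b) = 0"
| "source (Inr (q, a, q', w)) = q"

fun target :: "entry \<Rightarrow> nat" where
  "target (Inl b) = 0"
| "target (Inr (q, a, q', w)) = q'"

text \<open>The shift plus one, which keeps positions within the natural numbers.\<close>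

fun offset :: "move \<Rightarrow> nat" where
  "offset Left = 0"
| "offset Stay = 1"
| "offset Right = 2"

fun next_pos :: "nat \<Rightarrow> entry \<Rightarrow> nat" where
  "next_pos r (Inl b) = 0"
| "next_pos r (Inr (q, a, q', w)) = offset (snd (w ! r))"

lemma offset_shift: "int (offset d) = shift d + 1"
  by (cases d) auto

locale tableau =
  fixes M :: tm and x :: "bool list" and T :: nat
  assumes wf: "wf_tm M"
begin

text \<open>Idle moves in the accepting state, which allow an accepting run to be padded to length
  exactly \<open>T\<close>. There, \<open>M\<close> has no transition of its own.\<close>

definition halts :: "transition set" where
  "halts = {(accept M, a, accept M, map stay a) | a. length a = tapes M \<and> set a \<subseteq> alphabet M}"

definition M' :: tm where
  "M' = M\<lparr>delta := delta M \<union> halts\<rparr>"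

definition entries :: "entry set" where
  "entries = Inl ` alphabet M \<union> Inr ` delta M'"

text \<open>The window shows cell \<open>z - T\<close> of a tape at index \<open>z\<close>.\<close>

definition bad :: "nat \<Rightarrow> nat \<Rightarrow> nat \<Rightarrow> entry \<Rightarrow> nat \<Rightarrow> nat \<Rightarrow> nat \<Rightarrow> entry \<Rightarrow> bool" where
  "bad t r z X t' r' z' X' \<longleftrightarrow>
     (t = 0 \<and> symbol r X \<noteq> string_contents (if r = 0 then x else []) (int z - int T)) \<or>
     (t = 0 \<and> at_head X \<noteq> (z = T)) \<or>
     (t = 0 \<and> at_head X \<and> source X \<noteq> start M) \<or>
     (t = T \<and> at_head X \<and> source X \<noteq> accept M) \<or>
     (t' = t \<and> at_head X \<and> at_head X' \<and> X \<noteq> X') \<or>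
     (t' = t + 1 \<and> at_head X \<and> at_head X' \<and> target X \<noteq> source X') \<or>
     (t' = t + 1 \<and> r' = r \<and> z' = z \<and> new_symbol r X \<noteq> symbol r X') \<or>
     (t' = t + 1 \<and> r' = r \<and> at_head X \<and> at_head X' \<noteq> (z' + 1 = z + next_pos r X))"

text \<open>The pairs include an entry with itself, so that the initial and final conditions, which
  concern a single entry, are covered as well.\<close>

definition consistent :: "(nat \<Rightarrow> nat \<Rightarrow> nat \<Rightarrow> entry) \<Rightarrow> bool" where
  "consistent F \<longleftrightarrow>
     (\<forall>t\<le>T. \<forall>r<tapes M. \<forall>z<2 * T + 1. F t r z \<in> entries) \<and>
     (\<forall>t\<le>T. \<forall>r<tapes M. \<forall>z<2 * T + 1. \<forall>t'\<le>T. \<forall>r'<tapes M. \<forall>z'<2 * T + 1.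
        \<not> bad t r z (F t r z) t' r' z' (F t' r' z'))"

lemma tapes: "1 \<le> tapes M" "0 < tapes M"
  using wf by (auto simp: wf_tm_def)

lemma blank_alphabet: "0 \<in> alphabet M" "bit_symbol b \<in> alphabet M"
  using wf by (cases b; auto simp: wf_tm_def)+

lemma delta_M':
  assumes "(q, a, q', w) \<in> delta M'"
  shows "length a = tapes M" "length w = tapes M" "set a \<subseteq> alphabet M" "fst ` set w \<subseteq> alphabet M"
proof -
  have W: "\<forall>(q, a, q', w) \<in> delta M.
        q \<in> states M \<and> q \<noteq> accept M \<and> q' \<in> states M \<and>
        length a = tapes M \<and> set a \<subseteq> alphabet M \<and>
        length w = tapes M \<and> fst ` set w \<subseteq> alphabet M"
    using wf by (simp add: wf_tm_def)
  have "(q, a, q', w) \<in> delta M \<Longrightarrow> length a = tapes M \<and> length w = tapes M \<and>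
    set a \<subseteq> alphabet M \<and> fst ` set w \<subseteq> alphabet M"
    using bspec[OF W, of "(q, a, q', w)"] by simp
  moreover have "(q, a, q', w) \<in> halts \<Longrightarrow> length a = tapes M \<and> length w = tapes M \<and>
    set a \<subseteq> alphabet M \<and> fst ` set w \<subseteq> alphabet M"
    by (auto simp: halts_def)
  ultimately have "length a = tapes M \<and> length w = tapes M \<and>
    set a \<subseteq> alphabet M \<and> fst ` set w \<subseteq> alphabet M"
    using assms by (auto simp: M'_def)
  then show "length a = tapes M" "length w = tapes M" "set a \<subseteq> alphabet M" "fst ` set w \<subseteq> alphabet M"
    by blast+
qed

lemma finite_entries: "finite entries"
proof -
  have fin: "finite (states M)" "finite (alphabet M)"
    using wf by (auto simp: wf_tm_def)
  have move: "finite (UNIV :: move set)"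
  proof (rule finite_subset)
    show "(UNIV :: move set) \<subseteq> {Left, Stay, Right}" using move.exhaust by blast
  qed simp
  let ?A = "{a. set a \<subseteq> alphabet M \<and> length a = tapes M}"
  let ?W = "{w. set w \<subseteq> alphabet M \<times> (UNIV :: move set) \<and> length w = tapes M}"
  have "delta M' \<subseteq> states M \<times> ?A \<times> states M \<times> ?W"
  proof
    fix \<delta> assume d: "\<delta> \<in> delta M'"
    obtain q a q' w where \<delta>: "\<delta> = (q, a, q', w)" by (cases \<delta>)
    have "q \<in> states M" "q' \<in> states M"
      using d wf by (auto simp: \<delta> M'_def halts_def wf_tm_def)
    then show "\<delta> \<in> states M \<times> ?A \<times> states M \<times> ?W"
      using delta_M'[of q a q' w] d by (force simp: \<delta>)
  qed
  moreover have "finite (states M \<times> ?A \<times> states M \<times> ?W)"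
    using fin move by (intro finite_cartesian_product finite_lists_length_eq) auto
  ultimately have "finite (delta M')" by (rule finite_subset)
  then show ?thesis using fin by (simp add: entries_def)
qed

section \<open>Idle steps in the accepting state\<close>

lemma map2_act_stay: "map2 act (map (stay \<circ> scanned) ts) ts = ts"
  by (intro nth_equalityI) (auto simp: act_scanned_Stay)

lemma step_M':
  assumes "step M' (q, ts) c"
  shows "step M (q, ts) c \<or> (q = accept M \<and> c = (q, ts))"
  using assms
proof cases
  case (1 q' w)
  then show ?thesis
    using map2_act_stay[of ts] by (auto simp: M'_def halts_def intro: step.intros)
qed

lemma step_M'_accepts:
  assumes ts: "(step M' ^^ n) c (accept M, ts)"
  shows "\<exists>t\<le>n. (step M ^^ t) c (accept M, ts)"
  using assms
proof (induction n arbitrary: c)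
  case (Suc n)
  obtain d where d: "step M' c d" "(step M' ^^ n) d (accept M, ts)"
    using relpowp_Suc_D2[OF Suc.prems] by blast
  obtain t where t: "t \<le> n" "(step M ^^ t) d (accept M, ts)"
    using Suc.IH[OF d(2)] by blast
  obtain q us where c: "c = (q, us)" by (cases c)
  from step_M'[OF d(1)[unfolded c]] show ?case
  proof
    assume "step M (q, us) d"
    then have "(step M ^^ Suc t) c (accept M, ts)"
      using t(2) relpowp_Suc_I2[of "step M"] c by metis
    then show ?thesis using t(1) by (intro exI[of _ "Suc t"]) simp
  next
    assume "q = accept M \<and> d = (q, us)"
    then show ?thesis using t c by (intro exI[of _ t]) simp
  qed
qed auto

text \<open>A head moves by at most one cell per step, so up to time \<open>T\<close> it stays in
  the window of width \<open>2 * T + 1\<close>; the condition on symbols makes the cells legal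
  entries.\<close>

definition good :: "nat \<Rightarrow> config \<Rightarrow> bool" where
  "good t c \<longleftrightarrow> length (snd c) = tapes M \<and>
     (\<forall>\<tau>\<in>set (snd c). range (fst \<tau>) \<subseteq> alphabet M \<and> \<bar>snd \<tau>\<bar> \<le> int t)"

lemma good_initial: "good 0 (initial M x)"
  using tapes blank_alphabet by (auto simp: good_def initial_def string_contents_def)

lemma abs_shift: "\<bar>h\<bar> \<le> int t \<Longrightarrow> \<bar>h + shift d\<bar> \<le> int (Suc t)"
  by (cases d) auto

lemma good_step:
  assumes "good t (q, ts)" "(q, map scanned ts, q', w) \<in> delta M'"
  shows "good (Suc t) (q', map2 act w ts)"
proof -
  have w: "length w = tapes M" "fst ` set w \<subseteq> alphabet M"
    using delta_M'[OF assms(2)] by auto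
  have "range (fst \<tau>) \<subseteq> alphabet M \<and> \<bar>snd \<tau>\<bar> \<le> int (Suc t)" if \<tau>: "\<tau> \<in> set (map2 act w ts)" for \<tau>
  proof -
    obtain p where p: "\<tau> = (case p of (bd, \<sigma>) \<Rightarrow> act bd \<sigma>)" "p \<in> set (zip w ts)"
      using \<tau> unfolding set_map by (rule imageE)
    obtain bd \<sigma> where "p = (bd, \<sigma>)" by (cases p)
    with p have z: "(bd, \<sigma>) \<in> set (zip w ts)" "\<tau> = act bd \<sigma>" by simp_all
    obtain b d c h where bd: "bd = (b, d)" "\<sigma> = (c, h)" by (cases bd, cases \<sigma>)
    have "b \<in> alphabet M" using w(2) set_zip_leftD[OF z(1)] bd by force
    moreover have "range c \<subseteq> alphabet M" "\<bar>h\<bar> \<le> int t"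
      using assms(1) bspec[of "set ts" _ "(c, h)"] set_zip_rightD[OF z(1)] bd
      by (simp_all add: good_def) (metis fst_conv, metis snd_conv)
    ultimately show ?thesis using abs_shift[of h t d] by (auto simp: z(2) bd act_def)
  qed
  with w assms(1) show ?thesis by (simp add: good_def)
qed

definition describes :: "(nat \<Rightarrow> nat \<Rightarrow> nat \<Rightarrow> entry) \<Rightarrow> nat \<Rightarrow> tape list \<Rightarrow> transition \<Rightarrow> bool" where
  "describes F t ts \<delta> \<longleftrightarrow> (\<forall>r<tapes M. \<forall>z<2 * T + 1. F t r z =
     (if int z - int T = snd (ts ! r) then Inr \<delta> else Inl (fst (ts ! r) (int z - int T))))"

lemma head_in_window:
  assumes "good t (q, ts)" "t \<le> T" "r < tapes M"
  obtains z where "z < 2 * T + 1" "int z - int T = snd (ts ! r)"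
proof -
  have "\<bar>snd (ts ! r)\<bar> \<le> int t"
    using assms by (auto simp: good_def)
  then show thesis
    using assms(2) by (intro that[of "nat (snd (ts ! r) + int T)"]) auto
qed

text \<open>The head of tape 0 is in the window and carries some transition. Heads at equal times
  must agree, so all tapes carry this same transition, and the symbols in the row show that it fits
  what is scanned.\<close>

lemma describesI:
  assumes F: "consistent F" and t: "t \<le> T" and good: "good t (q, ts)"
    and head: "\<And>r z. r < tapes M \<Longrightarrow> z < 2 * T + 1 \<Longrightarrow> at_head (F t r z) \<longleftrightarrow> int z - int T = snd (ts ! r)"
    and symbol: "\<And>r z. r < tapes M \<Longrightarrow> z < 2 * T + 1 \<Longrightarrow> symbol r (F t r z) = fst (ts ! r) (int z - int T)"
    and source: "\<And>r z. r < tapes M \<Longrightarrow> z < 2 * T + 1 \<Longrightarrow> at_head (F t r z) \<Longrightarrow> source (F t r z) = q"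
  shows "\<exists>q' w. (q, map scanned ts, q', w) \<in> delta M' \<and> describes F t ts (q, map scanned ts, q', w)"
proof -
  have len: "length ts = tapes M" using good by (simp add: good_def)
  obtain z0 where z0: "z0 < 2 * T + 1" "int z0 - int T = snd (ts ! 0)"
    using head_in_window[OF good t tapes(2)] .
  have "F t 0 z0 \<in> entries" "at_head (F t 0 z0)"
    using F t tapes z0 head by (auto simp: consistent_def)
  then obtain q0 a q' w where d: "F t 0 z0 = Inr (q0, a, q', w)" "(q0, a, q', w) \<in> delta M'"
    by (auto simp: entries_def)
  have [simp]: "q0 = q"
    using source[OF tapes(2) z0(1)] head[OF tapes(2) z0(1)] d z0 by simp
  have all: "F t r z = Inr (q0, a, q', w)" if "r < tapes M" "z < 2 * T + 1" "at_head (F t r z)" for r z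
  proof -
    have "\<not> bad t 0 z0 (F t 0 z0) t r z (F t r z)"
      using F t tapes z0 that by (auto simp: consistent_def)
    then show ?thesis using that(3) d by (auto simp: bad_def)
  qed
  have "a ! r = scanned (ts ! r)" if r: "r < tapes M" for r
  proof -
    obtain z where z: "z < 2 * T + 1" "int z - int T = snd (ts ! r)"
      using head_in_window[OF good t r] .
    then have "F t r z = Inr (q0, a, q', w)" using all head r by simp
    then show ?thesis
      using symbol[OF r z(1)] z(2) by (auto simp: scanned_def split: prod.splits)
  qed
  then have a: "a = map scanned ts"
    using delta_M'(1)[OF d(2)] len by (intro nth_equalityI) auto
  have "describes F t ts (q, a, q', w)"
    unfolding describes_def
  proof (intro allI impI)
    fix r z assume rz: "r < tapes M" "z < 2 * T + 1"
    show "F t r z = (if int z - int T = snd (ts ! r) then Inr (q, a, q', w) else Inl (fst (ts ! r) (int z - int T)))"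
      using all[OF rz] head[OF rz] symbol[OF rz] by (cases "F t r z") auto
  qed
  then show ?thesis using d a by auto
qed

text \<open>Row \<open>t\<close> names the transition to take, so no choice is left. The clauses of
  \<open>bad\<close> for \<open>t' = t + 1\<close> then fix the heads, symbols and state of the next
  row, and \<open>describesI\<close> supplies its transition.\<close>

lemma consistent_imp_run:
  assumes F: "consistent F" and "t \<le> T"
  shows "\<exists>q ts q' w. (step M' ^^ t) (initial M x) (q, ts) \<and> good t (q, ts) \<and>
    (q, map scanned ts, q', w) \<in> delta M' \<and> describes F t ts (q, map scanned ts, q', w)"
  using assms(2)
proof (induction t)
  case 0
  obtain q ts where qts: "initial M x = (q, ts)" by (cases "initial M x")
  have q: "q = start M" and nth: "\<And>r. r < tapes M \<Longrightarrow> ts ! r = (string_contents (if r = 0 then x else []), 0)"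
    using qts by (auto simp: initial_def nth_Cons')
  have nb: "\<not> bad 0 r z (F 0 r z) 0 r z (F 0 r z)" if "r < tapes M" "z < 2 * T + 1" for r z
    using F that by (simp add: consistent_def)
  have "\<exists>q' w. (q, map scanned ts, q', w) \<in> delta M' \<and> describes F 0 ts (q, map scanned ts, q', w)"
  proof (rule describesI[OF F])
    show "good 0 (q, ts)" using good_initial qts by simp
  qed (use nb nth q in \<open>auto simp: bad_def\<close>)
  then show ?case using good_initial qts by auto
next
  case (Suc t)
  then obtain q ts q' w where IH: "(step M' ^^ t) (initial M x) (q, ts)" "good t (q, ts)"
    "(q, map scanned ts, q', w) \<in> delta M'" "describes F t ts (q, map scanned ts, q', w)"
    by auto
  let ?\<delta> = "(q, map scanned ts, q', w)"
  let ?ts = "map2 act w ts"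
  have len: "length ts = tapes M" "length w = tapes M"
    using IH(2) delta_M'[OF IH(3)] by (auto simp: good_def)
  have run: "(step M' ^^ Suc t) (initial M x) (q', ?ts)"
    using relpowp_Suc_I[OF IH(1)] step.intros[OF IH(3)] by blast
  have good: "good (Suc t) (q', ?ts)" using good_step[OF IH(2,3)] .
  have "\<exists>q'' w'. (q', map scanned ?ts, q'', w') \<in> delta M' \<and> describes F (Suc t) ?ts (q', map scanned ?ts, q'', w')"
  proof (rule describesI[OF F Suc.prems good])
    fix r z assume rz: "r < tapes M" "z < 2 * T + 1"
    obtain c h where ch: "ts ! r = (c, h)" by (cases "ts ! r")
    obtain b d where bd: "w ! r = (b, d)" by (cases "w ! r")
    have nth: "?ts ! r = (c(h := b), h + shift d)"
      using rz len by (simp add: ch bd act_def)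
    obtain z0 where z0: "z0 < 2 * T + 1" "int z0 - int T = h"
      using head_in_window[OF IH(2) _ rz(1)] Suc.prems ch by auto
    have F0: "F t r z0 = Inr ?\<delta>"
      using IH(4) rz z0 ch by (simp add: describes_def)
    have "\<not> bad t r z0 (F t r z0) (Suc t) r z (F (Suc t) r z)" "\<not> bad t r z (F t r z) (Suc t) r z (F (Suc t) r z)"
      using F Suc.prems rz z0 by (auto simp: consistent_def)
    then have nb: "at_head (F (Suc t) r z) = (z + 1 = z0 + offset d)" "new_symbol r (F t r z) = symbol r (F (Suc t) r z)"
      "at_head (F (Suc t) r z) \<Longrightarrow> source (F (Suc t) r z) = q'"
      by (auto simp: bad_def F0 bd)
    show "at_head (F (Suc t) r z) \<longleftrightarrow> int z - int T = snd (?ts ! r)"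
      unfolding nb nth using z0 offset_shift[of d] by auto
    show "symbol r (F (Suc t) r z) = fst (?ts ! r) (int z - int T)"
      unfolding nb(2)[symmetric] nth using IH(4) rz ch bd by (auto simp: describes_def)
    show "at_head (F (Suc t) r z) \<Longrightarrow> source (F (Suc t) r z) = q'" by (rule nb(3))
  qed
  then show ?case using run good by blast
qed

lemma consistent_imp_accepts:
  assumes "consistent F"
  shows "\<exists>t\<le>T. accepts_in M x t"
proof -
  obtain q ts q' w where run: "(step M' ^^ T) (initial M x) (q, ts)" "good T (q, ts)"
    "describes F T ts (q, map scanned ts, q', w)"
    using consistent_imp_run[OF assms le_refl] by blast
  obtain z where z: "z < 2 * T + 1" "int z - int T = snd (ts ! 0)"
    using head_in_window[OF run(2) le_refl tapes(2)] .
  have "\<not> bad T 0 z (F T 0 z) T 0 z (F T 0 z)"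
    using assms tapes(2) z by (simp add: consistent_def)
  moreover have "F T 0 z = Inr (q, map scanned ts, q', w)"
    using run(3) tapes(2) z by (simp add: describes_def)
  ultimately have "q = accept M" by (simp add: bad_def)
  then show ?thesis
    using step_M'_accepts run(1) unfolding accepts_in_def by blast
qed

lemma accepts_imp_consistent:
  assumes "t \<le> T" "accepts_in M x t"
  shows "\<exists>F. consistent F"
proof -
  obtain ts where ts: "(step M ^^ t) (initial M x) (accept M, ts)"
    using assms(2) unfolding accepts_in_def by blast
  have sub: "step M c d \<Longrightarrow> step M' c d" for c d
    by (erule step.cases) (auto simp: M'_def intro: step.intros)
  have good_run: "good n c" if "(step M' ^^ n) (initial M x) c" for n c
    using that
  proof (induction n arbitrary: c)
    case (Suc n)
    then obtain q us where d: "(step M' ^^ n) (initial M x) (q, us)" "step M' (q, us) c"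
      by auto
    from d(2) Suc.IH[OF d(1)] show ?case
      by cases (auto intro: good_step)
  qed (use good_initial in auto)
  have mono: "(step M' ^^ t) (initial M x) (accept M, ts)"
    using ts by (rule relpowp_mono[rotated]) (use sub in auto)
  have halt: "good n (accept M, us) \<Longrightarrow> (accept M, map scanned us, accept M, map stay (map scanned us)) \<in> delta M'" for n us
  proof -
    assume g: "good n (accept M, us)"
    have "scanned \<tau> \<in> alphabet M" if "\<tau> \<in> set us" for \<tau>
    proof -
      have "range (fst \<tau>) \<subseteq> alphabet M" using g that by (simp add: good_def)
      then show ?thesis by (cases \<tau>) (auto simp: scanned_def)
    qed
    then have "set (map scanned us) \<subseteq> alphabet M" by auto
    with g show ?thesis by (auto simp: M'_def halts_def good_def)
  qed
  \<comment> \<open>The tableau has a fixed height, so shorter runs wait in the accepting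
    state.\<close>
  have pad: "(step M' ^^ (t + n)) (initial M x) (accept M, ts)" for n
  proof (induction n)
    case (Suc n)
    have "step M' (accept M, ts) (accept M, ts)"
      using step.intros[OF halt[OF good_run[OF Suc]]] by (simp add: map2_act_stay)
    with Suc show ?case by auto
  qed (use mono in simp)
  have "(step M' ^^ T) (initial M x) (accept M, ts)"
    using pad[of "T - t"] assms(1) by simp
  then obtain C where C: "C 0 = initial M x" "C T = (accept M, ts)" "\<And>i. i < T \<Longrightarrow> step M' (C i) (C (Suc i))"
    unfolding relpowp_fun_conv by blast
  have "(step M' ^^ i) (initial M x) (C i)" if "i \<le> T" for i
    using that
  proof (induction i)
    case (Suc i)
    then show ?case using C(3)[of i] by auto
  qed (use C in simp)
  then have good: "good i (C i)" if "i \<le> T" for i using good_run that by blast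
  \<comment> \<open>The last row too must show a transition, although no step follows it; the idle
    one serves.\<close>
  have "\<exists>q' w. (fst (C i), map scanned (snd (C i)), q', w) \<in> delta M' \<and>
    (i < T \<longrightarrow> C (Suc i) = (q', map2 act w (snd (C i))))" if "i \<le> T" for i
  proof (cases "i < T")
    case True
    from C(3)[OF True] show ?thesis
      by (rule step.cases) (use True in auto)
  next
    case False
    then have "i = T" using that by simp
    with halt[of T ts] good[of T] C(2) show ?thesis by auto
  qed
  then have "\<forall>i. \<exists>p. i \<le> T \<longrightarrow> (fst (C i), map scanned (snd (C i)), p) \<in> delta M' \<and>
    (i < T \<longrightarrow> C (Suc i) = (fst p, map2 act (snd p) (snd (C i))))"
    by fastforce
  from choice[OF this] obtain p where p: "\<And>i. i \<le> T \<Longrightarrow> (fst (C i), map scanned (snd (C i)), p i) \<in> delta M' \<and>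
    (i < T \<longrightarrow> C (Suc i) = (fst (p i), map2 act (snd (p i)) (snd (C i))))"
    by blast
  define q' w where "q' i = fst (p i)" and "w i = snd (p i)" for i
  have \<delta>: "\<And>i. i \<le> T \<Longrightarrow> (fst (C i), map scanned (snd (C i)), q' i, w i) \<in> delta M'"
    "\<And>i. i < T \<Longrightarrow> C (Suc i) = (q' i, map2 act (w i) (snd (C i)))"
    using p by (auto simp: q'_def w_def)
  define F where "F i r z = (if int z - int T = snd (snd (C i) ! r)
    then Inr (fst (C i), map scanned (snd (C i)), q' i, w i) else Inl (fst (snd (C i) ! r) (int z - int T)))"
    for i r and z :: nat
  have len: "length (snd (C i)) = tapes M" if "i \<le> T" for i
    using good[OF that] by (simp add: good_def)
  have symbol: "symbol r (F i r z) = fst (snd (C i) ! r) (int z - int T)" if "i \<le> T" "r < tapes M" for i r z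
    using len that by (auto simp: F_def scanned_def split: prod.splits)
  have "F i r z \<in> entries" if "i \<le> T" "r < tapes M" for i r z
  proof -
    have "snd (C i) ! r \<in> set (snd (C i))" using that len by simp
    then have "range (fst (snd (C i) ! r)) \<subseteq> alphabet M"
      using good[OF that(1)] by (auto simp: good_def)
    then show ?thesis using \<delta>(1)[OF that(1)] by (auto simp: F_def entries_def)
  qed
  moreover have "\<not> bad i r z (F i r z) i' r' z' (F i' r' z')"
    if i: "i \<le> T" "i' \<le> T" and r: "r < tapes M" "r' < tapes M" for i r z i' r' z'
  proof
    assume b: "bad i r z (F i r z) i' r' z' (F i' r' z')"
    have init: "snd (initial M x) ! r = (string_contents (if r = 0 then x else []), 0)"
      using r(1) by (auto simp: initial_def nth_Cons')
    have next_C: "snd (C (Suc i)) ! r = act (w i ! r) (snd (C i) ! r)" if "i < T"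
      using \<delta>(2)[OF that] len[OF i(1)] delta_M'(2)[OF \<delta>(1)[OF i(1)]] r(1) by simp
    obtain b' d where bd: "w i ! r = (b', d)" by (cases "w i ! r")
    obtain c h where ch: "snd (C i) ! r = (c, h)" by (cases "snd (C i) ! r")
    from b[unfolded bad_def] show False
    proof (elim disjE conjE)
      assume "i = 0" "symbol r (F i r z) \<noteq> string_contents (if r = 0 then x else []) (int z - int T)"
      then show False using symbol[OF i(1) r(1)] init C(1) by simp
    next
      assume "i = 0" "at_head (F i r z) \<noteq> (z = T)"
      then show False using init C(1) by (auto simp: F_def split: if_splits)
    next
      assume "i = 0" "at_head (F i r z)" "source (F i r z) \<noteq> start M"
      then show False using C(1) by (auto simp: F_def initial_def split: if_splits)
    next
      assume "i = T" "at_head (F i r z)" "source (F i r z) \<noteq> accept M"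
      then show False using C(2) by (auto simp: F_def split: if_splits)
    next
      assume "i' = i" "at_head (F i r z)" "at_head (F i' r' z')" "F i r z \<noteq> F i' r' z'"
      then show False by (auto simp: F_def split: if_splits)
    next
      assume "i' = i + 1" "at_head (F i r z)" "at_head (F i' r' z')" "target (F i r z) \<noteq> source (F i' r' z')"
      then show False using \<delta>(2)[of i] i by (auto simp: F_def split: if_splits)
    next
      assume a: "i' = i + 1" "r' = r" "z' = z" "new_symbol r (F i r z) \<noteq> symbol r (F i' r' z')"
      then have "symbol r (F i' r' z') = (c(h := b')) (int z - int T)"
        using symbol[of i' r z] next_C i r by (simp add: ch bd act_def)
      then show False using a(4) by (auto simp: F_def ch bd split: if_splits)
    next
      assume a: "i' = i + 1" "r' = r" "at_head (F i r z)" "at_head (F i' r' z') \<noteq> (z' + 1 = z + next_pos r (F i r z))"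
      then have z: "int z - int T = h" "next_pos r (F i r z) = offset d"
        by (auto simp: F_def ch bd split: if_splits)
      have "at_head (F i' r' z') \<longleftrightarrow> int z' - int T = h + shift d"
        using a(1,2) next_C i by (auto simp: F_def ch bd act_def)
      then show False using a(4) z offset_shift[of d] by auto
    qed
  qed
  ultimately have "consistent F" unfolding consistent_def by blast
  then show ?thesis by blast
qed

theorem consistent_iff: "(\<exists>F. consistent F) \<longleftrightarrow> (\<exists>t\<le>T. accepts_in M x t)"
  using consistent_imp_accepts accepts_imp_consistent by blast

end

section \<open>A library of expressions\<close>

abbreviation holds :: "bool list \<Rightarrow> bool list \<Rightarrow> exp \<Rightarrow> env \<Rightarrow> bool" where
  "holds x g e \<sigma> \<equiv> eval x g e \<sigma> \<noteq> 0"

definition Neg :: "exp \<Rightarrow> exp" where "Neg a = Sub (Const 1) a"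
definition Conj :: "exp \<Rightarrow> exp \<Rightarrow> exp" where "Conj a b = Mul a b"
definition Disj :: "exp \<Rightarrow> exp \<Rightarrow> exp" where "Disj a b = Add a b"
definition Less :: "exp \<Rightarrow> exp \<Rightarrow> exp" where "Less a b = Sub b a"
definition Leq :: "exp \<Rightarrow> exp \<Rightarrow> exp" where "Leq a b = Neg (Sub a b)"
definition Eq :: "exp \<Rightarrow> exp \<Rightarrow> exp" where "Eq a b = Neg (Add (Sub a b) (Sub b a))"
definition Exists :: "nat \<Rightarrow> exp \<Rightarrow> exp \<Rightarrow> exp" where "Exists v a b = Sum v a b"
definition Forall :: "nat \<Rightarrow> exp \<Rightarrow> exp \<Rightarrow> exp" where "Forall v a b = Neg (Exists v a (Neg b))"
text \<open>Any nonzero value counts as true; this normalises it to 1, so that truth values can be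
  counted or used as factors.\<close>

definition Truth :: "exp \<Rightarrow> exp" where "Truth a = Neg (Neg a)"
definition Any :: "exp list \<Rightarrow> exp" where "Any es = foldr Disj es (Const 0)"

lemma holds_simps [simp]:
  "eval x g (Neg a) \<sigma> = 0 \<longleftrightarrow> holds x g a \<sigma>"
  "eval x g (Conj a b) \<sigma> = 0 \<longleftrightarrow> eval x g a \<sigma> = 0 \<or> eval x g b \<sigma> = 0"
  "eval x g (Disj a b) \<sigma> = 0 \<longleftrightarrow> eval x g a \<sigma> = 0 \<and> eval x g b \<sigma> = 0"
  "eval x g (Less a b) \<sigma> = 0 \<longleftrightarrow> \<not> eval x g a \<sigma> < eval x g b \<sigma>"
  "eval x g (Leq a b) \<sigma> = 0 \<longleftrightarrow> \<not> eval x g a \<sigma> \<le> eval x g b \<sigma>"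
  "eval x g (Eq a b) \<sigma> = 0 \<longleftrightarrow> eval x g a \<sigma> \<noteq> eval x g b \<sigma>"
  "eval x g (Exists v a b) \<sigma> = 0 \<longleftrightarrow> (\<forall>i<eval x g a \<sigma>. eval x g b (\<sigma>(v := i)) = 0)"
  by (auto simp: Neg_def Conj_def Disj_def Less_def Leq_def Eq_def Exists_def)

lemma holds_Forall [simp]:
  "eval x g (Forall v a b) \<sigma> = 0 \<longleftrightarrow> \<not> (\<forall>i<eval x g a \<sigma>. holds x g b (\<sigma>(v := i)))"
  by (simp add: Forall_def)

lemma eval_Truth [simp]: "eval x g (Truth a) \<sigma> = of_bool (holds x g a \<sigma>)"
  by (auto simp: Truth_def Neg_def)

lemma eval_Any [simp]: "eval x g (Any es) \<sigma> = 0 \<longleftrightarrow> (\<forall>e\<in>set es. eval x g e \<sigma> = 0)"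
  by (induction es) (auto simp: Any_def)

text \<open>Horner's scheme.\<close>

definition Poly :: "nat poly \<Rightarrow> exp \<Rightarrow> exp" where
  "Poly p a = foldr (\<lambda>c e. Add (Const c) (Mul a e)) (coeffs p) (Const 0)"

lemma eval_Poly [simp]: "eval x g (Poly p a) \<sigma> = poly p (eval x g a \<sigma>)"
proof (induction p)
  case (pCons c p)
  then show ?case
    by (simp add: Poly_def cCons_def)
qed (simp add: Poly_def)

text \<open>The binders 90 to 92 are reserved for the auxiliary predicates.\<close>

definition Pow2 :: "exp \<Rightarrow> exp" where
  "Pow2 a = Conj (Less (Const 0) a)
     (Neg (Exists 90 (Add a (Const 1)) (Exists 91 (Add a (Const 1))
       (Eq (Mul (Var 90) (Add (Mul (Const 2) (Var 91)) (Const 3))) a))))"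

text \<open>For a power of two \<open>b\<close> this reads a binary digit of \<open>a\<close>. The
  quotient is pinned down by two inequalities instead of a division.\<close>

definition Odd_div :: "exp \<Rightarrow> exp \<Rightarrow> exp" where
  "Odd_div a b = Exists 92 (Add a (Const 1))
     (Conj (Leq (Mul (Add (Mul (Const 2) (Var 92)) (Const 1)) b) a)
          (Less a (Mul (Add (Mul (Const 2) (Var 92)) (Const 2)) b)))"

text \<open>Powers of two are the positive numbers without an odd divisor greater than 1, and
  \<open>2 * b + 3\<close> runs through these divisors. This replaces an exponential by a
  product.\<close>

lemma power_of_2_iff: "(\<exists>i. q = 2 ^ i) \<longleftrightarrow> 0 < q \<and> (\<forall>a b. a * (2 * b + 3) \<noteq> (q :: nat))"
proof
  assume "\<exists>i. q = 2 ^ i"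
  then obtain i where i: "q = 2 ^ i" by blast
  have "a * (2 * b + 3) \<noteq> q" for a b
  proof
    assume "a * (2 * b + 3) = q"
    then have "2 * b + 3 dvd 2 ^ i" using i by (metis dvd_triv_right)
    then obtain j where "2 * b + 3 = 2 ^ j"
      by (metis divides_primepow_nat two_is_prime_nat)
    then show False by (cases j) (auto, presburger)
  qed
  then show "0 < q \<and> (\<forall>a b. a * (2 * b + 3) \<noteq> q)" using i by simp
next
  assume q: "0 < q \<and> (\<forall>a b. a * (2 * b + 3) \<noteq> q)"
  then show "\<exists>i. q = 2 ^ i"
  proof (induction q rule: less_induct)
    case (less q)
    show ?case
    proof (cases "even q")
      case True
      then obtain r where r: "q = 2 * r" by blast
      have "a * (2 * b + 3) \<noteq> r" for a b
      proof
        assume "a * (2 * b + 3) = r"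
        then have "(2 * a) * (2 * b + 3) = q" using r by (metis mult.assoc)
        then show False using less.prems by blast
      qed
      with less.prems r obtain i where "r = 2 ^ i" using less.IH[of r] by auto
      then show ?thesis using r by (intro exI[of _ "Suc i"]) simp
    next
      case False
      then obtain b where b: "q = 2 * b + 1" by (rule oddE)
      show ?thesis
      proof (cases b)
        case 0
        then show ?thesis using b by (intro exI[of _ 0]) simp
      next
        case (Suc c)
        then have "1 * (2 * c + 3) = q" using b by simp
        then show ?thesis using less.prems by blast
      qed
    qed
  qed
qed

text \<open>The assumptions say that \<open>a\<close> is independent of the binders. Bounding the
  search by the value of \<open>a\<close> is harmless, since both factors of a positive product are
  at most that product.\<close>

lemma holds_Pow2:
  assumes "\<And>i j. eval x g a (\<sigma>(90 := i)) = eval x g a \<sigma>" "\<And>i j. eval x g a (\<sigma>(90 := i, 91 := j)) = eval x g a \<sigma>"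
  shows "holds x g (Pow2 a) \<sigma> \<longleftrightarrow> (\<exists>i. eval x g a \<sigma> = 2 ^ i)"
proof -
  let ?q = "eval x g a \<sigma>"
  have "i < ?q + 1 \<and> j < ?q + 1" if "i * (2 * j + 3) = ?q" "0 < ?q" for i j
  proof -
    have "i \<noteq> 0" using that by (metis less_irrefl mult_0)
    then have "2 * j + 3 \<le> ?q" "i \<le> ?q" using that by (auto simp: that(1)[symmetric])
    then show ?thesis by auto
  qed
  moreover have "holds x g (Pow2 a) \<sigma> \<longleftrightarrow> 0 < ?q \<and> \<not> (\<exists>i<?q + 1. \<exists>j<?q + 1. i * (2 * j + 3) = ?q)"
    by (simp add: Pow2_def assms)
  ultimately show ?thesis
    unfolding power_of_2_iff by blast
qed

lemma holds_Odd_div: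
  assumes "\<And>i. eval x g a (\<sigma>(92 := i)) = eval x g a \<sigma>" "\<And>i. eval x g b (\<sigma>(92 := i)) = eval x g b \<sigma>"
    and "0 < eval x g b \<sigma>"
  shows "holds x g (Odd_div a b) \<sigma> \<longleftrightarrow> odd (eval x g a \<sigma> div eval x g b \<sigma>)"
proof -
  let ?l = "eval x g a \<sigma>" let ?q = "eval x g b \<sigma>"
  have "(2 * i + 1) * ?q \<le> ?l \<and> ?l < (2 * i + 2) * ?q \<longleftrightarrow> ?l div ?q = 2 * i + 1" for i
    using assms(3) less_eq_div_iff_mult_less_eq[of ?q "2 * i + 1" ?l] div_less_iff_less_mult[of ?q ?l "2 * i + 2"]
    by linarith
  moreover have "i < ?l + 1" if "?l div ?q = 2 * i + 1" for i
    using div_le_dividend[of ?l ?q] that by simp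
  ultimately have "holds x g (Odd_div a b) \<sigma> \<longleftrightarrow> (\<exists>i. ?l div ?q = 2 * i + 1)"
    unfolding Odd_div_def using assms(1,2) by auto
  then show ?thesis by (auto elim: oddE)
qed

text \<open>A power of two is 1 or the double of one up to half the bound: the recursion of
  \<open>binary\<close>, seen on the weights.\<close>

lemma filter_power_of_2:
  assumes "0 < l"
  shows "filter (\<lambda>q. \<exists>i. q = 2 ^ i) [0..<Suc l] = 1 # map ((*) 2) (filter (\<lambda>q. \<exists>i. q = 2 ^ i) [0..<Suc (l div 2)])"
    (is "?A = 1 # map _ ?B")
proof (rule sorted_distinct_set_unique)
  note upt_Suc [simp del]
  have "sorted ?B" "distinct ?B" by (auto intro: sorted_wrt_filter simp del: upt_Suc)
  then show "sorted (1 # map ((*) 2) ?B)" "distinct (1 # map ((*) 2) ?B)"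
    by (auto simp: sorted_map distinct_map inj_on_def simp del: upt_Suc)
  show "set ?A = set (1 # map ((*) 2) ?B)"
  proof (intro set_eqI iffI)
    fix q assume "q \<in> set ?A"
    then obtain i where i: "q = 2 ^ i" "q \<le> l" by auto
    show "q \<in> set (1 # map ((*) 2) ?B)"
    proof (cases i)
      case (Suc j)
      then have "q = 2 * 2 ^ j" "2 ^ j \<le> l div 2" using i by auto
      then show ?thesis by auto
    qed (use i in auto)
  next
    fix q assume "q \<in> set (1 # map ((*) 2) ?B)"
    then consider "q = 1" | i where "q = 2 * 2 ^ i" "2 ^ i \<le> l div 2" by auto
    then show "q \<in> set ?A"
    proof cases
      case 1
      then show ?thesis using assms by (auto intro: exI[of _ 0])
    next
      case 2
      then show ?thesis by (auto intro: exI[of _ "Suc i"])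
    qed
  qed
qed (auto intro: sorted_wrt_filter simp del: upt_Suc)

lemma binary_filter:
  "binary l = map (\<lambda>q. odd (l div q)) (filter (\<lambda>q. \<exists>i. q = 2 ^ i) [0..<Suc l])"
proof (induction l rule: less_induct)
  case (less l)
  show ?case
  proof (cases "l = 0")
    case False
    then have "binary l = odd l # binary (l div 2)"
      by (simp add: binary.simps[of l])
    also have "\<dots> = map (\<lambda>q. odd (l div q)) (filter (\<lambda>q. \<exists>i. q = 2 ^ i) [0..<Suc l])"
      using False less[of "l div 2"] by (simp only: filter_power_of_2) (simp add: div_mult2_eq)
    finally show ?thesis .
  qed (simp add: binary.simps)
qed

lemma concat_map_if: "concat (map (\<lambda>v. if P v then [f v] else []) vs) = map f (filter P vs)"
  by (induction vs) auto

text \<open>The inner loop runs at most once and acts as a conditional, selecting the powers of two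
  among all weights up to the number. This is affordable because the printed number is itself
  polynomial.\<close>

definition Emit_binary :: "exp \<Rightarrow> out" where
  "Emit_binary a = OFor 93 (Add a (Const 1))
     (OFor 94 (Truth (Pow2 (Var 93))) (Emit (Odd_div a (Var 93))))"

lemma emitted_Emit_binary:
  assumes "\<And>\<sigma>'. \<sigma>' 0 = \<sigma> 0 \<Longrightarrow> eval x g a \<sigma>' = l"
  shows "emitted x g (Emit_binary a) \<sigma> = binary l"
proof -
  have a: "eval x g a (\<sigma>(93 := q, 94 := j)) = l" "eval x g a \<sigma> = l" "eval x g a (\<sigma>(93 := q, 94 := j, 92 := i)) = l" for q i j
    by (rule assms, simp)+
  have P: "holds x g (Pow2 (Var 93)) (\<sigma>(93 := q)) \<longleftrightarrow> (\<exists>i. q = 2 ^ i)" for q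
    by (subst holds_Pow2) auto
  have O: "holds x g (Odd_div a (Var 93)) (\<sigma>(93 := q, 94 := j)) \<longleftrightarrow> odd (l div q)" if "\<exists>i. q = 2 ^ i" for q j
    by (subst holds_Odd_div) (use that a in auto)
  have "emitted x g (OFor 94 (Truth (Pow2 (Var 93))) (Emit (Odd_div a (Var 93)))) (\<sigma>(93 := q)) =
    (if \<exists>i. q = 2 ^ i then [odd (l div q)] else [])" for q
    using P[of q] O[of q] by auto
  then show ?thesis
    unfolding Emit_binary_def binary_filter
    by (simp add: a concat_map_if del: upt_Suc)
qed

section \<open>Invariance of limited domination under renaming of vertices\<close>

lemma limited_dominating_set_image:
  assumes "simple_graph V E" "inj_on h V" "limited_dominating_set k V E D"
  shows "limited_dominating_set k (h ` V) ((`) h ` E) (h ` D)" "card (h ` D) = card D"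
proof -
  have E: "\<And>e. e \<in> E \<Longrightarrow> e \<subseteq> V" and D: "D \<subseteq> V"
    using assms(1,3) by (auto simp: simple_graph_def limited_dominating_set_def dominating_set_def)
  have edge: "{h u, h v} \<in> (`) h ` E \<longleftrightarrow> {u, v} \<in> E" if "u \<in> V" "v \<in> V" for u v
  proof
    assume "{h u, h v} \<in> (`) h ` E"
    then obtain e where e: "e \<in> E" "h ` {u, v} = h ` e" by auto
    then have "{u, v} = e"
      using inj_on_image_eq_iff[OF assms(2), of "{u, v}" e] E that by auto
    with e show "{u, v} \<in> E" by simp
  next
    assume "{u, v} \<in> E"
    then show "{h u, h v} \<in> (`) h ` E" by (intro image_eqI[of _ _ "{u, v}"]) auto
  qed
  have nb: "neighborhood ((`) h ` E) (h u) = h ` neighborhood E u" if "u \<in> V" for u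
  proof (intro set_eqI iffI)
    fix y assume "y \<in> neighborhood ((`) h ` E) (h u)"
    then have y: "{h u, y} \<in> (`) h ` E" by (simp add: neighborhood_def)
    then obtain v where v: "v \<in> V" "y = h v" using E by blast
    then show "y \<in> h ` neighborhood E u"
      using y edge that by (auto simp: neighborhood_def)
  next
    fix y assume "y \<in> h ` neighborhood E u"
    then obtain v where v: "{u, v} \<in> E" "y = h v" by (auto simp: neighborhood_def)
    then have "v \<in> V" using E by auto
    then show "y \<in> neighborhood ((`) h ` E) (h u)"
      using v edge that by (auto simp: neighborhood_def)
  qed
  have nbV: "neighborhood E u \<subseteq> V" for u
    using E by (auto simp: neighborhood_def)
  have diff: "neighborhood ((`) h ` E) (h u) - h ` D = h ` (neighborhood E u - D)" if "u \<in> V" for u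
    unfolding nb[OF that] using inj_on_image_set_diff[OF assms(2), of "neighborhood E u" D] nbV D by blast
  have "dominating_set (h ` V) ((`) h ` E) (h ` D)"
    unfolding dominating_set_def
  proof (intro conjI ballI)
    fix y assume "y \<in> h ` V - h ` D"
    then obtain v where v: "v \<in> V - D" "y = h v" by auto
    then have "neighborhood E v \<inter> D \<noteq> {}"
      using assms(3) by (auto simp: limited_dominating_set_def dominating_set_def)
    then show "neighborhood ((`) h ` E) y \<inter> h ` D \<noteq> {}"
      using v nb[of v] by auto
  qed (use D in auto)
  moreover have "card (neighborhood ((`) h ` E) (h u) - h ` D) \<le> k" if "u \<in> D" for u
  proof -
    have "u \<in> V" using that D by blast
    then have "card (neighborhood ((`) h ` E) (h u) - h ` D) = card (neighborhood E u - D)"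
      using diff card_image[OF inj_on_subset[OF assms(2)], of "neighborhood E u - D"] nbV by fastforce
    then show ?thesis
      using assms(3) that by (simp add: limited_dominating_set_def)
  qed
  ultimately show "limited_dominating_set k (h ` V) ((`) h ` E) (h ` D)"
    by (auto simp: limited_dominating_set_def)
  show "card (h ` D) = card D"
    using card_image inj_on_subset[OF assms(2) D] by blast
qed

lemma simple_graph_image:
  assumes "simple_graph V E" "inj_on h V"
  shows "simple_graph (h ` V) ((`) h ` E)"
  unfolding simple_graph_def
proof (intro conjI ballI)
  show "finite (h ` V)" using assms(1) by (simp add: simple_graph_def)
  fix e assume "e \<in> (`) h ` E"
  then obtain d where "d \<in> E" "e = h ` d" by auto
  moreover from this have "d \<subseteq> V" "card d = 2" using assms(1) by (auto simp: simple_graph_def)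
  ultimately show "e \<subseteq> h ` V" "card e = 2"
    using card_image[OF inj_on_subset[OF assms(2)]] by auto
qed

lemma limited_dominating_set_image_iff:
  assumes "simple_graph V E" "inj_on h V"
  shows "(\<exists>D. limited_dominating_set k (h ` V) ((`) h ` E) D \<and> card D \<le> l) \<longleftrightarrow>
    (\<exists>D. limited_dominating_set k V E D \<and> card D \<le> l)"
proof
  let ?h = "inv_into V h"
  assume "\<exists>D. limited_dominating_set k (h ` V) ((`) h ` E) D \<and> card D \<le> l"
  then obtain D where D: "limited_dominating_set k (h ` V) ((`) h ` E) D" "card D \<le> l" by blast
  have V: "?h ` h ` V = V"
    using inv_into_image_cancel[OF assms(2) order_refl] .
  have E: "(`) ?h ` (`) h ` E = E"
  proof -
    have "?h ` h ` e = e" if "e \<in> E" for e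
      using inv_into_image_cancel[OF assms(2)] assms(1) that by (simp add: simple_graph_def)
    then show ?thesis by (auto simp: image_image image_iff)
  qed
  have "inj_on ?h (h ` V)" by (rule inj_on_inv_into) simp
  from limited_dominating_set_image[OF simple_graph_image[OF assms] this D(1)] D(2)
  show "\<exists>D. limited_dominating_set k V E D \<and> card D \<le> l"
    unfolding V E by metis
next
  assume "\<exists>D. limited_dominating_set k V E D \<and> card D \<le> l"
  then show "\<exists>D. limited_dominating_set k (h ` V) ((`) h ` E) D \<and> card D \<le> l"
    using limited_dominating_set_image[OF assms] by metis
qed

section \<open>NP-hardness\<close>

lemma digits_less: "a < A \<Longrightarrow> b < B \<Longrightarrow> a * B + b < A * (B :: nat)"
proof -
  assume a: "a < A" "b < B"
  then have "a * B + b < (a + 1) * B" by simp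
  also have "\<dots> \<le> A * B" using a by (intro mult_right_mono) auto
  finally show ?thesis .
qed

lemma digits_inject: "a * B + b = a' * B + b' \<Longrightarrow> b < B \<Longrightarrow> b' < B \<Longrightarrow> a = a' \<and> b = (b' :: nat)"
  by (metis add.commute div_mult_self1 div_less mod_less mod_mult_self1 add_0 gr_implies_not0)

lemma div_less_of_less_mult: "v < A * B \<Longrightarrow> v div B < (A :: nat)"
  by (simp add: less_mult_imp_div_less)

locale reduction =
  fixes k :: nat and M :: tm and p :: "nat poly"
  assumes k: "2 \<le> k" and wf: "wf_tm M"
begin

definition T :: "bool list \<Rightarrow> nat" where "T x = poly p (length x)"

sublocale tab: tableau M x "T x" for x
  by standard (rule wf)

text \<open>The entries depend on the machine and not on the input, so an arbitrary enumeration of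
  them can be wired into the expressions.\<close>

definition opts :: "entry list" where "opts = (SOME es. set es = tableau.entries M)"

definition Q :: nat where "Q = length opts"

abbreviation \<tau> :: nat where "\<tau> \<equiv> tapes M"

definition W :: "bool list \<Rightarrow> nat" where "W x = 2 * T x + 1"

definition G :: "bool list \<Rightarrow> nat" where "G x = (T x + 1) * \<tau> * W x"

text \<open>The digits are found by bounded search, as the expression language has quantifiers but
  no division.\<close>

definition R :: "bool list \<Rightarrow> nat \<Rightarrow> nat \<Rightarrow> bool" where
  "R x i j \<longleftrightarrow> (\<exists>t<T x + 1. \<exists>r<\<tau>. \<exists>z<W x. \<exists>q<Q. \<exists>t'<T x + 1. \<exists>r'<\<tau>. \<exists>z'<W x. \<exists>q'<Q.
     i = ((t * \<tau> + r) * W x + z) * Q + q \<and> j = ((t' * \<tau> + r') * W x + z') * Q + q' \<and>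
     tab.bad x t r z (opts ! q) t' r' z' (opts ! q'))"

lemma set_opts: "set opts = tableau.entries M"
  unfolding opts_def using finite_list[OF tab.finite_entries] by (rule someI_ex)

lemma Q_pos: "0 < Q"
proof -
  have "Inl 0 \<in> set opts"
    using tab.blank_alphabet(1) by (simp add: set_opts tab.entries_def)
  then show ?thesis by (auto simp: Q_def)
qed

sublocale sel: selection k "G x" Q "R x" for x
  by standard (use k Q_pos in auto)

section \<open>Tableau positions as cells of a selection problem\<close>

lemma cell_less: "t < T x + 1 \<Longrightarrow> r < \<tau> \<Longrightarrow> z < W x \<Longrightarrow> (t * \<tau> + r) * W x + z < G x"
  unfolding G_def by (intro digits_less) auto

lemma cell_split:
  assumes "t * \<tau> + r < (T x + 1) * \<tau>" "r < \<tau>" "z < W x"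
  shows "((t * \<tau> + r) * W x + z) div W x div \<tau> = t" "((t * \<tau> + r) * W x + z) div W x mod \<tau> = r"
    "((t * \<tau> + r) * W x + z) mod W x = z"
  using assms by auto

lemma solvable_iff_consistent: "sel.solvable x \<longleftrightarrow> (\<exists>F. tab.consistent x F)"
proof
  assume "sel.solvable x"
  then obtain f where f: "\<And>g. g < G x \<Longrightarrow> f g < Q"
    "\<And>g g'. g < G x \<Longrightarrow> g' < G x \<Longrightarrow> \<not> R x (g * Q + f g) (g' * Q + f g')"
    unfolding sel.solvable_def by blast
  define F where "F t r z = opts ! f ((t * \<tau> + r) * W x + z)" for t r z
  have "F t r z \<in> tableau.entries M" if "t < T x + 1" "r < \<tau>" "z < W x" for t r z
    using f(1)[OF cell_less[OF that]] by (simp add: F_def Q_def set_opts[symmetric])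
  moreover have "\<not> tab.bad x t r z (F t r z) t' r' z' (F t' r' z')"
    if "t < T x + 1" "r < \<tau>" "z < W x" "t' < T x + 1" "r' < \<tau>" "z' < W x" for t r z t' r' z'
  proof
    assume b: "tab.bad x t r z (F t r z) t' r' z' (F t' r' z')"
    let ?c = "(t * \<tau> + r) * W x + z" let ?c' = "(t' * \<tau> + r') * W x + z'"
    have c: "?c < G x" "?c' < G x" using cell_less that by auto
    have "R x (?c * Q + f ?c) (?c' * Q + f ?c')"
      unfolding R_def using that b f(1)[OF c(1)] f(1)[OF c(2)] unfolding F_def by blast
    then show False using f(2)[OF c] by blast
  qed
  ultimately have "tab.consistent x F"
    unfolding tab.consistent_def by (auto simp: W_def less_Suc_eq_le)
  then show "\<exists>F. tab.consistent x F" by blast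
next
  assume "\<exists>F. tab.consistent x F"
  then obtain F where cons: "tab.consistent x F" by blast
  have F1: "F t r z \<in> set opts" if "t < T x + 1" "r < \<tau>" "z < W x" for t r z
    using cons that by (simp add: tab.consistent_def set_opts W_def)
  have F2: "\<not> tab.bad x t r z (F t r z) t' r' z' (F t' r' z')"
    if "t < T x + 1" "r < \<tau>" "z < W x" "t' < T x + 1" "r' < \<tau>" "z' < W x" for t r z t' r' z'
    using cons that by (simp add: tab.consistent_def W_def)
  define F' where "F' c = F (c div W x div \<tau>) (c div W x mod \<tau>) (c mod W x)" for c
  have F': "F' c \<in> set opts" if c: "c < G x" for c
  proof -
    have "c div W x div \<tau> < T x + 1"
      using c unfolding G_def by (intro div_less_of_less_mult) auto
    moreover have "c div W x mod \<tau> < \<tau>" "c mod W x < W x"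
      using tab.tapes by (auto simp: W_def)
    ultimately show ?thesis unfolding F'_def by (rule F1)
  qed
  then have "\<exists>q. q < Q \<and> opts ! q = F' c" if "c < G x" for c
    using that by (auto simp: in_set_conv_nth Q_def)
  then obtain f where f: "\<And>c. c < G x \<Longrightarrow> f c < Q" "\<And>c. c < G x \<Longrightarrow> opts ! f c = F' c"
    by metis
  have "\<not> R x (g * Q + f g) (g' * Q + f g')" if g: "g < G x" "g' < G x" for g g'
  proof
    assume "R x (g * Q + f g) (g' * Q + f g')"
    then obtain t r z q t' r' z' q' where b: "t < T x + 1" "r < \<tau>" "z < W x" "q < Q"
      "t' < T x + 1" "r' < \<tau>" "z' < W x" "q' < Q"
      and eq: "g * Q + f g = ((t * \<tau> + r) * W x + z) * Q + q" "g' * Q + f g' = ((t' * \<tau> + r') * W x + z') * Q + q'"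
      and bad: "tab.bad x t r z (opts ! q) t' r' z' (opts ! q')"
      unfolding R_def by blast
    have g1: "g = (t * \<tau> + r) * W x + z" "f g = q"
      using digits_inject[OF eq(1) f(1)[OF g(1)] b(4)] by auto
    have g2: "g' = (t' * \<tau> + r') * W x + z'" "f g' = q'"
      using digits_inject[OF eq(2) f(1)[OF g(2)] b(8)] by auto
    have "F' g = F t r z"
      unfolding F'_def g1(1) cell_split[OF digits_less[OF b(1,2)] b(2,3)] ..
    then have "opts ! q = F t r z"
      using f(2)[OF g(1)] g1(2) by simp
    moreover have "F' g' = F t' r' z'"
      unfolding F'_def g2(1) cell_split[OF digits_less[OF b(5,6)] b(6,7)] ..
    then have "opts ! q' = F t' r' z'"
      using f(2)[OF g(2)] g2(2) by simp
    ultimately show False using F2[of t r z t' r' z'] b bad by simp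
  qed
  then show "sel.solvable x"
    unfolding sel.solvable_def using f(1) by blast
qed

section \<open>Vertices as numbers, and the constructed instance\<close>

definition B :: nat where "B = 6 + 2 * k"

fun enc :: "bool list \<Rightarrow> vertex \<Rightarrow> nat" where
  "enc x (i, j, e) = (i * sel.m x + j) * B + e"

definition n :: "bool list \<Rightarrow> nat" where "n x = sel.m x * sel.m x * B"

definition l :: "bool list \<Rightarrow> nat" where "l x = 4 * sel.m x * sel.m x"

definition E :: "bool list \<Rightarrow> nat set set" where "E x = (`) (enc x) ` sel.E x"

lemma inj_enc: "inj_on (enc x) (sel.V x)"
proof (rule inj_onI)
  fix v w assume v: "v \<in> sel.V x" "w \<in> sel.V x" "enc x v = enc x w"
  obtain i j e i' j' e' where vw: "v = (i, j, e)" "w = (i', j', e')" by (cases v, cases w)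
  have b: "j < sel.m x" "e < B" "j' < sel.m x" "e' < B"
    using v by (auto simp: vw sel.V_def B_def)
  from v(3) show "v = w"
    using digits_inject[of "i * sel.m x + j" B e "i' * sel.m x + j'" e'] digits_inject[of i "sel.m x" j i' j'] b
    by (simp add: vw)
qed

lemma enc_image: "enc x ` sel.V x = {..<n x}"
proof (intro set_eqI iffI)
  fix a assume "a \<in> enc x ` sel.V x"
  then show "a \<in> {..<n x}"
    by (auto simp: sel.V_def n_def B_def intro!: digits_less)
next
  fix a assume "a \<in> {..<n x}"
  then have a: "a < sel.m x * sel.m x * B" by (simp add: n_def)
  then have pos: "0 < sel.m x" "0 < B" by (auto intro!: gr0I)
  let ?v = "(a div B div sel.m x, a div B mod sel.m x, a mod B)"
  have "a div B div sel.m x < sel.m x"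
    using a by (intro div_less_of_less_mult) auto
  then have "?v \<in> sel.V x"
    using pos by (auto simp: sel.V_def B_def)
  moreover have "enc x ?v = a" by (simp only: enc.simps div_mult_mod_eq)
  ultimately show "a \<in> enc x ` sel.V x" by (metis imageI)
qed

lemma simple_graph_E: "simple_graph {..<n x} (E x)"
  using simple_graph_image[OF sel.simple_graph_E inj_enc] by (simp add: enc_image E_def)

text \<open>An instance must have \<open>l \<ge> 1\<close>.\<close>

lemma m_pos: "0 < sel.m x"
proof -
  have "0 < G x" unfolding G_def W_def using tab.tapes by simp
  then show ?thesis unfolding sel.m_def using Q_pos by simp
qed

theorem instance_iff:
  "encode_instance (n x) (E x) (l x) \<in> LIMITED_DOMINATING_SET k \<longleftrightarrow> (\<exists>t\<le>T x. accepts_in M x t)"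
proof -
  have "encode_instance (n x) (E x) (l x) \<in> LIMITED_DOMINATING_SET k \<longleftrightarrow>
    (\<exists>D. limited_dominating_set k {..<n x} (E x) D \<and> card D \<le> l x)"
  proof
    assume "encode_instance (n x) (E x) (l x) \<in> LIMITED_DOMINATING_SET k"
    then obtain n' E' l' where e: "encode_instance (n x) (E x) (l x) = encode_instance n' E' l'"
      "simple_graph {..<n'} E'" "\<exists>D. limited_dominating_set k {..<n'} E' D \<and> card D \<le> l'"
      unfolding LIMITED_DOMINATING_SET_def by blast
    \<comment> \<open>The language speaks of some instance with this code; unique decoding makes it
      the constructed one.\<close>
    then show "\<exists>D. limited_dominating_set k {..<n x} (E x) D \<and> card D \<le> l x"
      using encode_instance_inject[OF simple_graph_E e(2,1)] by simp
  next
    assume "\<exists>D. limited_dominating_set k {..<n x} (E x) D \<and> card D \<le> l x"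
    moreover have "l x \<ge> 1" using m_pos[of x] by (simp add: l_def)
    ultimately show "encode_instance (n x) (E x) (l x) \<in> LIMITED_DOMINATING_SET k"
      unfolding LIMITED_DOMINATING_SET_def using simple_graph_E by blast
  qed
  also have "\<dots> \<longleftrightarrow> sel.solvable x"
    using limited_dominating_set_image_iff[OF sel.simple_graph_E inj_enc, of k x "l x"]
    by (simp add: enc_image E_def l_def sel.solvable_iff)
  also have "\<dots> \<longleftrightarrow> (\<exists>t\<le>T x. accepts_in M x t)"
    by (simp add: solvable_iff_consistent tab.consistent_iff)
  finally show ?thesis .
qed

text \<open>
  Variables: 0 is the input length; 1 and 2 are the vertices whose adjacency is decided; 3 to 8 are
  their decodings \<open>(i, j, e)\<close> and \<open>(i', j', e')\<close>; 10 to 17 are the components of two tableau options.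
\<close>

definition TE :: exp where "TE = Poly p (Var 0)"
definition WE :: exp where "WE = Add (Mul (Const 2) TE) (Const 1)"
definition GE :: exp where "GE = Mul (Mul (Add TE (Const 1)) (Const \<tau>)) WE"
definition mE :: exp where "mE = Mul GE (Const Q)"

lemma eval_consts [simp]:
  assumes "\<sigma> 0 = length x"
  shows "eval x g TE \<sigma> = T x" "eval x g WE \<sigma> = W x" "eval x g GE \<sigma> = G x" "eval x g mE \<sigma> = sel.m x"
proof -
  show T: "eval x g TE \<sigma> = T x" using assms by (simp add: TE_def T_def)
  then show W: "eval x g WE \<sigma> = W x" by (simp add: WE_def W_def)
  with T show G: "eval x g GE \<sigma> = G x" by (simp add: GE_def G_def)
  then show "eval x g mE \<sigma> = sel.m x" unfolding sel.m_def by (simp add: mE_def)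
qed

text \<open>A lookup table: a predicate on two options and a tape number has a fixed finite domain,
  so its values appear as constants.\<close>

definition Table :: "(nat \<Rightarrow> entry \<Rightarrow> entry \<Rightarrow> bool) \<Rightarrow> exp" where
  "Table P = Any (concat (map (\<lambda>r. concat (map (\<lambda>q. map (\<lambda>q'.
     Conj (Const (of_bool (P r (opts ! q) (opts ! q'))))
       (Conj (Eq (Var 11) (Const r)) (Conj (Eq (Var 13) (Const q)) (Eq (Var 17) (Const q')))))
     [0..<Q]) [0..<Q])) [0..<\<tau>]))"

lemma eval_Table:
  assumes "\<sigma> 11 < \<tau>" "\<sigma> 13 < Q" "\<sigma> 17 < Q"
  shows "eval x g (Table P) \<sigma> = 0 \<longleftrightarrow> \<not> P (\<sigma> 11) (opts ! \<sigma> 13) (opts ! \<sigma> 17)"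
  using assms by (auto simp: Table_def)

text \<open>The guard \<open>T \<le> z\<close> is essential: left of cell 0 the truncated difference
  would read the first input symbol instead of a blank.\<close>

definition initialE :: exp where
  "initialE = Mul (Truth (Conj (Eq (Var 11) (Const 0)) (Leq TE (Var 12)))) (Sym False (Sub (Var 12) TE))"

text \<open>A table cannot refer to computed numbers. Hence comparisons with the initial symbol and
  with the head movement are split over the possible values 0, 1, 2, and inequivalences over their
  two directions.\<close>

definition badE :: exp where
  "badE = Any [
     Conj (Eq (Var 10) (Const 0)) (Neg (Any (map (\<lambda>s. Conj (Eq initialE (Const s)) (Table (\<lambda>r X X'. symbol r X = s))) [0, 1, 2]))),
     Conj (Eq (Var 10) (Const 0)) (Conj (Table (\<lambda>r X X'. at_head X)) (Neg (Eq (Var 12) TE))),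
     Conj (Eq (Var 10) (Const 0)) (Conj (Table (\<lambda>r X X'. \<not> at_head X)) (Eq (Var 12) TE)),
     Conj (Eq (Var 10) (Const 0)) (Table (\<lambda>r X X'. at_head X \<and> source X \<noteq> start M)),
     Conj (Eq (Var 10) TE) (Table (\<lambda>r X X'. at_head X \<and> source X \<noteq> accept M)),
     Conj (Eq (Var 14) (Var 10)) (Table (\<lambda>r X X'. at_head X \<and> at_head X' \<and> X \<noteq> X')),
     Conj (Eq (Var 14) (Add (Var 10) (Const 1))) (Table (\<lambda>r X X'. at_head X \<and> at_head X' \<and> target X \<noteq> source X')),
     Conj (Eq (Var 14) (Add (Var 10) (Const 1))) (Conj (Eq (Var 15) (Var 11)) (Conj (Eq (Var 16) (Var 12))
       (Table (\<lambda>r X X'. new_symbol r X \<noteq> symbol r X')))),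
     Conj (Eq (Var 14) (Add (Var 10) (Const 1))) (Conj (Eq (Var 15) (Var 11)) (Any (map (\<lambda>c. 
       Disj (Conj (Table (\<lambda>r X X'. at_head X \<and> next_pos r X = c \<and> at_head X')) (Neg (Eq (Add (Var 16) (Const 1)) (Add (Var 12) (Const c)))))
         (Conj (Table (\<lambda>r X X'. at_head X \<and> next_pos r X = c \<and> \<not> at_head X')) (Eq (Add (Var 16) (Const 1)) (Add (Var 12) (Const c)))))
       [0, 1, 2])))]"

lemma eval_initialE:
  assumes "\<sigma> 0 = length x"
  shows "eval x g initialE \<sigma> = string_contents (if \<sigma> 11 = 0 then x else []) (int (\<sigma> 12) - int (T x))"
proof -
  have neg: "string_contents w (int a - int b) = 0" if "\<not> b \<le> a" for w a b
    using that by (simp add: string_contents_def)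
  have pos: "int (a - b) = int a - int b" if "b \<le> a" for a b
    using that by (rule of_nat_diff)
  have "eval x g initialE \<sigma> = of_bool (\<sigma> 11 = 0 \<and> T x \<le> \<sigma> 12) * string_contents x (int (\<sigma> 12 - T x))"
    by (simp add: initialE_def assms)
  then show ?thesis
    by (cases "T x \<le> \<sigma> 12") (simp_all add: neg pos string_contents_Nil del: of_nat_diff)
qed

lemma offset_le: "offset d \<le> 2"
  by (cases d) auto

lemma next_pos_le: "next_pos r X \<le> 2"
proof (cases X)
  case (Inr \<delta>)
  then show ?thesis by (cases \<delta>) (simp add: offset_le)
qed simp

lemma le_2_cases: "v \<le> (2 :: nat) \<Longrightarrow> v = 0 \<or> v = 1 \<or> v = 2"
  by linarith

lemma eval_badE:
  assumes "\<sigma> 0 = length x" "\<sigma> 11 < \<tau>" "\<sigma> 13 < Q" "\<sigma> 17 < Q"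
  shows "eval x g badE \<sigma> = 0 \<longleftrightarrow>
    \<not> tab.bad x (\<sigma> 10) (\<sigma> 11) (\<sigma> 12) (opts ! \<sigma> 13) (\<sigma> 14) (\<sigma> 15) (\<sigma> 16) (opts ! \<sigma> 17)"
proof -
  let ?X = "opts ! \<sigma> 13" let ?X' = "opts ! \<sigma> 17" let ?v = "eval x g initialE \<sigma>"
  let ?c = "next_pos (\<sigma> 11) ?X"
  have v: "string_contents (if \<sigma> 11 = 0 then x else []) (int (\<sigma> 12) - int (T x)) = ?v"
    by (rule eval_initialE[where \<sigma> = \<sigma> and x = x, OF assms(1), symmetric])
  then have "?v \<le> 2"
    using string_contents_le2 by metis
  from le_2_cases[OF this] le_2_cases[OF next_pos_le[of "\<sigma> 11" ?X]] show ?thesis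
    unfolding badE_def eval_Any tab.bad_def v using assms
    by (elim disjE; cases "at_head ?X"; cases "at_head ?X'"; simp add: eval_Table)
qed

definition cellE :: "nat \<Rightarrow> nat \<Rightarrow> nat \<Rightarrow> nat \<Rightarrow> exp" where
  "cellE t r z q = Add (Mul (Add (Mul (Add (Mul (Var t) (Const \<tau>)) (Var r)) WE) (Var z)) (Const Q)) (Var q)"

definition RE :: "nat \<Rightarrow> nat \<Rightarrow> exp" where
  "RE i j = Exists 10 (Add TE (Const 1)) (Exists 11 (Const \<tau>) (Exists 12 WE (Exists 13 (Const Q)
     (Exists 14 (Add TE (Const 1)) (Exists 15 (Const \<tau>) (Exists 16 WE (Exists 17 (Const Q)
       (Conj (Eq (Var i) (cellE 10 11 12 13)) (Conj (Eq (Var j) (cellE 14 15 16 17)) badE)))))))))"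

lemma eval_RE:
  assumes "\<sigma> 0 = length x" "i < 10" "j < 10"
  shows "eval x g (RE i j) \<sigma> = 0 \<longleftrightarrow> \<not> R x (\<sigma> i) (\<sigma> j)"
  unfolding RE_def R_def using assms
  by (simp add: eval_badE cellE_def) blast

definition arcE :: exp where
  "arcE = Any [
     Conj (Eq (Var 6) (Var 3)) (Conj (Eq (Var 7) (Var 4)) (Any [
       Conj (Eq (Var 5) (Const (5 + 2 * k))) (Leq (Var 8) (Const 1)),
       Conj (Eq (Var 5) (Const 2)) (Conj (Eq (Var 8) (Const 3)) (Disj (Leq GE (Var 3)) (Less (Const 0) (Var 4)))),
       Conj (Eq (Var 5) (Const 4)) (Conj (Leq (Const 5) (Var 8)) (Less (Var 8) (Const (5 + k)))),
       Conj (Eq (Var 5) (Const 5)) (Conj (Leq (Const (5 + k)) (Var 8)) (Less (Var 8) (Const (5 + 2 * k))))])),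
     Conj (Eq (Var 5) (Const 1)) (Conj (Eq (Var 8) (Const 2)) (Conj (Eq (Var 4) (Const 0)) (Conj (Eq (Var 7) (Const 0))
       (Conj (Leq (Mul (Var 6) (Const Q)) (Var 3)) (Conj (Less (Var 3) (Add (Mul (Var 6) (Const Q)) (Const Q))) (Neg (RE 3 3))))))),
     Conj (Eq (Var 5) (Const 4)) (Conj (Leq (Var 8) (Const 1)) (Conj (Eq (Var 7) (Const 0)) (Conj (Eq (Var 3) (Var 4)) (Eq (Var 6) (Var 3))))),
     Conj (Eq (Var 5) (Const 4)) (Conj (Eq (Var 8) (Const 0)) (Conj (Eq (Var 7) (Const 0)) (Conj (Neg (Eq (Var 3) (Var 4)))
       (Conj (RE 3 4) (Disj (Eq (Var 6) (Var 3)) (Eq (Var 6) (Var 4)))))))]"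

lemma eval_arcE:
  assumes "\<sigma> 0 = length x"
  shows "eval x g arcE \<sigma> = 0 \<longleftrightarrow> \<not> sel.arc x (\<sigma> 3, \<sigma> 4, \<sigma> 5) (\<sigma> 6, \<sigma> 7, \<sigma> 8)"
  unfolding arcE_def using assms by (simp add: eval_RE) 

definition encE :: "nat \<Rightarrow> nat \<Rightarrow> nat \<Rightarrow> exp" where
  "encE i j e = Add (Mul (Add (Mul (Var i) mE) (Var j)) (Const B)) (Var e)"

text \<open>Two vertex numbers are decoded by trying all pairs of digit triples, of which there are
  polynomially many.\<close>

definition adjE :: exp where
  "adjE = Exists 3 mE (Exists 4 mE (Exists 5 (Const B) (Exists 6 mE (Exists 7 mE (Exists 8 (Const B)
     (Conj arcE (Disj (Conj (Eq (encE 3 4 5) (Var 1)) (Eq (encE 6 7 8) (Var 2)))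
                   (Conj (Eq (encE 3 4 5) (Var 2)) (Eq (encE 6 7 8) (Var 1))))))))))"

lemma E_iff: "{a, b} \<in> E x \<longleftrightarrow>
  (\<exists>v\<in>sel.V x. \<exists>w\<in>sel.V x. sel.arc x v w \<and> ((enc x v = a \<and> enc x w = b) \<or> (enc x v = b \<and> enc x w = a)))"
proof
  assume "{a, b} \<in> E x"
  then obtain v w where "v \<in> sel.V x" "w \<in> sel.V x" "sel.arc x v w" "{a, b} = {enc x v, enc x w}"
    unfolding E_def sel.E_def by auto
  then show "\<exists>v\<in>sel.V x. \<exists>w\<in>sel.V x. sel.arc x v w \<and> ((enc x v = a \<and> enc x w = b) \<or> (enc x v = b \<and> enc x w = a))"
    unfolding doubleton_eq_iff by blast
next
  assume "\<exists>v\<in>sel.V x. \<exists>w\<in>sel.V x. sel.arc x v w \<and> ((enc x v = a \<and> enc x w = b) \<or> (enc x v = b \<and> enc x w = a))"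
  then obtain v w where vw: "v \<in> sel.V x" "w \<in> sel.V x" "sel.arc x v w" "{a, b} = {enc x v, enc x w}"
    by blast
  then have "{v, w} \<in> sel.E x" unfolding sel.E_def by blast
  then show "{a, b} \<in> E x"
    unfolding E_def vw(4) by (intro image_eqI[of _ _ "{v, w}"]) auto
qed

lemma eval_adjE:
  assumes "\<sigma> 0 = length x"
  shows "holds x g adjE \<sigma> \<longleftrightarrow> {\<sigma> 1, \<sigma> 2} \<in> E x"
proof -
  have "holds x g adjE \<sigma> \<longleftrightarrow> (\<exists>i<sel.m x. \<exists>j<sel.m x. \<exists>e<B. \<exists>i'<sel.m x. \<exists>j'<sel.m x. \<exists>e'<B.
    sel.arc x (i, j, e) (i', j', e') \<and> ((enc x (i, j, e) = \<sigma> 1 \<and> enc x (i', j', e') = \<sigma> 2) \<or>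
     (enc x (i, j, e) = \<sigma> 2 \<and> enc x (i', j', e') = \<sigma> 1)))"
    unfolding adjE_def using assms by (simp add: eval_arcE encE_def del: sel.arc.simps)
  also have "\<dots> \<longleftrightarrow> {\<sigma> 1, \<sigma> 2} \<in> E x"
    unfolding E_iff sel.V_def B_def[symmetric] by (simp add: Bex_def del: sel.arc.simps enc.simps)
  finally show ?thesis .
qed

definition nE :: exp where "nE = Mul (Mul mE mE) (Const B)"
definition lE :: exp where "lE = Mul (Mul (Const 4) mE) mE"

definition instance_out :: out where
  "instance_out = OSeq (OFor 1 nE (Emit (Const 1))) (OSeq (Emit (Const 0))
     (OSeq (OFor 1 nE (OFor 2 (Var 1) (Emit adjE))) (Emit_binary lE)))"

lemma emitted_instance_out:
  "emitted x [] instance_out (\<lambda>_. length x) = encode_instance (n x) (E x) (l x)"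
proof -
  have n: "eval x [] nE (\<lambda>_. length x) = n x" by (simp add: nE_def n_def)
  have l: "eval x [] lE \<sigma> = l x" if "\<sigma> 0 = length x" for \<sigma>
    using that by (simp add: lE_def l_def)
  have adj: "eval x [] adjE ((\<lambda>_. length x)(1 := i, 2 := j)) \<noteq> 0 \<longleftrightarrow> {i, j} \<in> E x" for i j
    by (subst eval_adjE) auto
  have "emitted x [] (OFor 1 nE (Emit (Const 1))) (\<lambda>_. length x) = replicate (n x) True"
    by (simp add: n concat_map_singleton map_replicate_const)
  moreover have "emitted x [] (OFor 1 nE (OFor 2 (Var 1) (Emit adjE))) (\<lambda>_. length x) =
    concat (map (\<lambda>i. map (\<lambda>j. {i, j} \<in> E x) [0..<i]) [0..<n x])"
    using adj by (simp add: n concat_map_singleton)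
  moreover have "emitted x [] (Emit_binary lE) (\<lambda>_. length x) = binary (l x)"
    by (rule emitted_Emit_binary) (simp add: l)
  ultimately show ?thesis
    by (simp add: instance_out_def encode_instance_def)
qed

end

theorem NP_hard_LIMITED_DOMINATING_SET:
  assumes "2 \<le> k"
  shows "NP_hard (LIMITED_DOMINATING_SET k)"
  unfolding NP_hard_def
proof
  fix A assume "A \<in> NP"
  then obtain M and p :: "nat poly" where M: "wf_tm M" "\<And>x. x \<in> A \<longleftrightarrow> (\<exists>t. accepts_in M x t)"
    "\<And>x. x \<in> A \<Longrightarrow> \<exists>t\<le>poly p (length x). accepts_in M x t"
    unfolding NP_def by blast
  interpret reduction k M p
    using assms M(1) by unfold_locales
  have "x \<in> A \<longleftrightarrow> encode_instance (n x) (E x) (l x) \<in> LIMITED_DOMINATING_SET k" for x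
    unfolding instance_iff T_def using M(2,3) by blast
  moreover have "poly_time_computable (\<lambda>x. encode_instance (n x) (E x) (l x))"
    using poly_time_computable_emitted[of instance_out] by (simp add: emitted_instance_out)
  ultimately show "poly_reducible A (LIMITED_DOMINATING_SET k)"
    unfolding poly_reducible_def by blast
qed

section \<open>Membership in NP\<close>

definition tri :: "nat \<Rightarrow> nat" where "tri n = (\<Sum>i<n. i)"

lemma tri_Suc [simp]: "tri (Suc n) = tri n + n"
  by (simp add: tri_def)

lemma tri_0 [simp]: "tri 0 = 0"
  by (simp add: tri_def)

definition rows :: "nat \<Rightarrow> nat set set \<Rightarrow> bool list" where
  "rows n E = concat (map (\<lambda>i. map (\<lambda>j. {i, j} \<in> E) [0..<i]) [0..<n])"

lemma rows_Suc: "rows (Suc n) E = rows n E @ map (\<lambda>j. {n, j} \<in> E) [0..<n]"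
  by (simp add: rows_def)

lemma length_rows: "length (rows n E) = tri n"
  by (induction n) (simp_all add: rows_Suc, simp add: rows_def)

lemma nth_rows: "i < n \<Longrightarrow> j < i \<Longrightarrow> rows n E ! (tri i + j) \<longleftrightarrow> {i, j} \<in> E"
proof (induction n)
  case (Suc n)
  show ?case
  proof (cases "i = n")
    case True
    then show ?thesis using Suc.prems by (simp add: rows_Suc nth_append length_rows)
  next
    case False
    then have "i < n" using Suc.prems by simp
    then have "tri (Suc i) \<le> tri n"
      unfolding tri_def by (intro sum_mono2) auto
    then have "tri i + j < tri n" using Suc.prems by simp
    then show ?thesis using Suc \<open>i < n\<close> by (simp add: rows_Suc nth_append length_rows)
  qed
qed simp

lemma tri_decompose: "q < tri n \<Longrightarrow> \<exists>i<n. \<exists>j<i. q = tri i + j"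
proof (induction n)
  case (Suc n)
  show ?case
  proof (cases "q < tri n")
    case True
    then show ?thesis using Suc.IH less_SucI by blast
  next
    case False
    then show ?thesis
      using Suc.prems by (intro exI[of _ n] conjI exI[of _ "q - tri n"]) auto
  qed
qed simp

lemma tri_less: "i < n \<Longrightarrow> j < i \<Longrightarrow> tri i + j < tri n"
proof -
  assume a: "i < n" "j < i"
  then have "tri (Suc i) \<le> tri n" unfolding tri_def by (intro sum_mono2) auto
  with a show ?thesis by simp
qed

section \<open>Values of bit strings, and the decoding of instances\<close>

definition bits_value :: "bool list \<Rightarrow> nat" where
  "bits_value bs = (\<Sum>i<length bs. of_bool (bs ! i) * 2 ^ i)"

lemma bits_value_Cons: "bits_value (b # bs) = of_bool b + 2 * bits_value bs"
  by (simp add: bits_value_def sum.lessThan_Suc_shift sum_distrib_left algebra_simps del: sum.lessThan_Suc sum_of_bool_mult_eq)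

lemma bits_value_binary: "bits_value (binary l) = l"
proof (induction l rule: less_induct)
  case (less l)
  show ?case
  proof (cases "l = 0")
    case False
    then have "bits_value (binary l) = of_bool (odd l) + 2 * (l div 2)"
      using less[of "l div 2"] by (simp add: binary.simps[of l] bits_value_Cons)
    then show ?thesis by (cases "odd l") (auto elim: oddE)
  qed (simp add: binary.simps bits_value_def)
qed

lemma binary_bits_value: "bs \<noteq> [] \<Longrightarrow> last bs \<Longrightarrow> 0 < bits_value bs \<and> binary (bits_value bs) = bs"
proof (induction bs)
  case (Cons b bs)
  show ?case
  proof (cases "bs = []")
    case True
    then show ?thesis using Cons.prems
      by (simp add: bits_value_Cons) (simp add: bits_value_def binary.simps)
  next
    case False
    then have IH: "0 < bits_value bs" "binary (bits_value bs) = bs"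
      using Cons by simp_all
    let ?v = "bits_value (b # bs)"
    have "0 < ?v" using IH(1) by (simp add: bits_value_Cons)
    moreover have "odd ?v = b" "?v div 2 = bits_value bs"
      by (cases b; simp add: bits_value_Cons)+
    ultimately show ?thesis using IH(2) binary.simps[of ?v] by simp
  qed
qed simp

lemma last_binary: "0 < l \<Longrightarrow> binary l \<noteq> [] \<and> last (binary l)"
proof (induction l rule: less_induct)
  case (less l)
  show ?case
  proof (cases "l = 1")
    case False
    then have "0 < l div 2" using less.prems by auto
    then show ?thesis
      using less.IH[of "l div 2"] less.prems by (simp add: binary.simps[of l])
  qed (simp add: binary.simps)
qed

text \<open>The strict inequality and the final bit make the number part nonempty with a leading 1,
  that is, the canonical code of a positive number.\<close>

definition decodes :: "bool list \<Rightarrow> nat \<Rightarrow> nat set set \<Rightarrow> nat \<Rightarrow> bool" where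
  "decodes x n E l \<longleftrightarrow> n + 1 + tri n < length x \<and> (\<forall>i<n. x ! i) \<and> \<not> x ! n \<and>
     (\<forall>i<n. \<forall>j<i. x ! (n + 1 + (tri i + j)) \<longleftrightarrow> {i, j} \<in> E) \<and> x ! (length x - 1) \<and>
     l = bits_value (drop (n + 1 + tri n) x)"

lemma encode_instance_rows: "encode_instance n E l = replicate n True @ False # rows n E @ binary l"
  by (simp add: encode_instance_def rows_def)

lemma decodes_encode_instance:
  assumes "0 < l"
  shows "decodes (encode_instance n E l) n E l"
proof -
  let ?x = "encode_instance n E l"
  note b = last_binary[OF assms]
  have len: "length ?x = n + 1 + tri n + length (binary l)"
    by (simp add: encode_instance_rows length_rows)
  have "?x ! (n + 1 + (tri i + j)) \<longleftrightarrow> {i, j} \<in> E" if "i < n" "j < i" for i j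
  proof -
    have "?x ! (n + 1 + (tri i + j)) = (rows n E @ binary l) ! (tri i + j)"
      by (simp add: encode_instance_rows nth_append)
    also have "\<dots> = rows n E ! (tri i + j)"
      using tri_less[OF that] by (simp add: nth_append length_rows)
    finally show ?thesis using nth_rows[OF that] by simp
  qed
  moreover have "?x ! (length ?x - 1) = last ?x"
    using b by (simp add: last_conv_nth encode_instance_rows)
  then have "?x ! (length ?x - 1)"
    using b by (simp add: encode_instance_rows)
  moreover have "drop (n + 1 + tri n) ?x = binary l"
    by (simp add: encode_instance_rows length_rows)
  ultimately show ?thesis
    using b len by (simp add: decodes_def bits_value_binary) (simp add: encode_instance_rows nth_append)
qed

lemma encode_instance_decodes:
  assumes "decodes x n E l"
  shows "0 < l \<and> encode_instance n E l = x"
proof -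
  let ?s = "n + 1 + tri n"
  have d: "?s < length x" "\<And>i. i < n \<Longrightarrow> x ! i" "\<not> x ! n" "x ! (length x - 1)"
    "\<And>i j. i < n \<Longrightarrow> j < i \<Longrightarrow> x ! (n + 1 + (tri i + j)) \<longleftrightarrow> {i, j} \<in> E" "l = bits_value (drop ?s x)"
    using assms unfolding decodes_def by blast+
  have "drop ?s x \<noteq> []" using d(1) by simp
  moreover have "last (drop ?s x)" using d(1,4) last_conv_nth[of x] by (cases "x = []") simp_all
  ultimately have l: "0 < l" "binary l = drop ?s x"
    using binary_bits_value d(6) by simp_all
  have "encode_instance n E l = x"
  proof (rule nth_equalityI)
    show len: "length (encode_instance n E l) = length x"
      using d(1) by (simp add: encode_instance_rows length_rows l(2))
    fix i assume "i < length (encode_instance n E l)"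
    then have i: "i < length x" using len by simp
    consider "i < n" | "i = n" | q where "i = n + 1 + q" "q < tri n" | "?s \<le> i"
      by (metis add.commute add_less_cancel_left le_Suc_ex linorder_neqE_nat not_le Suc_eq_plus1 Suc_leI)
    then show "encode_instance n E l ! i = x ! i"
    proof cases
      case 1
      then show ?thesis using d(2) by (simp add: encode_instance_rows nth_append)
    next
      case 2
      then show ?thesis using d(3) by (simp add: encode_instance_rows nth_append)
    next
      case (3 q)
      then obtain a b where ab: "a < n" "b < a" "q = tri a + b" using tri_decompose by blast
      have "encode_instance n E l ! i = rows n E ! q"
        using 3 by (simp add: encode_instance_rows nth_append length_rows)
      then show ?thesis using nth_rows[OF ab(1,2)] d(5)[OF ab(1,2)] 3 ab(3) by simp
    next
      case 4
      then obtain q where "i = ?s + q" using le_Suc_ex by blast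
      then show ?thesis using i by (simp add: encode_instance_rows nth_append length_rows l(2))
    qed
  qed
  with l show ?thesis by blast
qed

definition edges :: "bool list \<Rightarrow> nat \<Rightarrow> nat set set" where
  "edges x n = {{i, j} | i j. i < n \<and> j < i \<and> x ! (n + 1 + (tri i + j))}"

lemma simple_graph_edges: "simple_graph {..<n} (edges x n)"
  by (auto simp: simple_graph_def edges_def)

lemma edges_iff: "i < n \<Longrightarrow> j < i \<Longrightarrow> {i, j} \<in> edges x n \<longleftrightarrow> x ! (n + 1 + (tri i + j))"
  by (auto simp: edges_def doubleton_eq_iff)

text \<open>A logarithm rounded up, obtained by counting the powers of two below \<open>n\<close>;
  at \<open>2 ^ i\<close> it gives \<open>i\<close>.\<close>

definition powers :: "nat \<Rightarrow> nat" where
  "powers n = (\<Sum>q<n. of_bool (\<exists>i. q = 2 ^ i))"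

lemma powers: "{q. q < n \<and> (\<exists>i. q = 2 ^ i)} = (\<lambda>i. 2 ^ i) ` {..<powers n} \<and> n \<le> 2 ^ powers n"
proof (induction n)
  case (Suc n)
  let ?S = "\<lambda>n. {q. q < n \<and> (\<exists>i. q = 2 ^ i)}"
  show ?case
  proof (cases "\<exists>i. n = 2 ^ i")
    case True
    then obtain i where i: "n = 2 ^ i" by blast
    have "i \<le> powers n" using Suc i by simp
    moreover have "\<not> i < powers n"
    proof
      assume "i < powers n"
      then have "n \<in> ?S n" using Suc i by auto
      then show False by simp
    qed
    ultimately have n: "n = 2 ^ powers n" using i by simp
    have "powers (Suc n) = Suc (powers n)" using True by (simp add: powers_def)
    moreover have "?S (Suc n) = insert n (?S n)" using True by (auto simp: less_Suc_eq)
    moreover have "Suc n \<le> 2 ^ Suc (powers n)"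
      using n by (metis Suc_leI lessI power_strict_increasing_iff one_less_numeral_iff semiring_norm(76))
    ultimately show ?thesis using Suc n by (simp add: lessThan_Suc)
  next
    case False
    then have "powers (Suc n) = powers n" by (simp add: powers_def)
    moreover have "?S (Suc n) = ?S n" using False by (auto simp: less_Suc_eq)
    moreover have "n \<noteq> 2 ^ powers n" using False by blast
    ultimately show ?thesis using Suc by simp
  qed
qed (simp add: powers_def)

lemma powers_power: "powers (2 ^ i) = i"
proof -
  have "(\<lambda>j. 2 ^ j) ` {..<powers (2 ^ i)} = {q. q < 2 ^ i \<and> (\<exists>j. q = (2 :: nat) ^ j)}"
    using powers by blast
  also have "\<dots> = (\<lambda>j. 2 ^ j) ` {..<i}" by auto
  finally have "{..<powers (2 ^ i)} = {..<i}"
    by (subst (asm) inj_image_eq_iff) (auto simp: inj_def)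
  then show ?thesis by simp
qed

text \<open>The sum runs over weights rather than bit positions: then a position is the logarithm of
  its weight, and no power has to be computed.\<close>

definition low_value :: "bool list \<Rightarrow> nat \<Rightarrow> nat \<Rightarrow> nat" where
  "low_value x s n = (\<Sum>q<n + 1. of_bool ((\<exists>i. q = 2 ^ i) \<and> s + powers q < length x \<and> x ! (s + powers q)) * q)"

text \<open>Computes the bits of weight at most \<open>n\<close> only, since the whole value may be exponentially large.\<close>

lemma le_bits_value_iff:
  assumes "c \<le> n" "s \<le> length x"
  shows "c \<le> bits_value (drop s x) \<longleftrightarrow> c \<le> low_value x s n \<or>
    (\<exists>i<length x - s. x ! (s + i) \<and> powers (n + 1) \<le> i)"
proof -
  let ?K = "powers (n + 1)" let ?L = "length x - s"
  let ?b = "\<lambda>i. s + i < length x \<and> x ! (s + i)"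
  let ?P = "{q. q < n + 1 \<and> (\<exists>i. q = 2 ^ i)}"
  have P: "?P = (\<lambda>i. 2 ^ i) ` {..<?K}" "n + 1 \<le> 2 ^ ?K"
    using powers[of "n + 1"] by blast+
  have "low_value x s n = (\<Sum>q\<in>?P. of_bool (?b (powers q)) * q)"
    unfolding low_value_def by (rule sum.mono_neutral_cong_right) auto
  also have "\<dots> = (\<Sum>i<?K. of_bool (?b i) * 2 ^ i)"
    unfolding P(1) by (subst sum.reindex) (auto simp: inj_on_def powers_power)
  finally have low: "low_value x s n = (\<Sum>i<?K. of_bool (?b i) * 2 ^ i)" .
  have val: "bits_value (drop s x) = (\<Sum>i<?L. of_bool (?b i) * 2 ^ i)"
    unfolding bits_value_def using assms(2) by (intro sum.cong) (auto simp: less_diff_conv add.commute)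
  have both: "(\<Sum>i<M. of_bool (?b i) * 2 ^ i) = (\<Sum>i\<in>{i. i < M \<and> ?b i}. (2::nat) ^ i)" for M
    by (rule sum.mono_neutral_cong_right) auto
  have low_le: "low_value x s n \<le> bits_value (drop s x)"
    unfolding low val both using assms(2) by (intro sum_mono2) auto
  show ?thesis
  proof (cases "\<exists>i<?L. x ! (s + i) \<and> ?K \<le> i")
    case True
    then obtain i where i: "i < ?L" "x ! (s + i)" "?K \<le> i" by blast
    \<comment> \<open>A single bit at position \<open>?K\<close> or above already outweighs
      \<open>n\<close>, and hence \<open>c\<close>.\<close>
    have "c < 2 ^ ?K" using P(2) assms(1) by linarith
    also have "\<dots> \<le> 2 ^ i" using i(3) by simp
    also have "\<dots> \<le> bits_value (drop s x)"
      unfolding val both using i by (intro member_le_sum) auto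
    finally show ?thesis using True by auto
  next
    case False
    have "bits_value (drop s x) \<le> low_value x s n"
      unfolding low val both using False assms(2) by (intro sum_mono2) (auto simp: not_le less_diff_conv add.commute)
    with low_le False show ?thesis by auto
  qed
qed

text \<open>
  Variables: 0 is the input length and 1 the number of vertices. The edge bits are read off the
  input, and vertex \<open>v\<close> is in the set if the \<open>v\<close>-th guessed bit is set.
\<close>

definition BitE :: "bool \<Rightarrow> exp \<Rightarrow> exp" where "BitE guess a = Eq (Sym guess a) (Const 2)"
definition triE :: "nat \<Rightarrow> exp" where "triE i = Sum 20 (Var i) (Var 20)"
definition restE :: exp where "restE = Add (Add (Var 1) (Const 1)) (triE 1)"
definition edgeE :: "nat \<Rightarrow> nat \<Rightarrow> exp" where
  "edgeE i j = Conj (Less (Var j) (Var i)) (BitE False (Add (Add (Var 1) (Const 1)) (Add (triE i) (Var j))))"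
definition adjacentE :: "nat \<Rightarrow> nat \<Rightarrow> exp" where "adjacentE i j = Disj (edgeE i j) (edgeE j i)"
definition powersE :: "exp \<Rightarrow> exp" where "powersE a = Sum 21 a (Truth (Pow2 (Var 21)))"
definition lowE :: exp where
  "lowE = Sum 5 (Add (Var 1) (Const 1))
     (Mul (Truth (Conj (Pow2 (Var 5)) (BitE False (Add restE (powersE (Var 5)))))) (Var 5))"
definition highE :: exp where
  "highE = Exists 6 (Sub (Var 0) restE) (Conj (BitE False (Add restE (Var 6))) (Leq (powersE (Add (Var 1) (Const 1))) (Var 6)))"
definition sizeE :: exp where "sizeE = Sum 3 (Var 1) (Truth (BitE True (Var 3)))"

definition verifyE :: "nat \<Rightarrow> exp" where
  "verifyE k = Exists 1 (Var 0) (Conj (Less restE (Var 0)) (Conj (Forall 2 (Var 1) (BitE False (Var 2)))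
     (Conj (Neg (BitE False (Var 1))) (Conj (BitE False (Sub (Var 0) (Const 1)))
       (Conj (Disj (Leq sizeE lowE) highE)
         (Conj (Forall 3 (Var 1) (Disj (BitE True (Var 3)) (Exists 4 (Var 1) (Conj (BitE True (Var 4)) (adjacentE 3 4)))))
              (Forall 3 (Var 1) (Disj (Neg (BitE True (Var 3)))
                 (Leq (Sum 4 (Var 1) (Truth (Conj (adjacentE 3 4) (Neg (BitE True (Var 4)))))) (Const k))))))))))"

text \<open>Positions beyond the end hold a blank and count as unset, so guesses of every length are
  meaningful.\<close>

definition bit_set :: "bool list \<Rightarrow> nat \<Rightarrow> bool" where "bit_set w i \<longleftrightarrow> i < length w \<and> w ! i"

lemma eval_BitE [simp]: "eval x g (BitE guess a) \<sigma> = 0 \<longleftrightarrow> \<not> bit_set (if guess then g else x) (eval x g a \<sigma>)"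
  by (auto simp: BitE_def bit_set_def string_contents_def bit_symbol_def)

lemma eval_triE [simp]: "eval x g (triE i) \<sigma> = tri (\<sigma> i)"
  by (simp add: triE_def tri_def)

lemma eval_restE [simp]: "eval x g restE \<sigma> = \<sigma> 1 + 1 + tri (\<sigma> 1)"
  by (simp add: restE_def)

lemma holds_Pow2_Var: "v \<notin> {90, 91} \<Longrightarrow> holds x g (Pow2 (Var v)) \<sigma> \<longleftrightarrow> (\<exists>i. \<sigma> v = 2 ^ i)"
  by (subst holds_Pow2) auto

lemma eval_powersE [simp]: "eval x g (powersE a) \<sigma> = powers (eval x g a \<sigma>)"
  using holds_Pow2_Var[of 21 x g] by (simp add: powersE_def powers_def)

definition chosen :: "bool list \<Rightarrow> nat \<Rightarrow> nat set" where
  "chosen g n = {v. v < n \<and> bit_set g v}"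

lemma sum_of_bool_card: "(\<Sum>i<n. of_bool (P i)) = card {i. i < (n :: nat) \<and> P i}"
  by (simp add: sum_of_bool_eq Int_def)

lemma eval_lowE: "eval x g lowE \<sigma> = low_value x (\<sigma> 1 + 1 + tri (\<sigma> 1)) (\<sigma> 1)"
  unfolding low_value_def lowE_def eval.simps
  by (rule sum.cong) (use holds_Pow2_Var[of 5 x g] in \<open>auto simp: bit_set_def\<close>)

lemma edges_iff_bit_set:
  assumes "n + 1 + tri n < length x" "i < n" "j < n"
  shows "{i, j} \<in> edges x n \<longleftrightarrow> j < i \<and> bit_set x (n + 1 + (tri i + j)) \<or> i < j \<and> bit_set x (n + 1 + (tri j + i))"
proof -
  have 1: "{i, j} \<in> edges x n \<longleftrightarrow> bit_set x (n + 1 + (tri i + j))" if "i < n" "j < i" for i j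
    using edges_iff[OF that] tri_less[OF that] assms(1) by (simp add: bit_set_def)
  consider "j < i" | "i < j" | "i = j" by linarith
  then show ?thesis
  proof cases
    case 3
    have "{j} \<notin> edges x n"
      using simple_graph_edges[of n x] unfolding simple_graph_def by fastforce
    then show ?thesis using 3 by simp
  next
    case 2
    then show ?thesis using 1[OF assms(3) 2] by (simp add: insert_commute)
  qed (use 1[OF assms(2)] in simp)
qed

lemma eval_verifyE:
  assumes "\<sigma> 0 = length x"
  shows "holds x g (verifyE k) \<sigma> \<longleftrightarrow> (\<exists>n. decodes x n (edges x n) (bits_value (drop (n + 1 + tri n) x)) \<and>
    limited_dominating_set k {..<n} (edges x n) (chosen g n) \<and>
    card (chosen g n) \<le> bits_value (drop (n + 1 + tri n) x))"
proof -
  let ?adj = "\<lambda>n i j. j < i \<and> bit_set x (n + 1 + (tri i + j)) \<or> i < j \<and> bit_set x (n + 1 + (tri j + i))"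
  let ?s = "\<lambda>n. n + 1 + tri n"
  have "holds x g (verifyE k) \<sigma> \<longleftrightarrow> (\<exists>n<length x. ?s n < length x \<and> (\<forall>i<n. bit_set x i) \<and> \<not> bit_set x n \<and> bit_set x (length x - 1) \<and>
    ((\<Sum>v<n. of_bool (bit_set g v)) \<le> low_value x (?s n) n \<or>
      (\<exists>i<length x - ?s n. bit_set x (?s n + i) \<and> powers (n + 1) \<le> i)) \<and>
    (\<forall>v<n. bit_set g v \<or> (\<exists>u<n. bit_set g u \<and> ?adj n v u)) \<and>
    (\<forall>v<n. bit_set g v \<longrightarrow> (\<Sum>u<n. of_bool (?adj n v u \<and> \<not> bit_set g u)) \<le> k))"
    unfolding verifyE_def using assms
    by (simp add: sizeE_def eval_lowE highE_def adjacentE_def edgeE_def) blast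
  also have "\<dots> \<longleftrightarrow> (\<exists>n. decodes x n (edges x n) (bits_value (drop (?s n) x)) \<and>
    limited_dominating_set k {..<n} (edges x n) (chosen g n) \<and>
    card (chosen g n) \<le> bits_value (drop (?s n) x))"
  proof (intro ex_cong1)
    fix n
    show "(n < length x \<and> ?s n < length x \<and> (\<forall>i<n. bit_set x i) \<and> \<not> bit_set x n \<and> bit_set x (length x - 1) \<and>
      ((\<Sum>v<n. of_bool (bit_set g v)) \<le> low_value x (?s n) n \<or>
        (\<exists>i<length x - ?s n. bit_set x (?s n + i) \<and> powers (n + 1) \<le> i)) \<and>
      (\<forall>v<n. bit_set g v \<or> (\<exists>u<n. bit_set g u \<and> ?adj n v u)) \<and>
      (\<forall>v<n. bit_set g v \<longrightarrow> (\<Sum>u<n. of_bool (?adj n v u \<and> \<not> bit_set g u)) \<le> k)) \<longleftrightarrow>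
      decodes x n (edges x n) (bits_value (drop (?s n) x)) \<and>
      limited_dominating_set k {..<n} (edges x n) (chosen g n) \<and>
      card (chosen g n) \<le> bits_value (drop (?s n) x)"
    proof (cases "?s n < length x")
      case True
      let ?D = "chosen g n"
      have decodes: "decodes x n (edges x n) (bits_value (drop (?s n) x)) \<longleftrightarrow>
        (\<forall>i<n. bit_set x i) \<and> \<not> bit_set x n \<and> bit_set x (length x - 1)"
        using True edges_iff by (auto simp: decodes_def bit_set_def)
      have "(\<Sum>v<n. of_bool (bit_set g v)) = card ?D"
        by (simp add: sum_of_bool_card chosen_def)
      \<comment> \<open>A set has at most \<open>n\<close> members, which is why bits of weight up
        to \<open>n\<close> suffice for the comparison.\<close>
      moreover have "card ?D \<le> card {..<n}"
        by (intro card_mono) (auto simp: chosen_def)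
      ultimately have size: "((\<Sum>v<n. of_bool (bit_set g v)) \<le> low_value x (?s n) n \<or>
        (\<exists>i<length x - ?s n. bit_set x (?s n + i) \<and> powers (n + 1) \<le> i)) \<longleftrightarrow> card ?D \<le> bits_value (drop (?s n) x)"
        using le_bits_value_iff[of "card ?D" n "?s n" x] True by (auto simp: bit_set_def)
      have adj: "?adj n v u \<longleftrightarrow> {v, u} \<in> edges x n" if "v < n" "u < n" for v u
        using edges_iff_bit_set[OF True that] by blast
      have nbr: "u < n" if "u \<in> neighborhood (edges x n) v" for u v
        using that simple_graph_edges[of n x] by (auto simp: neighborhood_def simple_graph_def)
      have "(\<forall>v<n. bit_set g v \<or> (\<exists>u<n. bit_set g u \<and> ?adj n v u)) \<longleftrightarrow>
        (\<forall>v<n. bit_set g v \<or> (\<exists>u<n. bit_set g u \<and> {v, u} \<in> edges x n))"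
        using adj by blast
      also have "\<dots> \<longleftrightarrow> dominating_set {..<n} (edges x n) ?D"
        unfolding dominating_set_def chosen_def neighborhood_def by auto
      finally have dom: "(\<forall>v<n. bit_set g v \<or> (\<exists>u<n. bit_set g u \<and> ?adj n v u)) \<longleftrightarrow>
        dominating_set {..<n} (edges x n) ?D" .
      have "(\<Sum>u<n. of_bool (?adj n v u \<and> \<not> bit_set g u)) = card (neighborhood (edges x n) v - ?D)" if "v < n" for v
      proof -
        have "{u. u < n \<and> ?adj n v u \<and> \<not> bit_set g u} = neighborhood (edges x n) v - ?D"
          using adj[OF that] nbr[of _ v] by (auto simp: chosen_def neighborhood_def)
        then show ?thesis by (simp add: sum_of_bool_card)
      qed
      then have lim: "(\<forall>v<n. bit_set g v \<longrightarrow> (\<Sum>u<n. of_bool (?adj n v u \<and> \<not> bit_set g u)) \<le> k) \<longleftrightarrow>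
        (\<forall>v\<in>?D. card (neighborhood (edges x n) v - ?D) \<le> k)"
        by (auto simp: chosen_def)
      show ?thesis
        unfolding size dom lim decodes limited_dominating_set_def using True by auto
    next
      case False
      then show ?thesis by (auto simp: decodes_def)
    qed
  qed
  finally show ?thesis .
qed

theorem LIMITED_DOMINATING_SET_in_NP: "LIMITED_DOMINATING_SET k \<in> NP"
proof (rule NP_guess)
  fix x assume "x \<in> LIMITED_DOMINATING_SET k"
  then obtain n E l D where x: "x = encode_instance n E l" "simple_graph {..<n} E" "1 \<le> l"
    and D: "limited_dominating_set k {..<n} E D" "card D \<le> l"
    unfolding LIMITED_DOMINATING_SET_def by blast
  let ?g = "map (\<lambda>v. v \<in> D) [0..<n]"
  have d: "decodes x n E l" using decodes_encode_instance x by simp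
  have eq: "{i, j} \<in> edges x n \<longleftrightarrow> {i, j} \<in> E" if "i < n" "j < i" for i j
    using edges_iff[OF that] d that by (simp add: decodes_def)
  have "E \<subseteq> edges x n"
    by (rule simple_graph_subsetI[OF x(2)]) (simp add: eq)
  moreover have "edges x n \<subseteq> E"
    by (rule simple_graph_subsetI[OF simple_graph_edges]) (simp add: eq)
  ultimately have E: "edges x n = E" by blast
  have l: "bits_value (drop (n + 1 + tri n) x) = l" using d by (simp add: decodes_def)
  have "D \<subseteq> {..<n}" using D(1) by (simp add: limited_dominating_set_def dominating_set_def)
  then have "chosen ?g n = D" by (auto simp: chosen_def bit_set_def)
  then have "holds x ?g (verifyE k) (\<lambda>_. length x)"
    using d D E l by (subst eval_verifyE) auto
  moreover have "length ?g \<le> length x" using d by (simp add: decodes_def)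
  ultimately show "\<exists>g. length g \<le> length x \<and> holds x g (verifyE k) (\<lambda>_. length x)" by blast
next
  fix x g assume "holds x g (verifyE k) (\<lambda>_. length x)"
  then obtain n where n: "decodes x n (edges x n) (bits_value (drop (n + 1 + tri n) x))"
    "limited_dominating_set k {..<n} (edges x n) (chosen g n)"
    "card (chosen g n) \<le> bits_value (drop (n + 1 + tri n) x)"
    by (subst (asm) eval_verifyE) auto
  note x = encode_instance_decodes[OF n(1)]
  show "x \<in> LIMITED_DOMINATING_SET k"
    unfolding LIMITED_DOMINATING_SET_def mem_Collect_eq
  proof (intro exI conjI)
    show "x = encode_instance n (edges x n) (bits_value (drop (n + 1 + tri n) x))"
      "1 \<le> bits_value (drop (n + 1 + tri n) x)"
      using x by simp_all
  qed (use n(2,3) simple_graph_edges in simp_all)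
qed

section \<open>NP-completeness\<close>

theorem theorem5:
  fixes k :: nat
  assumes "k \<ge> 2"
  shows "NP_complete (LIMITED_DOMINATING_SET k)"
  unfolding NP_complete_def
  using LIMITED_DOMINATING_SET_in_NP NP_hard_LIMITED_DOMINATING_SET[OF assms] by blast

end
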